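(* Let $n\geqslant 3$ and let $(M^{n},g,X,\lambda)$ be a Riemann soliton with $M$ compact (without boundary). Then the soliton is trivial, i.e. $\mathcal{L}_{X}g=0$.
   Context: A Riemann soliton $(M^{n},g,X,\lambda)$, $n\geqslant3$, is a (connected, smooth) Riemannian manifold $(M^{n},g)$ together with a smooth vector field $X\in\mathfrak{X}(M)$ and a real number $\lambda\in\mathbb{R}$ such that $$Rm+\tfrac{1}{2}\mathcal{L}_{X}g\odot g=\lambda G,\qquad G=\tfrac12\, g\odot g,$$ where $Rm$ is the Riemann curvature $(0,4)$-tensor of $g$, with sign convention such that a metric of constant sectional curvature $c$ has $Rm=\frac{c}{2}g\odot g$, $\mathcal{L}_{X}g$ is the Lie derivative of $g$ in the direction of $X$, and $\odot$ is the Kulkarni-Nomizu product of symmetric $(0,2)$-tensors: $(A\odot B)(X_{1},X_{2},X_{3},X_{4})=A(X_{1},X_{3})B(X_{2},X_{4})+A(X_{2},X_{4})B(X_{1},X_{3})-A(X_{1},X_{4})B(X_{2},X_{3})-A(X_{2},X_{3})B(X_{1},X_{4})$. A Riemann soliton is called trivial if $\mathcal{L}_{X}g=0$. *)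

theory Defs
  imports "HOL-Analysis.Analysis"
begin

text \<open>Tensor fields on a smooth manifold are given in the classical way: one family of
  components, as functions of the coordinates, for each chart of an atlas, related on overlaps
  by the tensor transformation law.\<close>

section \<open>Smooth maps and smooth manifolds\<close>

text \<open>Meant for open sets in finite-dimensional spaces, where requiring every directional
  derivative to be \<open>C^k\<close> gives the usual notion of a \<open>C^(k+1)\<close> map.\<close>

fun Ck_on :: "nat \<Rightarrow> 'a::real_normed_vector set \<Rightarrow> ('a \<Rightarrow> 'b::real_normed_vector) \<Rightarrow> bool" where
  "Ck_on 0 S f \<longleftrightarrow> continuous_on S f"
| "Ck_on (Suc k) S f \<longleftrightarrow>
     (\<forall>x\<in>S. f differentiable (at x)) \<and> (\<forall>v. Ck_on k S (\<lambda>x. frechet_derivative f (at x) v))"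

definition smooth_on :: "'a::real_normed_vector set \<Rightarrow> ('a \<Rightarrow> 'b::real_normed_vector) \<Rightarrow> bool" where
  "smooth_on S f \<longleftrightarrow> (\<forall>k. Ck_on k S f)"

text \<open>A chart is a pair of its domain and its coordinate map; the values of the map outside the
  domain are irrelevant.\<close>

type_synonym ('m, 'n) chart = "'m set \<times> ('m \<Rightarrow> real ^ 'n)"

definition chart_image :: "('m, 'n::finite) chart \<Rightarrow> (real ^ 'n) set" where
  "chart_image c = snd c ` fst c"

definition chart_inv :: "('m, 'n::finite) chart \<Rightarrow> real ^ 'n \<Rightarrow> 'm" where
  "chart_inv c = inv_into (fst c) (snd c)"

definition overlap :: "('m, 'n::finite) chart \<Rightarrow> ('m, 'n) chart \<Rightarrow> (real ^ 'n) set" where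
  "overlap c d = snd c ` (fst c \<inter> fst d)"

definition transition :: "('m, 'n::finite) chart \<Rightarrow> ('m, 'n) chart \<Rightarrow> real ^ 'n \<Rightarrow> real ^ 'n" where
  "transition c d = snd d \<circ> chart_inv c"

definition jacobian :: "('m, 'n::finite) chart \<Rightarrow> ('m, 'n) chart \<Rightarrow> real ^ 'n \<Rightarrow> real ^ 'n ^ 'n" where
  "jacobian c d x = matrix (frechet_derivative (transition c d) (at x))"

text \<open>The underlying space of the manifold is the whole type \<open>'m\<close>, and its dimension is
  \<open>CARD('n)\<close>. All charts map onto open subsets of Euclidean space, so there is no boundary.
  The atlas need not be maximal.\<close>

definition smooth_atlas ::
  "('m::{t2_space, second_countable_topology}, 'n::finite) chart set \<Rightarrow> bool" where
  "smooth_atlas A \<longleftrightarrow>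
     (\<Union>c\<in>A. fst c) = UNIV \<and>
     (\<forall>c\<in>A. open (fst c) \<and> open (chart_image c) \<and>
        homeomorphism (fst c) (chart_image c) (snd c) (chart_inv c)) \<and>
     (\<forall>c\<in>A. \<forall>d\<in>A. smooth_on (overlap c d) (transition c d))"

section \<open>Vector fields and Riemannian metrics\<close>

text \<open>The vector \<open>X c x\<close> holds the components with respect to the coordinate frame of the chart
  \<open>c\<close> at the point with coordinates \<open>x\<close>; likewise \<open>g c x $ i $ j\<close> for a metric. Only values at
  \<open>x \<in> chart_image c\<close> matter.\<close>

definition smooth_vector_field ::
  "('m, 'n::finite) chart set \<Rightarrow> (('m, 'n) chart \<Rightarrow> real ^ 'n \<Rightarrow> real ^ 'n) \<Rightarrow> bool" where
  "smooth_vector_field A X \<longleftrightarrow>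
     (\<forall>c\<in>A. smooth_on (chart_image c) (X c)) \<and>
     (\<forall>c\<in>A. \<forall>d\<in>A. \<forall>x\<in>overlap c d. X d (transition c d x) = jacobian c d x *v X c x)"

definition riemannian_metric ::
  "('m, 'n::finite) chart set \<Rightarrow> (('m, 'n) chart \<Rightarrow> real ^ 'n \<Rightarrow> real ^ 'n ^ 'n) \<Rightarrow> bool" where
  "riemannian_metric A g \<longleftrightarrow>
     (\<forall>c\<in>A. smooth_on (chart_image c) (g c)) \<and>
     (\<forall>c\<in>A. \<forall>x\<in>chart_image c.
        transpose (g c x) = g c x \<and> (\<forall>v. v \<noteq> 0 \<longrightarrow> v \<bullet> (g c x *v v) > 0)) \<and>
     (\<forall>c\<in>A. \<forall>d\<in>A. \<forall>x\<in>overlap c d.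
        g c x = transpose (jacobian c d x) ** g d (transition c d x) ** jacobian c d x)"

section \<open>Curvature and Lie derivative in coordinates\<close>

definition partial_deriv :: "'n::finite \<Rightarrow> (real ^ 'n \<Rightarrow> real) \<Rightarrow> real ^ 'n \<Rightarrow> real" where
  "partial_deriv i f x = frechet_derivative f (at x) (axis i 1)"

text \<open>Christoffel symbols of the Levi-Civita connection: \<open>christoffel G x k i j\<close> is the
  \<open>k\<close>-th component of the covariant derivative of the \<open>j\<close>-th coordinate field along the
  \<open>i\<close>-th one.\<close>

definition christoffel ::
  "(real ^ 'n \<Rightarrow> real ^ 'n ^ 'n) \<Rightarrow> real ^ 'n \<Rightarrow> 'n::finite \<Rightarrow> 'n \<Rightarrow> 'n \<Rightarrow> real" where
  "christoffel G x k i j = (1 / 2) * (\<Sum>l\<in>UNIV. matrix_inv (G x) $ k $ l *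
     (partial_deriv i (\<lambda>y. G y $ j $ l) x + partial_deriv j (\<lambda>y. G y $ i $ l) x
      - partial_deriv l (\<lambda>y. G y $ i $ j) x))"

text \<open>\<open>curvature_op G x i j k l\<close> is the \<open>l\<close>-th component of \<open>R(e\<^sub>i, e\<^sub>j) e\<^sub>k\<close>, where the \<open>e\<^sub>i\<close> are
  the coordinate fields and \<open>R(Y, Z) W = \<nabla>\<^sub>Y \<nabla>\<^sub>Z W - \<nabla>\<^sub>Z \<nabla>\<^sub>Y W - \<nabla>\<^bsub>[Y, Z]\<^esub> W\<close>.\<close>

definition curvature_op ::
  "(real ^ 'n \<Rightarrow> real ^ 'n ^ 'n) \<Rightarrow> real ^ 'n \<Rightarrow> 'n::finite \<Rightarrow> 'n \<Rightarrow> 'n \<Rightarrow> 'n \<Rightarrow> real" where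
  "curvature_op G x i j k l =
     partial_deriv i (\<lambda>y. christoffel G y l j k) x - partial_deriv j (\<lambda>y. christoffel G y l i k) x
     + (\<Sum>m\<in>UNIV. christoffel G x m j k * christoffel G x l i m
                  - christoffel G x m i k * christoffel G x l j m)"

text \<open>\<open>Rm(Y, Z, V, W) = g(R(Y, Z) W, V)\<close>: for constant sectional curvature \<open>c\<close>, where
  \<open>R(Y, Z) W = c (g(Z, W) Y - g(Y, W) Z)\<close>, this is \<open>c/2\<close> times the Kulkarni-Nomizu square of
  \<open>g\<close>.\<close>

definition riemann_curvature ::
  "(real ^ 'n \<Rightarrow> real ^ 'n ^ 'n) \<Rightarrow> real ^ 'n \<Rightarrow> 'n::finite \<Rightarrow> 'n \<Rightarrow> 'n \<Rightarrow> 'n \<Rightarrow> real" where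
  "riemann_curvature G x i j k l = (\<Sum>m\<in>UNIV. G x $ k $ m * curvature_op G x i j l m)"

definition lie_deriv_metric ::
  "(real ^ 'n \<Rightarrow> real ^ 'n ^ 'n) \<Rightarrow> (real ^ 'n \<Rightarrow> real ^ 'n) \<Rightarrow> real ^ 'n \<Rightarrow> 'n::finite \<Rightarrow> 'n \<Rightarrow> real" where
  "lie_deriv_metric G V x i j =
     (\<Sum>k\<in>UNIV. V x $ k * partial_deriv k (\<lambda>y. G y $ i $ j) x
               + G x $ k $ j * partial_deriv i (\<lambda>y. V y $ k) x
               + G x $ i $ k * partial_deriv j (\<lambda>y. V y $ k) x)"

definition kulkarni_nomizu ::
  "('v \<Rightarrow> 'v \<Rightarrow> real) \<Rightarrow> ('v \<Rightarrow> 'v \<Rightarrow> real) \<Rightarrow> 'v \<Rightarrow> 'v \<Rightarrow> 'v \<Rightarrow> 'v \<Rightarrow> real"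
  (infixl "\<odot>" 70) where
  "(P \<odot> Q) x1 x2 x3 x4 =
     P x1 x3 * Q x2 x4 + P x2 x4 * Q x1 x3 - P x1 x4 * Q x2 x3 - P x2 x3 * Q x1 x4"

section \<open>Riemann solitons\<close>

definition riemann_soliton ::
  "('m::{t2_space, second_countable_topology}, 'n::finite) chart set \<Rightarrow>
   (('m, 'n) chart \<Rightarrow> real ^ 'n \<Rightarrow> real ^ 'n ^ 'n) \<Rightarrow>
   (('m, 'n) chart \<Rightarrow> real ^ 'n \<Rightarrow> real ^ 'n) \<Rightarrow> real \<Rightarrow> bool" where
  "riemann_soliton A g X lam \<longleftrightarrow>
     smooth_atlas A \<and> connected (UNIV :: 'm set) \<and>
     riemannian_metric A g \<and> smooth_vector_field A X \<and>
     (\<forall>c\<in>A. \<forall>x\<in>chart_image c. \<forall>i j k l.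
        (let gx = (\<lambda>i j. g c x $ i $ j) in
         riemann_curvature (g c) x i j k l
         + (1 / 2) * (lie_deriv_metric (g c) (X c) x \<odot> gx) i j k l
         = lam * ((1 / 2) * (gx \<odot> gx) i j k l)))"

definition trivial_soliton ::
  "('m, 'n::finite) chart set \<Rightarrow>
   (('m, 'n) chart \<Rightarrow> real ^ 'n \<Rightarrow> real ^ 'n ^ 'n) \<Rightarrow>
   (('m, 'n) chart \<Rightarrow> real ^ 'n \<Rightarrow> real ^ 'n) \<Rightarrow> bool" where
  "trivial_soliton A g X \<longleftrightarrow>
     (\<forall>c\<in>A. \<forall>x\<in>chart_image c. \<forall>i j. lie_deriv_metric (g c) (X c) x i j = 0)"

end

theory Submission
  imports Defs
begin

text \<open>Put \<open>P = (\<lambda>/2) g - (1/2) L\<^sub>X g\<close>, so that \<open>Rm = P \<odot> g\<close>, and let \<open>J = tr P\<close>, so that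
  \<open>div X = n \<lambda>/2 - J\<close>. The contracted second Bianchi identity gives \<open>div P = dJ\<close>. With the Ricci
  identity for \<open>\<nabla>X\<close> this becomes \<open>2 Ric(X) = div w\<close>, where \<open>w\<close> is twice the antisymmetric part of \<open>\<nabla>X\<close>;
  since \<open>div div w = 0\<close>, also \<open>div Ric(X) = 0\<close>, which expands to
  \<open>(n - 1) X(J) = (n - 2) |P|\<^sup>2 + J\<^sup>2 - (n - 1) \<lambda> J\<close>.
  As \<open>|P|\<^sup>2 \<ge> J\<^sup>2/n\<close>, at a maximum or minimum of \<open>J\<close> this forces \<open>J (J - n \<lambda>/2) \<le> 0\<close>. Hence
  \<open>J\<close> never exceeds \<open>n \<lambda>/2\<close> if \<open>\<lambda> \<ge> 0\<close> and never falls below it if \<open>\<lambda> < 0\<close>, so \<open>div X\<close> has one sign and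
  vanishes by the divergence theorem. Now \<open>J = n \<lambda>/2\<close> is constant, the
  displayed identity reads \<open>|P|\<^sup>2 = J\<^sup>2/n\<close>, and this equality case means \<open>P = (\<lambda>/2) g\<close>.\<close>

section \<open>Calculus of \<open>C^k\<close> maps\<close>

text \<open>The argument is of first order in \<open>J\<close>: when \<open>div P = dJ\<close> meets
  the Ricci identity, the gradient terms cancel because \<open>d(div X) = -dJ\<close>. No Laplacian
  of \<open>J\<close> is left, so an extremum is used only through \<open>dJ = 0\<close>, and the
  sign condition there confines all values of \<open>J\<close> to the interval between
  \<open>0\<close> and \<open>n \<lambda>/2\<close>. Passing to \<open>div div w = 0\<close> is what
  turns the resulting vector equation into a scalar one without integrating. Two global points shape
  the rest. \<open>J\<close> is built chart by chart, so the transformation law of the Lie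
  derivative is needed to make it a function on the manifold. In the divergence theorem no global
  integral is defined: only functions supported in a single chart are integrated, against the
  density \<open>sqrt (det g)\<close>, and such integrals are compared through a partition of unity.
  Densities transform with \<open>|det|\<close>, so no orientation is chosen, and \<open>C^1\<close>
  bump functions suffice because each is differentiated once.\<close>

lemma frechet_derivative_cong_open:
  assumes "open S" "x \<in> S" "\<And>y. y \<in> S \<Longrightarrow> f y = g y"
  shows "f differentiable (at x) \<longleftrightarrow> g differentiable (at x)"
    and "frechet_derivative f (at x) = frechet_derivative g (at x)"
proof -
  have *: "(f has_derivative D) (at x) \<longleftrightarrow> (g has_derivative D) (at x)" for D
    using has_derivative_transform_within_open[of f D x UNIV S g] has_derivative_transform_within_open[of g D x UNIV S f] assms
    by auto
  then show "f differentiable (at x) \<longleftrightarrow> g differentiable (at x)"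
    by (auto simp: differentiable_def)
  show "frechet_derivative f (at x) = frechet_derivative g (at x)"
    unfolding frechet_derivative_def * ..
qed

lemma Ck_on_cong:
  assumes "open S" "\<And>y. y \<in> S \<Longrightarrow> f y = g y"
  shows "Ck_on k S f \<longleftrightarrow> Ck_on k S g"
  using assms(2)
proof (induction k arbitrary: f g)
  case 0
  then show ?case by (simp cong: continuous_on_cong)
next
  case (Suc k)
  have "Ck_on k S (\<lambda>x. frechet_derivative f (at x) v) \<longleftrightarrow> Ck_on k S (\<lambda>x. frechet_derivative g (at x) v)" for v
    by (rule Suc.IH) (simp add: frechet_derivative_cong_open(2)[OF assms(1) _ Suc.prems])
  then show ?case
    using frechet_derivative_cong_open(1)[OF assms(1) _ Suc.prems] by auto
qed

lemma Ck_on_SucD: "Ck_on (Suc k) S f \<Longrightarrow> Ck_on k S f"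
proof (induction k arbitrary: f)
  case 0
  then show ?case
    by (auto intro!: continuous_at_imp_continuous_on differentiable_imp_continuous_within)
next
  case (Suc k)
  then show ?case by auto
qed

lemma Ck_on_le:
  assumes "Ck_on k S f" "j \<le> k" shows "Ck_on j S f"
  using assms(2,1) by (induction rule: inc_induct) (blast intro: Ck_on_SucD)+

lemma Ck_on_const: "Ck_on k S (\<lambda>x. c)"
  by (induction k arbitrary: c) auto

text \<open>By uniqueness of the derivative an explicit formula \<open>D\<close> may stand in for
  \<open>frechet_derivative\<close>. The closure rules below are inductions on the order built on
  this: the formula supplied by the calculus rule involves only maps already known to be of order
  \<open>k\<close>.\<close>

lemma Ck_on_SucI:
  assumes "open S" and D: "\<And>x. x \<in> S \<Longrightarrow> (f has_derivative D x) (at x)"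
    and k: "\<And>v. Ck_on k S (\<lambda>x. D x v)"
  shows "Ck_on (Suc k) S f"
proof -
  have eq: "D x v = frechet_derivative f (at x) v" if "x \<in> S" for x v
    using frechet_derivative_at[OF D[OF that]] by (rule fun_cong)
  have "Ck_on k S (\<lambda>x. frechet_derivative f (at x) v)" for v
    using Ck_on_cong[OF \<open>open S\<close>, where f="\<lambda>x. D x v", OF eq] k by blast
  then show ?thesis using D by (auto simp: differentiable_def)
qed

lemma Ck_on_has_derivative:
  "Ck_on (Suc k) S f \<Longrightarrow> x \<in> S \<Longrightarrow> (f has_derivative frechet_derivative f (at x)) (at x)"
  by (auto simp: frechet_derivative_works[symmetric])

lemma Ck_on_add:
  assumes "open S" "Ck_on k S f" "Ck_on k S g"
  shows "Ck_on k S (\<lambda>x. f x + g x)"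
  using assms(2,3)
proof (induction k arbitrary: f g)
  case 0
  then show ?case by (auto intro: continuous_intros)
next
  case (Suc k)
  have c: "Ck_on k S (\<lambda>x. frechet_derivative f (at x) v + frechet_derivative g (at x) v)" for v
    using Suc by auto
  have d: "((\<lambda>x. f x + g x) has_derivative (\<lambda>v. frechet_derivative f (at x) v + frechet_derivative g (at x) v)) (at x)"
    if "x \<in> S" for x
    using that Suc.prems by (intro has_derivative_add Ck_on_has_derivative)
  from d c show ?case by (rule Ck_on_SucI[OF assms(1)])
qed

lemma Ck_on_linear:
  assumes "open S" "bounded_linear L" "Ck_on k S f"
  shows "Ck_on k S (\<lambda>x. L (f x))"
  using assms(3)
proof (induction k arbitrary: f)
  case 0
  then show ?case using assms(2) by (auto intro: bounded_linear.continuous_on)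
next
  case (Suc k)
  have d: "((\<lambda>x. L (f x)) has_derivative (\<lambda>v. L (frechet_derivative f (at x) v))) (at x)" if "x \<in> S" for x
    using that Suc.prems by (intro bounded_linear.has_derivative[OF assms(2)] Ck_on_has_derivative)
  have "Ck_on k S (\<lambda>x. L (frechet_derivative f (at x) v))" for v
    using Suc by auto
  with d show ?case by (rule Ck_on_SucI[OF assms(1)])
qed

lemma Ck_on_mult:
  fixes f g :: "'a::real_normed_vector \<Rightarrow> real"
  assumes "open S" "Ck_on k S f" "Ck_on k S g"
  shows "Ck_on k S (\<lambda>x. f x * g x)"
  using assms(2,3)
proof (induction k arbitrary: f g)
  case 0
  then show ?case by (auto intro: continuous_intros)
next
  case (Suc k)
  have d: "((\<lambda>x. f x * g x) has_derivative (\<lambda>v. f x * frechet_derivative g (at x) v + frechet_derivative f (at x) v * g x)) (at x)"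
    if "x \<in> S" for x
    using that Suc.prems by (intro has_derivative_mult Ck_on_has_derivative)
  have "Ck_on k S (\<lambda>x. f x * frechet_derivative g (at x) v + frechet_derivative f (at x) v * g x)" for v
    using Suc Ck_on_SucD[OF Suc.prems(1)] Ck_on_SucD[OF Suc.prems(2)] by (intro Ck_on_add assms) auto
  with d show ?case by (rule Ck_on_SucI[OF assms(1)])
qed

text \<open>The derivative contains the inverse of \<open>f\<close> itself, so the induction runs
  with \<open>f\<close> fixed; \<open>Ck_on_sqrt\<close> works in the same way.\<close>

lemma Ck_on_inverse:
  fixes f :: "'a::real_normed_vector \<Rightarrow> real"
  assumes "open S" "Ck_on k S f" "\<And>x. x \<in> S \<Longrightarrow> f x \<noteq> 0"
  shows "Ck_on k S (\<lambda>x. inverse (f x))"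
  using assms(2)
proof (induction k)
  case 0
  then show ?case using assms(3) by (auto intro: continuous_intros)
next
  case (Suc k)
  have d: "((\<lambda>x. inverse (f x)) has_derivative (\<lambda>v. (-1) * (inverse (f x) * frechet_derivative f (at x) v * inverse (f x)))) (at x)"
    if "x \<in> S" for x
    using Deriv.has_derivative_inverse[OF assms(3)[OF that] Ck_on_has_derivative[OF Suc.prems that]] by simp
  have "Ck_on k S (\<lambda>x. (-1) * (inverse (f x) * frechet_derivative f (at x) v * inverse (f x)))" for v
    using Suc.IH[OF Ck_on_SucD[OF Suc.prems]] Suc.prems by (intro Ck_on_mult Ck_on_const assms) auto
  with d show ?case by (rule Ck_on_SucI[OF assms(1)])
qed

lemma Ck_on_divide:
  fixes f :: "'a::real_normed_vector \<Rightarrow> real"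
  assumes "open S" "Ck_on k S f" "Ck_on k S g" "\<And>x. x \<in> S \<Longrightarrow> g x \<noteq> 0"
  shows "Ck_on k S (\<lambda>x. f x / g x)"
  using Ck_on_mult[OF assms(1,2) Ck_on_inverse[OF assms(1,3,4)]] by (simp add: divide_inverse)

lemma Ck_on_sqrt:
  fixes f :: "'a::real_normed_vector \<Rightarrow> real"
  assumes "open S" "Ck_on k S f" "\<And>x. x \<in> S \<Longrightarrow> f x > 0"
  shows "Ck_on k S (\<lambda>x. sqrt (f x))"
  using assms(2)
proof (induction k)
  case 0
  then show ?case by (auto intro: continuous_intros)
next
  case (Suc k)
  have d: "((\<lambda>x. sqrt (f x)) has_derivative (\<lambda>v. inverse (sqrt (f x)) / 2 * frechet_derivative f (at x) v)) (at x)"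
    if "x \<in> S" for x
  proof -
    have "(f has_derivative frechet_derivative f (at x)) (at x)"
      using Suc.prems that by (rule Ck_on_has_derivative)
    moreover have "(sqrt has_derivative (*) (inverse (sqrt (f x)) / 2)) (at (f x))"
      using DERIV_real_sqrt[OF assms(3)[OF that]] by (simp add: has_field_derivative_def)
    ultimately have "(sqrt \<circ> f has_derivative (*) (inverse (sqrt (f x)) / 2) \<circ> frechet_derivative f (at x)) (at x)"
      by (rule diff_chain_at)
    then show ?thesis by (simp add: o_def)
  qed
  have "sqrt (f x) \<noteq> 0" if "x \<in> S" for x
    using assms(3)[OF that] by simp
  then have "Ck_on k S (\<lambda>x. inverse (sqrt (f x)) / 2 * frechet_derivative f (at x) v)" for v
    using Suc.IH[OF Ck_on_SucD[OF Suc.prems]] Suc.prems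
    by (intro Ck_on_mult Ck_on_const Ck_on_inverse Ck_on_divide assms(1)) auto
  with d show ?case by (rule Ck_on_SucI[OF assms(1)])
qed

lemma Ck_on_minus:
  fixes f :: "'a::real_normed_vector \<Rightarrow> real"
  assumes "open S" "Ck_on k S f" shows "Ck_on k S (\<lambda>x. - f x)"
  using Ck_on_linear[OF assms(1) bounded_linear_minus[OF bounded_linear_ident] assms(2)] by simp

lemma Ck_on_diff:
  fixes f :: "'a::real_normed_vector \<Rightarrow> real"
  assumes "open S" "Ck_on k S f" "Ck_on k S g" shows "Ck_on k S (\<lambda>x. f x - g x)"
  using Ck_on_add[OF assms(1,2) Ck_on_minus[OF assms(1,3)]] by simp

lemma Ck_on_sum:
  assumes "open S" "\<And>i. i \<in> I \<Longrightarrow> Ck_on k S (f i)" shows "Ck_on k S (\<lambda>x. \<Sum>i\<in>I. f i x)"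
proof (cases "finite I")
  case True
  then show ?thesis using assms(2)
    by (induction I) (auto intro: Ck_on_add assms(1) Ck_on_const)
qed (simp add: Ck_on_const)

lemma Ck_on_prod:
  fixes f :: "'i \<Rightarrow> 'a::real_normed_vector \<Rightarrow> real"
  assumes "open S" "\<And>i. i \<in> I \<Longrightarrow> Ck_on k S (f i)" shows "Ck_on k S (\<lambda>x. \<Prod>i\<in>I. f i x)"
proof (cases "finite I")
  case True
  then show ?thesis using assms(2)
    by (induction I) (auto intro: Ck_on_mult assms(1) Ck_on_const)
qed (simp add: Ck_on_const)

lemma Ck_on_det:
  fixes M :: "'a::real_normed_vector \<Rightarrow> real^'n^'n"
  assumes "open S" "\<And>i j. Ck_on k S (\<lambda>x. M x $ i $ j)" shows "Ck_on k S (\<lambda>x. det (M x))"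
  unfolding det_def by (intro Ck_on_sum Ck_on_mult Ck_on_prod Ck_on_const assms)

text \<open>Cramer's rule for the system whose solution is column \<open>l\<close> of the inverse.
  It exhibits the entries of the inverse as quotients of polynomials in the entries of
  \<open>M\<close>, from which smoothness of the inverse metric follows.\<close>

lemma matrix_inv_component:
  fixes M :: "real^'n^'n"
  assumes "det M \<noteq> 0"
  shows "matrix_inv M $ k $ l = det (\<chi> i j. if j = k then axis l 1 $ i else M $ i $ j) / det M"
proof -
  have "M ** matrix_inv M = mat 1"
    using assms invertible_det_nz[of M] unfolding invertible_def matrix_inv_def by (metis (mono_tags, lifting) someI_ex)
  then have "M *v (matrix_inv M *v axis l 1) = axis l 1"
    by (simp add: matrix_vector_mul_assoc)
  then have "matrix_inv M *v axis l 1 = (\<chi> k. det (\<chi> i j. if j = k then axis l 1 $ i else M $ i $ j) / det M)"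
    using cramer[OF assms] by blast
  moreover have "(matrix_inv M *v axis l 1) $ k = matrix_inv M $ k $ l"
    by (simp add: matrix_vector_mult_basis column_def)
  ultimately show ?thesis by simp
qed

lemma Ck_on_matrix_inv:
  fixes M :: "'a::real_normed_vector \<Rightarrow> real^'n^'n"
  assumes "open S" "\<And>i j. Ck_on k S (\<lambda>x. M x $ i $ j)" "\<And>x. x \<in> S \<Longrightarrow> det (M x) \<noteq> 0"
  shows "Ck_on k S (\<lambda>x. matrix_inv (M x) $ a $ b)"
proof -
  have "Ck_on k S (\<lambda>x. (\<chi> i j. if j = a then axis b 1 $ i else M x $ i $ j) $ i $ j)" for i j
    by (cases "j = a") (simp_all add: Ck_on_const assms(2))
  then have "Ck_on k S (\<lambda>x. det (\<chi> i j. if j = a then axis b 1 $ i else M x $ i $ j) / det (M x))"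
    by (intro Ck_on_divide Ck_on_det assms)
  then show ?thesis
    using Ck_on_cong[OF assms(1), of "\<lambda>x. matrix_inv (M x) $ a $ b"] matrix_inv_component[OF assms(3)] by simp
qed

section \<open>Symmetry of second derivatives\<close>

text \<open>The second difference is the increment over \<open>[0, h]\<close> of the map sending
  \<open>s\<close> to \<open>f (x + s u + h v) - f (x + s u)\<close>. The mean value theorem in
  \<open>s\<close> and then in \<open>t\<close> turns it into a mixed derivative at an intermediate
  point.\<close>

lemma second_difference_mean_value:
  fixes f :: "'a::real_normed_vector \<Rightarrow> real"
  assumes "ball x r \<subseteq> S" "Ck_on 2 S f" "h > 0" "h * (norm u + norm v) < r"
  shows "\<exists>y\<in>ball x r. f (x + h *\<^sub>R u + h *\<^sub>R v) - f (x + h *\<^sub>R u) - f (x + h *\<^sub>R v) + f x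
    = h * h * frechet_derivative (\<lambda>z. frechet_derivative f (at z) u) (at y) v"
proof -
  let ?Du = "\<lambda>z. frechet_derivative f (at z) u"
  have in_ball: "x + s *\<^sub>R u + t *\<^sub>R v \<in> ball x r" if "0 \<le> s" "s \<le> h" "0 \<le> t" "t \<le> h" for s t
  proof -
    have "norm (s *\<^sub>R u + t *\<^sub>R v) \<le> s * norm u + t * norm v"
      using norm_triangle_ineq[of "s *\<^sub>R u" "t *\<^sub>R v"] that by simp
    also have "\<dots> \<le> h * norm u + h * norm v"
      using that by (intro add_mono mult_right_mono) auto
    also have "\<dots> < r" using assms(4) by (simp add: algebra_simps)
    finally have "dist (x + (s *\<^sub>R u + t *\<^sub>R v)) x < r" by (simp only: dist_norm add_diff_cancel_left')
    then show ?thesis by (simp add: dist_commute add.assoc)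
  qed
  have f': "(f has_derivative frechet_derivative f (at z)) (at z)"
    and Du': "(?Du has_derivative frechet_derivative ?Du (at z)) (at z)" if "z \<in> ball x r" for z
    using assms(1,2) that Ck_on_has_derivative[of 1 S f z] Ck_on_has_derivative[of 0 S ?Du z]
    by (auto simp: numeral_2_eq_2)
  have d1: "((\<lambda>s. f (x + s *\<^sub>R u + t *\<^sub>R v)) has_real_derivative ?Du (x + s *\<^sub>R u + t *\<^sub>R v)) (at s)"
    if st: "0 \<le> s" "s \<le> h" "0 \<le> t" "t \<le> h" for s t
  proof -
    interpret bounded_linear "frechet_derivative f (at (x + s *\<^sub>R u + t *\<^sub>R v))"
      using f'[OF in_ball[OF st]] by (rule has_derivative_bounded_linear)
    have "((\<lambda>s. x + s *\<^sub>R u + t *\<^sub>R v) has_derivative (\<lambda>k. k *\<^sub>R u)) (at s)"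
      by (auto intro!: derivative_eq_intros)
    from has_derivative_compose[OF this f'[OF in_ball[OF st]]]
    show ?thesis by (simp add: has_field_derivative_def scaleR mult_commute_abs)
  qed
  have d2: "((\<lambda>t. ?Du (x + s *\<^sub>R u + t *\<^sub>R v)) has_real_derivative frechet_derivative ?Du (at (x + s *\<^sub>R u + t *\<^sub>R v)) v) (at t)"
    if st: "0 \<le> s" "s \<le> h" "0 \<le> t" "t \<le> h" for s t
  proof -
    interpret bounded_linear "frechet_derivative ?Du (at (x + s *\<^sub>R u + t *\<^sub>R v))"
      using Du'[OF in_ball[OF st]] by (rule has_derivative_bounded_linear)
    have "((\<lambda>t. x + s *\<^sub>R u + t *\<^sub>R v) has_derivative (\<lambda>k. k *\<^sub>R v)) (at t)"
      by (auto intro!: derivative_eq_intros)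
    from has_derivative_compose[OF this Du'[OF in_ball[OF st]]]
    show ?thesis by (simp add: has_field_derivative_def scaleR mult_commute_abs)
  qed
  have "\<exists>s>0. s < h \<and> (f (x + h *\<^sub>R u + h *\<^sub>R v) - f (x + h *\<^sub>R u + 0 *\<^sub>R v)) - (f (x + 0 *\<^sub>R u + h *\<^sub>R v) - f (x + 0 *\<^sub>R u + 0 *\<^sub>R v))
      = (h - 0) * (?Du (x + s *\<^sub>R u + h *\<^sub>R v) - ?Du (x + s *\<^sub>R u + 0 *\<^sub>R v))"
    by (rule MVT2[OF \<open>h > 0\<close>]) (rule DERIV_diff; rule d1; use \<open>h > 0\<close> in simp)
  then obtain s where s: "0 < s" "s < h"
    "(f (x + h *\<^sub>R u + h *\<^sub>R v) - f (x + h *\<^sub>R u + 0 *\<^sub>R v)) - (f (x + 0 *\<^sub>R u + h *\<^sub>R v) - f (x + 0 *\<^sub>R u + 0 *\<^sub>R v))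
      = (h - 0) * (?Du (x + s *\<^sub>R u + h *\<^sub>R v) - ?Du (x + s *\<^sub>R u + 0 *\<^sub>R v))"
    by blast
  obtain t where t: "0 < t" "t < h"
    "?Du (x + s *\<^sub>R u + h *\<^sub>R v) - ?Du (x + s *\<^sub>R u + 0 *\<^sub>R v)
      = (h - 0) * frechet_derivative ?Du (at (x + s *\<^sub>R u + t *\<^sub>R v)) v"
    using MVT2[of 0 h "\<lambda>t. ?Du (x + s *\<^sub>R u + t *\<^sub>R v)"
      "\<lambda>t. frechet_derivative ?Du (at (x + s *\<^sub>R u + t *\<^sub>R v)) v"] \<open>h > 0\<close> d2 s(1,2)
    by auto
  show ?thesis
    using s t by (intro bexI[of _ "x + s *\<^sub>R u + t *\<^sub>R v"] in_ball) (auto simp: algebra_simps)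
qed

text \<open>The second difference is symmetric in \<open>u\<close> and \<open>v\<close>. Hence the
  mixed derivative in one order at some point equals the one in the other order at another point,
  both arbitrarily close to \<open>x\<close>, and continuity forces equality at
  \<open>x\<close>.\<close>

lemma frechet_derivative_commute:
  fixes f :: "'a::real_normed_vector \<Rightarrow> real"
  assumes "open S" "x \<in> S" "Ck_on 2 S f"
  shows "frechet_derivative (\<lambda>z. frechet_derivative f (at z) u) (at x) v
    = frechet_derivative (\<lambda>z. frechet_derivative f (at z) v) (at x) u"
    (is "?A x = ?B x")
proof (rule ccontr)
  assume ne: "?A x \<noteq> ?B x"
  \<comment> \<open>Half the gap: values within \<open>e\<close> of \<open>?A x\<close> and of
    \<open>?B x\<close> cannot coincide.\<close>
  define e where "e = \<bar>?A x - ?B x\<bar> / 2"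
  have "e > 0" using ne by (simp add: e_def)
  have cont: "continuous_on S ?A" "continuous_on S ?B"
    using assms(3) by (auto simp: numeral_2_eq_2)
  then have "\<forall>\<^sub>F y in at x. dist (?A y) (?A x) < e" "\<forall>\<^sub>F y in at x. dist (?B y) (?B x) < e"
    using \<open>e > 0\<close> assms(1,2) by (auto simp: continuous_on_eq_continuous_at isCont_def intro!: tendstoD)
  then have "\<forall>\<^sub>F y in nhds x. dist (?A y) (?A x) < e \<and> dist (?B y) (?B x) < e \<and> y \<in> S"
    using \<open>e > 0\<close> eventually_nhds_in_open[OF assms(1,2)]
    by (auto simp: eventually_at_filter elim: eventually_elim2 intro: eventually_conj)
  then obtain r where "r > 0" and r: "\<And>y. dist y x < r \<Longrightarrow> dist (?A y) (?A x) < e \<and> dist (?B y) (?B x) < e \<and> y \<in> S"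
    by (auto simp: eventually_nhds_metric)
  then have sub: "ball x r \<subseteq> S" by (auto simp: dist_commute)
  define h where "h = r / (2 * (norm u + norm v + 1))"
  have h: "h > 0" "h * (norm u + norm v) < r" "h * (norm v + norm u) < r"
    using \<open>r > 0\<close> by (auto simp: h_def field_simps add_pos_nonneg intro!: add_nonneg_pos)
  obtain y where y: "y \<in> ball x r" "f (x + h *\<^sub>R u + h *\<^sub>R v) - f (x + h *\<^sub>R u) - f (x + h *\<^sub>R v) + f x = h * h * ?A y"
    using second_difference_mean_value[OF sub assms(3) h(1,2)] by blast
  obtain z where z: "z \<in> ball x r" "f (x + h *\<^sub>R v + h *\<^sub>R u) - f (x + h *\<^sub>R v) - f (x + h *\<^sub>R u) + f x = h * h * ?B z"
    using second_difference_mean_value[OF sub assms(3) h(1,3)] by blast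
  have "x + h *\<^sub>R v + h *\<^sub>R u = x + h *\<^sub>R u + h *\<^sub>R v" by simp
  then have "h * h * ?A y = h * h * ?B z" using y(2) z(2) by (smt (verit))
  then have "?A y = ?B z" using h(1) by simp
  moreover have "dist (?A y) (?A x) < e" "dist (?B z) (?B x) < e"
    using r[of y] r[of z] y(1) z(1) by (auto simp: dist_commute)
  ultimately show False
    by (simp add: e_def dist_real_def) (smt (verit) field_sum_of_halves)
qed

section \<open>Partial derivatives of smooth functions\<close>

lemma partial_deriv_eq: "(f has_derivative D) (at x) \<Longrightarrow> partial_deriv i f x = D (axis i 1)"
  unfolding partial_deriv_def by (simp add: frechet_derivative_at[symmetric])

lemma partial_deriv_cong:
  "open S \<Longrightarrow> x \<in> S \<Longrightarrow> (\<And>y. y \<in> S \<Longrightarrow> f y = g y) \<Longrightarrow> partial_deriv i f x = partial_deriv i g x"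
  unfolding partial_deriv_def by (simp add: frechet_derivative_cong_open(2)[of S x f g])

lemma partial_deriv_const [simp]: "partial_deriv i (\<lambda>x. c) x = 0"
  by (simp add: partial_deriv_def)

lemma partial_deriv_add:
  "f differentiable (at x) \<Longrightarrow> g differentiable (at x) \<Longrightarrow>
    partial_deriv i (\<lambda>x. f x + g x) x = partial_deriv i f x + partial_deriv i g x"
  unfolding partial_deriv_def frechet_derivative_works
  by (subst frechet_derivative_at[symmetric]) (auto intro: has_derivative_add)

lemma partial_deriv_diff:
  "f differentiable (at x) \<Longrightarrow> g differentiable (at x) \<Longrightarrow>
    partial_deriv i (\<lambda>x. f x - g x) x = partial_deriv i f x - partial_deriv i g x"
  unfolding partial_deriv_def frechet_derivative_works
  by (subst frechet_derivative_at[symmetric]) (auto intro: has_derivative_diff)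

lemma partial_deriv_mult:
  "f differentiable (at x) \<Longrightarrow> g differentiable (at x) \<Longrightarrow>
    partial_deriv i (\<lambda>x. f x * g x) x = f x * partial_deriv i g x + partial_deriv i f x * g x"
  unfolding partial_deriv_def frechet_derivative_works
  by (subst frechet_derivative_at[symmetric]) (auto intro: has_derivative_mult)

lemma partial_deriv_sum:
  "(\<And>a. a \<in> I \<Longrightarrow> f a differentiable (at x)) \<Longrightarrow>
    partial_deriv i (\<lambda>x. \<Sum>a\<in>I. f a x) x = (\<Sum>a\<in>I. partial_deriv i (f a) x)"
  unfolding partial_deriv_def frechet_derivative_works
  by (subst frechet_derivative_at[symmetric]) (auto intro: has_derivative_sum)

lemma has_derivative_partial_deriv:
  assumes "(f has_derivative D) (at x)"
  shows "D v = (\<Sum>i\<in>UNIV. v $ i * partial_deriv i f x)"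
proof -
  interpret bounded_linear D using assms by (rule has_derivative_bounded_linear)
  have "D v = D (\<Sum>i\<in>UNIV. v $ i *\<^sub>R axis i 1)"
    using basis_expansion[of v] by (simp add: scalar_mult_eq_scaleR)
  also have "\<dots> = (\<Sum>i\<in>UNIV. v $ i * partial_deriv i f x)"
    by (simp add: sum scaleR partial_deriv_eq[OF assms])
  finally show ?thesis .
qed

lemma smooth_on_differentiable: "smooth_on S f \<Longrightarrow> x \<in> S \<Longrightarrow> f differentiable (at x)"
  unfolding smooth_on_def by (metis Ck_on.simps(2))

lemma smooth_on_partial_deriv: "smooth_on S f \<Longrightarrow> smooth_on S (partial_deriv i f)"
  unfolding smooth_on_def partial_deriv_def[abs_def] by (metis Ck_on.simps(2))

lemma smooth_on_component:
  assumes "open S" "smooth_on S f" shows "smooth_on S (\<lambda>x. f x $ i)"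
  using assms Ck_on_linear[OF _ bounded_linear_vec_nth] unfolding smooth_on_def by blast

lemma smooth_on_const: "smooth_on S (\<lambda>x. c)"
  by (simp add: smooth_on_def Ck_on_const)

lemma smooth_on_add: "open S \<Longrightarrow> smooth_on S f \<Longrightarrow> smooth_on S g \<Longrightarrow> smooth_on S (\<lambda>x. f x + g x)"
  by (simp add: smooth_on_def Ck_on_add)

lemma smooth_on_diff:
  fixes f :: "'a::real_normed_vector \<Rightarrow> real"
  shows "open S \<Longrightarrow> smooth_on S f \<Longrightarrow> smooth_on S g \<Longrightarrow> smooth_on S (\<lambda>x. f x - g x)"
  by (simp add: smooth_on_def Ck_on_diff)

lemma smooth_on_mult:
  fixes f :: "'a::real_normed_vector \<Rightarrow> real"
  shows "open S \<Longrightarrow> smooth_on S f \<Longrightarrow> smooth_on S g \<Longrightarrow> smooth_on S (\<lambda>x. f x * g x)"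
  by (simp add: smooth_on_def Ck_on_mult)

lemma smooth_on_sum:
  "open S \<Longrightarrow> (\<And>i. i \<in> I \<Longrightarrow> smooth_on S (f i)) \<Longrightarrow> smooth_on S (\<lambda>x. \<Sum>i\<in>I. f i x)"
  by (simp add: smooth_on_def Ck_on_sum)

lemma partial_deriv_commute:
  assumes "open S" "x \<in> S" "smooth_on S f"
  shows "partial_deriv i (partial_deriv j f) x = partial_deriv j (partial_deriv i f) x"
  using frechet_derivative_commute[OF assms(1,2)] assms(3)
  unfolding partial_deriv_def[abs_def] smooth_on_def by blast

lemma smooth_on_divide_const:
  fixes f :: "'a::real_normed_vector \<Rightarrow> real"
  assumes "open S" "smooth_on S f" shows "smooth_on S (\<lambda>x. f x / c)"
  using smooth_on_mult[OF assms smooth_on_const[of S "inverse c"]] by (simp add: divide_inverse)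

lemma sum_kronecker [simp]:
  fixes f :: "'n::finite \<Rightarrow> real"
  shows "(\<Sum>r\<in>UNIV. (if a = r then 1 else 0) * f r) = f a"
    "(\<Sum>r\<in>UNIV. (if r = a then 1 else 0) * f r) = f a"
    "(\<Sum>r\<in>UNIV. f r * (if a = r then 1 else 0)) = f a"
    "(\<Sum>r\<in>UNIV. f r * (if r = a then 1 else 0)) = f a"
  by (simp_all add: if_distrib[where f="\<lambda>x. x * _"] if_distrib[where f="\<lambda>x. _ * x"] cong: if_cong)

lemma sum_antisymmetric_eq_0:
  fixes f :: "'n::finite \<Rightarrow> 'n \<Rightarrow> real"
  assumes "\<And>i j. f i j = - f j i"
  shows "(\<Sum>i\<in>UNIV. \<Sum>j\<in>UNIV. f i j) = 0"
proof -
  have "(\<Sum>i\<in>UNIV. \<Sum>j\<in>UNIV. f i j) = (\<Sum>i\<in>UNIV. \<Sum>j\<in>UNIV. - f j i)"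
    using assms by (intro sum.cong refl) blast
  also have "\<dots> = - (\<Sum>i\<in>UNIV. \<Sum>j\<in>UNIV. f i j)"
    by (subst sum.swap) (simp add: sum_negf)
  finally show ?thesis by simp
qed

text \<open>With the connection viewed as a matrix-valued one-form, this is
  \<open>dF + [a, F] = 0\<close> in components: \<open>a\<close>, \<open>da\<close>,
  \<open>dda\<close> stand for the Christoffel symbols and their first and second derivatives,
  \<open>F\<close> for the curvature, \<open>dF\<close> for its partial derivative and
  \<open>C\<close> for the commutator. The terms of type \<open>a da\<close> (\<open>L\<close>),
  \<open>da a\<close> (\<open>R\<close>) and the cubic ones (\<open>T\<close>) cancel separately in
  the cyclic sum.\<close>

lemma bianchi_algebra:
  fixes a :: "'n::finite \<Rightarrow> 'n \<Rightarrow> 'n \<Rightarrow> real"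
  defines "F \<equiv> \<lambda>da i j l m. da i m j l - da j m i l + (\<Sum>r\<in>UNIV. a r j l * a m i r - a r i l * a m j r)"
  defines "dF \<equiv> \<lambda>da dda k i j l m. dda k i m j l - dda k j m i l
    + (\<Sum>r\<in>UNIV. a r j l * da k m i r + da k r j l * a m i r - (a r i l * da k m j r + da k r i l * a m j r))"
  defines "C \<equiv> \<lambda>da k i j l m. \<Sum>r\<in>UNIV. a m k r * F da i j l r - F da i j r m * a r k l"
  assumes dda: "\<And>k i m j l. dda k i m j l = dda i k m j l"
  shows "(dF da dda k i j l m + C da k i j l m) + (dF da dda i j k l m + C da i j k l m)
    + (dF da dda j k i l m + C da j k i l m) = (0::real)"
proof -
  define T where "T p q w = (\<Sum>r\<in>UNIV. \<Sum>s\<in>UNIV. a m p r * a r q s * a s w l)" for p q w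
  define L where "L p i j = (\<Sum>r\<in>UNIV. a m p r * da i r j l)" for p i j
  define R where "R i j p = (\<Sum>r\<in>UNIV. da i m j r * a r p l)" for i j p
  have 1: "(\<Sum>r\<in>UNIV. a m k r * F da i j l r) = L k i j - L k j i + T k i j - T k j i" for k i j
    unfolding F_def T_def L_def
    by (simp add: algebra_simps sum.distrib sum_subtractf sum_distrib_left)
  have 2: "(\<Sum>r\<in>UNIV. F da i j r m * a r k l) = R i j k - R j i k + T i j k - T j i k" for k i j
  proof -
    have "(\<Sum>r\<in>UNIV. (\<Sum>s\<in>UNIV. a s j r * a m i s) * a r k l) = T i j k" for i j
      unfolding T_def by (subst sum.swap) (simp add: sum_distrib_left sum_distrib_right algebra_simps)
    then show ?thesis unfolding F_def R_def
      by (simp add: left_diff_distrib distrib_right sum.distrib sum_subtractf)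
  qed
  have C: "C da k i j l m = L k i j - L k j i + T k i j - T k j i - (R i j k - R j i k + T i j k - T j i k)" for k i j
    unfolding C_def sum_subtractf 1 2 ..
  have dF: "dF da dda k i j l m = dda k i m j l - dda k j m i l + R k i j + L i k j - R k j i - L j k i" for k i j
    unfolding dF_def L_def R_def by (simp add: sum.distrib sum_subtractf mult.commute)
  show ?thesis
    unfolding C dF using dda[of k i] dda[of k j] dda[of i j] by simp
qed

section \<open>Linear algebra of a metric\<close>

text \<open>Gram-Schmidt without projections: as long as fewer than \<open>n\<close> vectors have
  been found, some nonzero \<open>v\<close> is Euclidean-orthogonal to all \<open>G b\<close>, that
  is, \<open>G\<close>-orthogonal to all \<open>b\<close>, and only has to be normalized. The
  columns of \<open>E\<close> form the frame.\<close>

lemma orthonormal_frame_exists: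
  fixes G :: "real^'n^'n"
  assumes sym: "transpose G = G" and pos: "\<And>v. v \<noteq> 0 \<Longrightarrow> v \<bullet> (G *v v) > 0"
  shows "\<exists>E::real^'n^'n. transpose E ** G ** E = mat 1"
proof -
  define P where "P B \<longleftrightarrow> finite B \<and> (\<forall>b\<in>B. \<forall>c\<in>B. b \<bullet> (G *v c) = (if b = c then 1 else 0))" for B
  have G_sym: "v \<bullet> (G *v u) = u \<bullet> (G *v v)" for u v
  proof -
    have "v v* G = G *v v" using transpose_matrix_vector[of G v] sym by simp
    then show ?thesis using dot_lmul_matrix[of v G u] by (simp add: inner_commute)
  qed
  have "\<exists>B. P B \<and> card B = k" if "k \<le> CARD('n)" for k
    using that
  proof (induction k)
    case 0
    show ?case by (rule exI[of _ "{}"]) (simp add: P_def)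
  next
    case (Suc k)
    then obtain B where B: "P B" "card B = k" by auto
    then have "dim ((*v) G ` B) < DIM(real^'n)"
      using Suc.prems dim_le_card'[of "(*v) G ` B"] card_image_le[of B "(*v) G"] by (auto simp: P_def)
    then obtain v where v: "v \<noteq> 0" "\<And>y. y \<in> span ((*v) G ` B) \<Longrightarrow> orthogonal v y"
      using orthogonal_to_subspace_exists by blast
    define u where "u = (1 / sqrt (v \<bullet> (G *v v))) *\<^sub>R v"
    define q where "q = v \<bullet> (G *v v)"
    have "q > 0" unfolding q_def by (rule pos[OF v(1)])
    have "u \<bullet> (G *v u) = q / (sqrt q * sqrt q)"
      unfolding u_def q_def by (simp add: matrix_vector_mult_scaleR)
    then have uu: "u \<bullet> (G *v u) = 1" using \<open>q > 0\<close> by simp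
    have ub: "u \<bullet> (G *v b) = 0" if "b \<in> B" for b
      using v(2)[OF span_base, of "G *v b"] that by (simp add: u_def orthogonal_def)
    then have bu: "b \<bullet> (G *v u) = 0" if "b \<in> B" for b
      using that G_sym[of b u] by simp
    have "u \<notin> B" using uu ub by auto
    moreover have "P (insert u B)"
      using B(1) uu ub bu \<open>u \<notin> B\<close> unfolding P_def by auto
    ultimately show ?case
      using B by (intro exI[of _ "insert u B"]) (auto simp: P_def)
  qed
  then obtain B where B: "P B" "card B = CARD('n)" by blast
  then obtain e where e: "bij_betw e (UNIV :: 'n set) B"
    using bij_betw_iff_card[of "UNIV :: 'n set" B] unfolding P_def by auto
  define E :: "real^'n^'n" where "E = (\<chi> i a. e a $ i)"
  have "(transpose E ** G ** E) $ a $ b = e a \<bullet> (G *v e b)" for a b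
    unfolding matrix_mul_assoc[symmetric]
    by (simp add: matrix_matrix_mult_def matrix_vector_mult_def transpose_def E_def inner_vec_def)
  moreover have "e a \<bullet> (G *v e b) = (if a = b then 1 else 0)" for a b
  proof -
    have "e a \<in> B" "e b \<in> B" "e a = e b \<longleftrightarrow> a = b"
      using e by (auto simp: bij_betw_def inj_on_eq_iff)
    then show ?thesis using B(1) unfolding P_def by simp
  qed
  ultimately have "transpose E ** G ** E = mat 1"
    by (simp add: vec_eq_iff mat_def)
  then show ?thesis by blast
qed

text \<open>In a \<open>G\<close>-orthonormal frame the inverse metric is \<open>E E^T\<close>, and
  the trace becomes the sum of the squared entries of the symmetric matrix
  \<open>M = E^T t E\<close>. It is the squared norm of \<open>t\<close> with respect to
  \<open>G\<close>.\<close>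

lemma trace_square_raised:
  fixes G Gi t :: "real^'n^'n"
  assumes "transpose G = G" "\<And>v. v \<noteq> 0 \<Longrightarrow> v \<bullet> (G *v v) > 0"
    and t: "transpose t = t" and inv: "Gi ** G = mat 1"
  shows "trace ((Gi ** t) ** (Gi ** t)) \<ge> 0"
    and "trace ((Gi ** t) ** (Gi ** t)) = 0 \<Longrightarrow> t = 0"
proof -
  obtain E :: "real^'n^'n" where "transpose E ** G ** E = mat 1"
    using orthonormal_frame_exists[OF assms(1,2)] by blast
  then have "transpose E ** (G ** E) = mat 1" by (simp add: matrix_mul_assoc)
  then have "(G ** E) ** transpose E = mat 1" by (rule iffD1[OF matrix_left_right_inverse])
  then have E1: "G ** (E ** transpose E) = mat 1" by (simp add: matrix_mul_assoc)
  then have E2: "(E ** transpose E) ** G = mat 1" by (rule iffD1[OF matrix_left_right_inverse])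
  have "Gi ** (G ** (E ** transpose E)) = E ** transpose E"
    unfolding matrix_mul_assoc[of Gi] inv by simp
  then have Gi: "Gi = E ** transpose E" unfolding E1 by simp
  define M where "M = transpose E ** t ** E"
  have "transpose M = M"
    by (simp add: M_def matrix_transpose_mul t matrix_mul_assoc)
  then have M: "M $ i $ j = M $ j $ i" for i j
  proof -
    have "transpose M $ j $ i = M $ i $ j" by (simp add: transpose_def)
    then show ?thesis using \<open>transpose M = M\<close> by simp
  qed
  have "trace ((Gi ** t) ** (Gi ** t)) = trace (E ** (transpose E ** t ** E ** transpose E ** t))"
    by (simp add: Gi matrix_mul_assoc)
  also have "\<dots> = trace (M ** M)"
    by (subst trace_mul_sym) (simp add: M_def matrix_mul_assoc)
  also have "\<dots> = (\<Sum>i\<in>UNIV. \<Sum>j\<in>UNIV. (M $ i $ j)\<^sup>2)"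
    unfolding trace_def by (simp add: matrix_matrix_mult_def power2_eq_square M)
  finally have tr: "trace ((Gi ** t) ** (Gi ** t)) = (\<Sum>i\<in>UNIV. \<Sum>j\<in>UNIV. (M $ i $ j)\<^sup>2)" .
  then show "trace ((Gi ** t) ** (Gi ** t)) \<ge> 0" by (simp add: sum_nonneg)
  assume "trace ((Gi ** t) ** (Gi ** t)) = 0"
  then have "M = 0"
    unfolding tr by (simp add: sum_nonneg_eq_0_iff sum_nonneg vec_eq_iff)
  \<comment> \<open>Recovers \<open>t\<close> from \<open>M\<close>, so that \<open>M = 0\<close>
    gives \<open>t = 0\<close>.\<close>
  moreover have "(G ** (E ** transpose E)) ** t ** ((E ** transpose E) ** G) = G ** (E ** M ** transpose E) ** G"
    unfolding M_def by (simp add: matrix_mul_assoc)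
  then have "t = G ** (E ** M ** transpose E) ** G"
    unfolding E1 E2 by simp
  ultimately show "t = 0"
    by (simp add: matrix_matrix_mult_def vec_eq_iff)
qed

section \<open>Tensor calculus in a chart\<close>

locale metric_chart =
  fixes U :: "(real ^ 'n::finite) set" and G :: "real ^ 'n \<Rightarrow> real ^ 'n ^ 'n"
  assumes open_U: "open U" and smooth_G: "smooth_on U G"
    and G_sym: "x \<in> U \<Longrightarrow> G x $ i $ j = G x $ j $ i"
    and G_pos: "x \<in> U \<Longrightarrow> v \<noteq> 0 \<Longrightarrow> v \<bullet> (G x *v v) > 0"
begin

abbreviation gi where "gi x i j \<equiv> matrix_inv (G x) $ i $ j"
abbreviation Gam where "Gam x k i j \<equiv> christoffel G x k i j"

lemma det_G: assumes "x \<in> U" shows "det (G x) \<noteq> 0"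
proof -
  have "inj ((*v) (G x))"
    using G_pos[OF assms]
    by (metis (no_types, lifting) inner_zero_right less_irrefl linear_injective_0 matrix_vector_mul_linear)
  then show ?thesis
    using invertible_det_nz invertible_left_inverse matrix_left_invertible_injective by blast
qed

lemma inverse_G: assumes "x \<in> U" shows "G x ** matrix_inv (G x) = mat 1" "matrix_inv (G x) ** G x = mat 1"
  using det_G[OF assms] invertible_det_nz[of "G x"] unfolding invertible_def matrix_inv_def
  by (metis (mono_tags, lifting) someI_ex)+

lemma G_gi: assumes "x \<in> U" shows "(\<Sum>k\<in>UNIV. G x $ i $ k * gi x k j) = (if i = j then 1 else 0)"
  using inverse_G(1)[OF assms] by (simp add: vec_eq_iff matrix_matrix_mult_def mat_def)

lemma gi_G: assumes "x \<in> U" shows "(\<Sum>k\<in>UNIV. gi x i k * G x $ k $ j) = (if i = j then 1 else 0)"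
  using inverse_G(2)[OF assms] by (simp add: vec_eq_iff matrix_matrix_mult_def mat_def)

lemma lower_raise: assumes "x \<in> U" shows "(\<Sum>k\<in>UNIV. G x $ i $ k * (\<Sum>l\<in>UNIV. gi x k l * a l)) = a i"
proof -
  have "(\<Sum>k\<in>UNIV. G x $ i $ k * (\<Sum>l\<in>UNIV. gi x k l * a l)) = (\<Sum>l\<in>UNIV. (\<Sum>k\<in>UNIV. G x $ i $ k * gi x k l) * a l)"
    unfolding sum_distrib_left sum_distrib_right by (subst sum.swap) (simp add: mult.assoc)
  then show ?thesis by (simp add: G_gi[OF assms])
qed

lemma raise_lower: assumes "x \<in> U" shows "(\<Sum>k\<in>UNIV. gi x i k * (\<Sum>l\<in>UNIV. G x $ k $ l * a l)) = a i"
proof -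
  have "(\<Sum>k\<in>UNIV. gi x i k * (\<Sum>l\<in>UNIV. G x $ k $ l * a l)) = (\<Sum>l\<in>UNIV. (\<Sum>k\<in>UNIV. gi x i k * G x $ k $ l) * a l)"
    unfolding sum_distrib_left sum_distrib_right by (subst sum.swap) (simp add: mult.assoc)
  then show ?thesis by (simp add: gi_G[OF assms])
qed

lemma gi_sym: assumes "x \<in> U" shows "gi x i j = gi x j i"
proof -
  have t: "transpose (G x) = G x"
    using G_sym[OF assms] by (simp add: transpose_def vec_eq_iff)
  have "transpose (matrix_inv (G x)) ** G x = mat 1"
    using arg_cong[OF inverse_G(1)[OF assms], of transpose] by (simp add: matrix_transpose_mul t)
  then have "transpose (matrix_inv (G x)) = matrix_inv (G x)"
    by (metis inverse_G(1)[OF assms] matrix_mul_assoc matrix_mul_lid matrix_mul_rid)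
  then show ?thesis by (simp add: transpose_def vec_eq_iff)
qed

lemmas sm_G [simp] = smooth_on_component[OF open_U smooth_on_component[OF open_U smooth_G]]

lemma sm_gi [simp]: "smooth_on U (\<lambda>x. gi x i j)"
  using sm_G Ck_on_matrix_inv[OF open_U] det_G unfolding smooth_on_def by blast

lemmas sm_intros [simp] = smooth_on_add[OF open_U] smooth_on_diff[OF open_U] smooth_on_mult[OF open_U]
  smooth_on_sum[OF open_U] smooth_on_const smooth_on_divide_const[OF open_U]
  smooth_on_partial_deriv

lemma sm_Gam [simp]: "smooth_on U (\<lambda>x. Gam x k i j)"
  unfolding christoffel_def by simp

lemma
  assumes "x \<in> U"
  shows pd_add: "smooth_on U f \<Longrightarrow> smooth_on U h \<Longrightarrow>
      partial_deriv i (\<lambda>x. f x + h x) x = partial_deriv i f x + partial_deriv i h x"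
    and pd_diff: "smooth_on U f \<Longrightarrow> smooth_on U h \<Longrightarrow>
      partial_deriv i (\<lambda>x. f x - h x) x = partial_deriv i f x - partial_deriv i h x"
    and pd_mult: "smooth_on U f \<Longrightarrow> smooth_on U h \<Longrightarrow>
      partial_deriv i (\<lambda>x. f x * h x) x = f x * partial_deriv i h x + partial_deriv i f x * h x"
    and pd_sum: "(\<And>a. a \<in> I \<Longrightarrow> smooth_on U (fs a)) \<Longrightarrow>
      partial_deriv i (\<lambda>x. \<Sum>a\<in>I. fs a x) x = (\<Sum>a\<in>I. partial_deriv i (fs a) x)"
  using smooth_on_differentiable[OF _ assms]
  by (auto intro: partial_deriv_add partial_deriv_diff partial_deriv_mult partial_deriv_sum)

lemma pd_divide: "x \<in> U \<Longrightarrow> smooth_on U f \<Longrightarrow> partial_deriv i (\<lambda>x. f x / c) x = partial_deriv i f x / c"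
  using pd_mult[of x f "\<lambda>_. inverse c" i] by (simp add: divide_inverse)

lemmas pd_rules = pd_add pd_diff pd_mult pd_divide pd_sum

lemma pd_cong: "x \<in> U \<Longrightarrow> (\<And>y. y \<in> U \<Longrightarrow> f y = h y) \<Longrightarrow> partial_deriv i f x = partial_deriv i h x"
  by (rule partial_deriv_cong[OF open_U])

lemma pd_commute: "x \<in> U \<Longrightarrow> smooth_on U f \<Longrightarrow> partial_deriv i (partial_deriv j f) x = partial_deriv j (partial_deriv i f) x"
  by (rule partial_deriv_commute[OF open_U])

section \<open>Christoffel symbols, metric compatibility and the second Bianchi identity\<close>

lemma pd_G_sym: "x \<in> U \<Longrightarrow> partial_deriv k (\<lambda>y. G y $ i $ j) x = partial_deriv k (\<lambda>y. G y $ j $ i) x"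
  by (rule pd_cong) (auto intro: G_sym)

lemma Gam_sym: "x \<in> U \<Longrightarrow> Gam x k i j = Gam x k j i"
  unfolding christoffel_def by (simp add: pd_G_sym[of x _ i j] add.commute)

lemma lower_Gam:
  assumes "x \<in> U"
  shows "(\<Sum>m\<in>UNIV. G x $ j $ m * Gam x m k i) = (partial_deriv k (\<lambda>y. G y $ i $ j) x
    + partial_deriv i (\<lambda>y. G y $ k $ j) x - partial_deriv j (\<lambda>y. G y $ k $ i) x) / 2"
proof -
  have "(\<Sum>m\<in>UNIV. G x $ j $ m * Gam x m k i) = (\<Sum>m\<in>UNIV. G x $ j $ m * (\<Sum>l\<in>UNIV. gi x m l *
    ((partial_deriv k (\<lambda>y. G y $ i $ l) x + partial_deriv i (\<lambda>y. G y $ k $ l) x - partial_deriv l (\<lambda>y. G y $ k $ i) x) / 2)))"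
    unfolding christoffel_def by (simp add: sum_divide_distrib)
  then show ?thesis by (simp only: lower_raise[OF assms])
qed

text \<open>This is \<open>\<nabla>g = 0\<close> in coordinates: in the sum of two Christoffel
  symbols of the first kind all derivatives but one cancel.\<close>

lemma pd_G:
  assumes "x \<in> U"
  shows "partial_deriv k (\<lambda>y. G y $ i $ j) x = (\<Sum>m\<in>UNIV. G x $ m $ j * Gam x m k i) + (\<Sum>m\<in>UNIV. G x $ i $ m * Gam x m k j)"
proof -
  have "(\<Sum>m\<in>UNIV. G x $ m $ j * Gam x m k i) = (\<Sum>m\<in>UNIV. G x $ j $ m * Gam x m k i)"
    by (simp add: G_sym[OF assms, of _ j])
  then show ?thesis
    unfolding lower_Gam[OF assms] using pd_G_sym[OF assms] by (simp add: field_simps)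
qed

text \<open>\<open>B\<close> corrects the partial derivative by Christoffel symbols only in the
  slots \<open>l\<close> and \<open>m\<close>. The corrections that a full covariant derivative has
  in the slots \<open>i\<close> and \<open>j\<close> would cancel in the cyclic sum, the connection
  being torsion free.\<close>

lemma second_bianchi:
  assumes "x \<in> U"
  defines "B \<equiv> \<lambda>l m k i j. partial_deriv k (\<lambda>y. curvature_op G y i j l m) x
     + (\<Sum>r\<in>UNIV. Gam x m k r * curvature_op G x i j l r - curvature_op G x i j r m * Gam x r k l)"
  shows "B l m k i j + B l m i j k + B l m j k i = 0"
proof -
  have d: "partial_deriv k (\<lambda>y. curvature_op G y i j l m) x =
    partial_deriv k (partial_deriv i (\<lambda>y. Gam y m j l)) x - partial_deriv k (partial_deriv j (\<lambda>y. Gam y m i l)) x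
    + (\<Sum>r\<in>UNIV. Gam x r j l * partial_deriv k (\<lambda>y. Gam y m i r) x + partial_deriv k (\<lambda>y. Gam y r j l) x * Gam x m i r
     - (Gam x r i l * partial_deriv k (\<lambda>y. Gam y m j r) x + partial_deriv k (\<lambda>y. Gam y r i l) x * Gam x m j r))" for k i j
    unfolding curvature_op_def using assms(1) by (simp add: pd_rules)
  show ?thesis
    unfolding B_def d unfolding curvature_op_def
    by (rule bianchi_algebra[where a = "Gam x" and da = "\<lambda>i m j l. partial_deriv i (\<lambda>y. Gam y m j l) x"
      and dda = "\<lambda>k i m j l. partial_deriv k (partial_deriv i (\<lambda>y. Gam y m j l)) x"]) (simp add: pd_commute[OF assms(1)])
qed

text \<open>Derivatives of the inverse metric are avoided throughout: a tensor with a raised index is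
  differentiated through its lowered version.\<close>

lemma pd_lower:
  assumes x: "x \<in> U" and T: "\<And>m. smooth_on U (\<lambda>y. T y m)"
    and S: "\<And>y. y \<in> U \<Longrightarrow> S y = (\<Sum>m\<in>UNIV. G y $ i $ m * T y m)"
  shows "partial_deriv k S x = (\<Sum>m\<in>UNIV. G x $ i $ m * partial_deriv k (\<lambda>y. T y m) x)
    + (\<Sum>r\<in>UNIV. Gam x r k i * (\<Sum>m\<in>UNIV. G x $ r $ m * T x m))
    + (\<Sum>m\<in>UNIV. G x $ i $ m * (\<Sum>r\<in>UNIV. Gam x m k r * T x r))"
proof -
  have "partial_deriv k S x = partial_deriv k (\<lambda>y. \<Sum>m\<in>UNIV. G y $ i $ m * T y m) x"
    by (rule pd_cong[OF x S])
  also have "\<dots> = (\<Sum>m\<in>UNIV. G x $ i $ m * partial_deriv k (\<lambda>y. T y m) x)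
     + (\<Sum>m\<in>UNIV. (\<Sum>r\<in>UNIV. G x $ r $ m * Gam x r k i) * T x m)
     + (\<Sum>m\<in>UNIV. (\<Sum>r\<in>UNIV. G x $ i $ r * Gam x r k m) * T x m)"
    using x T by (simp add: pd_rules pd_G sum.distrib distrib_right)
  also have "(\<Sum>m\<in>UNIV. (\<Sum>r\<in>UNIV. G x $ r $ m * Gam x r k i) * T x m)
     = (\<Sum>r\<in>UNIV. Gam x r k i * (\<Sum>m\<in>UNIV. G x $ r $ m * T x m))"
    unfolding sum_distrib_left sum_distrib_right by (subst sum.swap) (simp add: mult_ac)
  also have "(\<Sum>m\<in>UNIV. (\<Sum>r\<in>UNIV. G x $ i $ r * Gam x r k m) * T x m)
     = (\<Sum>m\<in>UNIV. G x $ i $ m * (\<Sum>r\<in>UNIV. Gam x m k r * T x r))"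
    unfolding sum_distrib_left sum_distrib_right by (subst sum.swap) (simp add: mult_ac)
  finally show ?thesis .
qed

text \<open>\<open>k\<close> is the direction, \<open>m\<close> the upper and \<open>i\<close> the
  lower index. Bilinear forms are differentiated through the corresponding endomorphisms, so that
  traces and divergences need no metric.\<close>

definition covariant_deriv ("\<nabla>") where
  "\<nabla> T x k m i = partial_deriv k (\<lambda>y. T y m i) x + (\<Sum>r\<in>UNIV. Gam x m k r * T x r i)
     - (\<Sum>r\<in>UNIV. T x m r * Gam x r k i)"

lemma trace_covariant_deriv:
  assumes "x \<in> U" "\<And>m i. smooth_on U (\<lambda>y. T y m i)"
  shows "(\<Sum>m\<in>UNIV. \<nabla> T x k m m) = partial_deriv k (\<lambda>y. \<Sum>m\<in>UNIV. T y m m) x"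
proof -
  have "(\<Sum>m\<in>UNIV. \<Sum>r\<in>UNIV. Gam x m k r * T x r m) = (\<Sum>m\<in>UNIV. \<Sum>r\<in>UNIV. T x m r * Gam x r k m)"
    by (subst sum.swap) (simp add: mult.commute)
  then show ?thesis
    unfolding covariant_deriv_def using assms by (simp add: pd_rules sum.distrib sum_subtractf)
qed

end

section \<open>The soliton equation in a chart\<close>

locale soliton_chart = metric_chart U G for U :: "(real ^ 'n::finite) set" and G +
  fixes X :: "real ^ 'n \<Rightarrow> real ^ 'n" and lam :: real
  assumes smooth_X: "smooth_on U X" and dim: "CARD('n) \<ge> 3"
    and soliton: "x \<in> U \<Longrightarrow> riemann_curvature G x i j k l
         + (1 / 2) * (lie_deriv_metric G X x \<odot> (\<lambda>i j. G x $ i $ j)) i j k l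
         = lam * ((1 / 2) * ((\<lambda>i j. G x $ i $ j) \<odot> (\<lambda>i j. G x $ i $ j)) i j k l)"
begin

lemmas sm_X [simp] = smooth_on_component[OF open_U smooth_X]

text \<open>\<open>p\<close> is the Schouten tensor of the soliton, \<open>Q\<close> the corresponding endomorphism and \<open>J\<close> its
  trace; \<open>K\<close> is the endomorphism \<open>\<nabla>X\<close>. The bivector \<open>w\<close> is \<open>K - K\<^sup>*\<close> with its index raised, and
  \<open>W\<close> is \<open>K - K\<^sup>*\<close> itself.\<close>

definition K where "K x m i = partial_deriv i (\<lambda>y. X y $ m) x + (\<Sum>k\<in>UNIV. Gam x m i k * X x $ k)"
definition p where "p x i j = lam / 2 * G x $ i $ j - lie_deriv_metric G X x i j / 2"
definition Q where "Q x m i = (\<Sum>j\<in>UNIV. gi x m j * p x j i)"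
definition J where "J x = (\<Sum>i\<in>UNIV. Q x i i)"
definition w where "w x m j = (\<Sum>i\<in>UNIV. gi x j i * K x m i) - (\<Sum>i\<in>UNIV. gi x m i * K x j i)"
definition W where "W x m i = (\<Sum>j\<in>UNIV. G x $ i $ j * w x m j)"

lemma sm_lie [simp]: "smooth_on U (\<lambda>x. lie_deriv_metric G X x i j)"
  unfolding lie_deriv_metric_def by simp

lemma sm_tensors [simp]:
  "smooth_on U (\<lambda>x. K x i j)" "smooth_on U (\<lambda>x. p x i j)" "smooth_on U (\<lambda>x. Q x i j)"
  "smooth_on U (\<lambda>x. J x)" "smooth_on U (\<lambda>x. w x i j)" "smooth_on U (\<lambda>x. W x i j)"
proof -
  show K: "smooth_on U (\<lambda>x. K x i j)" for i j unfolding K_def by simp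
  show p: "smooth_on U (\<lambda>x. p x i j)" for i j unfolding p_def by simp
  show Q: "smooth_on U (\<lambda>x. Q x i j)" for i j unfolding Q_def using p by simp
  show "smooth_on U (\<lambda>x. J x)" unfolding J_def using Q by simp
  show w: "smooth_on U (\<lambda>x. w x i j)" for i j unfolding w_def using K by simp
  show "smooth_on U (\<lambda>x. W x i j)" for i j unfolding W_def using w by simp
qed

section \<open>Relations between the Lie derivative, \<open>\<nabla>X\<close> and the
  curvature\<close>

lemma w_antisym: "w x i j = - w x j i"
  by (simp add: w_def)

text \<open>Metric compatibility writes the derivative of the metric along \<open>X\<close> as two
  Christoffel terms, which by torsion-freeness complete the partial derivatives of \<open>X\<close>
  to covariant ones. So the Lie derivative is twice the symmetric part of \<open>\<nabla>X\<close>,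
  lowered.\<close>

lemma lie_eq:
  assumes x: "x \<in> U"
  shows "lie_deriv_metric G X x i j = (\<Sum>m\<in>UNIV. G x $ j $ m * K x m i) + (\<Sum>m\<in>UNIV. G x $ i $ m * K x m j)"
proof -
  have *: "(\<Sum>k\<in>UNIV. X x $ k * (\<Sum>m\<in>UNIV. G x $ i $ m * Gam x m k j))
     = (\<Sum>m\<in>UNIV. G x $ i $ m * (\<Sum>k\<in>UNIV. Gam x m j k * X x $ k))" for i j
    unfolding sum_distrib_left by (subst sum.swap) (simp add: mult_ac Gam_sym[OF x, of _ _ j])
  have **: "(\<Sum>m\<in>UNIV. G x $ m $ j * a m) = (\<Sum>m\<in>UNIV. G x $ j $ m * a m)" for a j
    by (simp add: G_sym[OF x, of _ j])
  show ?thesis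
    unfolding lie_deriv_metric_def K_def pd_G[OF x]
    by (simp add: sum.distrib distrib_left * **)
qed

lemma p_sym: "x \<in> U \<Longrightarrow> p x i j = p x j i"
  by (simp add: p_def lie_eq G_sym[of x i j] add.commute)

lemma p_lower: "x \<in> U \<Longrightarrow> p x i j = (\<Sum>m\<in>UNIV. G x $ i $ m * Q x m j)"
  unfolding Q_def by (simp add: lower_raise)

text \<open>\<open>p\<close> subtracts the symmetric part of \<open>\<nabla>X\<close> from a
  multiple of the metric, and as an endomorphism that part is \<open>K - W / 2\<close>. In the proof
  \<open>c\<close> is a component of the adjoint of \<open>K\<close>, whence
  \<open>W = K - c\<close>.\<close>

lemma Q_eq:
  assumes x: "x \<in> U"
  shows "Q x m i = lam / 2 * (if m = i then 1 else 0) - K x m i + W x m i / 2"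
proof -
  define c where "c = (\<Sum>j\<in>UNIV. gi x m j * (\<Sum>r\<in>UNIV. G x $ i $ r * K x r j))"
  have "p x j i = lam / 2 * G x $ j $ i - (\<Sum>r\<in>UNIV. G x $ i $ r * K x r j) / 2 - (\<Sum>r\<in>UNIV. G x $ j $ r * K x r i) / 2" for j
    by (simp add: p_def lie_eq[OF x] field_simps)
  then have "Q x m i = lam / 2 * (\<Sum>j\<in>UNIV. gi x m j * G x $ j $ i) - c / 2
      - (\<Sum>j\<in>UNIV. gi x m j * (\<Sum>r\<in>UNIV. G x $ j $ r * K x r i)) / 2"
    unfolding Q_def c_def
    by (simp add: right_diff_distrib sum_subtractf sum_divide_distrib sum_distrib_left mult_ac)
  then have 1: "Q x m i = lam / 2 * (if m = i then 1 else 0) - c / 2 - K x m i / 2"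
    by (simp only: gi_G[OF x] raise_lower[OF x])
  have "W x m i = (\<Sum>j\<in>UNIV. G x $ i $ j * (\<Sum>a\<in>UNIV. gi x j a * K x m a))
      - (\<Sum>j\<in>UNIV. G x $ i $ j * (\<Sum>a\<in>UNIV. gi x m a * K x j a))"
    by (simp add: W_def w_def right_diff_distrib sum_subtractf)
  also have "(\<Sum>j\<in>UNIV. G x $ i $ j * (\<Sum>a\<in>UNIV. gi x m a * K x j a)) = c"
    unfolding c_def sum_distrib_left by (subst sum.swap) (simp add: mult_ac)
  finally have "W x m i = K x m i - c" by (simp only: lower_raise[OF x])
  with 1 show ?thesis by (simp add: field_simps)
qed

text \<open>Raising the third index of \<open>p \<odot> g\<close> turns two of the factors
  \<open>p\<close> into \<open>Q\<close> and two of the factors \<open>g\<close> into Kronecker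
  deltas.\<close>

lemma curvature_eq:
  assumes x: "x \<in> U"
  shows "curvature_op G x i j l m = Q x m i * G x $ j $ l + p x j l * (if m = i then 1 else 0)
     - p x i l * (if m = j then 1 else 0) - Q x m j * G x $ i $ l"
proof -
  have "(\<Sum>a\<in>UNIV. G x $ k $ a * curvature_op G x i j l a)
     = p x k i * G x $ j $ l + p x j l * G x $ k $ i - p x i l * G x $ k $ j - p x k j * G x $ i $ l" for k
    using soliton[OF x, of i j k l] G_sym[OF x, of k] p_sym[OF x, of k] unfolding riemann_curvature_def
    by (simp add: kulkarni_nomizu_def p_def field_simps)
  then have "curvature_op G x i j l m = (\<Sum>k\<in>UNIV. gi x m k *
      (p x k i * G x $ j $ l + p x j l * G x $ k $ i - p x i l * G x $ k $ j - p x k j * G x $ i $ l))"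
    using raise_lower[OF x, of m "curvature_op G x i j l"] by simp
  also have "\<dots> = Q x m i * G x $ j $ l + p x j l * (\<Sum>k\<in>UNIV. gi x m k * G x $ k $ i)
      - p x i l * (\<Sum>k\<in>UNIV. gi x m k * G x $ k $ j) - Q x m j * G x $ i $ l"
    unfolding Q_def by (simp add: algebra_simps sum.distrib sum_subtractf sum_distrib_left)
  finally show ?thesis by (simp only: gi_G[OF x])
qed

section \<open>The contracted second Bianchi identity\<close>

lemma pd_p:
  assumes x: "x \<in> U"
  shows "partial_deriv k (\<lambda>y. p y i j) x = (\<Sum>m\<in>UNIV. G x $ i $ m * \<nabla> Q x k m j)
    + (\<Sum>r\<in>UNIV. Gam x r k i * p x r j) + (\<Sum>r\<in>UNIV. Gam x r k j * p x r i)"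
proof -
  have "(\<Sum>m\<in>UNIV. G x $ i $ m * (\<Sum>r\<in>UNIV. Q x m r * Gam x r k j)) = (\<Sum>r\<in>UNIV. Gam x r k j * p x i r)"
    unfolding p_lower[OF x] sum_distrib_left by (subst sum.swap) (simp add: mult_ac)
  then show ?thesis
    using pd_lower[OF x, where T = "\<lambda>y m. Q y m j" and S = "\<lambda>y. p y i j" and i = i and k = k, OF sm_tensors(3) p_lower]
    unfolding covariant_deriv_def
    by (simp add: distrib_left right_diff_distrib sum.distrib sum_subtractf p_lower[OF x, symmetric] p_sym[OF x, of _ i])
qed

text \<open>\<open>B\<close> is the covariant derivative of \<open>p \<odot> g\<close> with one
  index raised: \<open>\<nabla>\<close> only hits \<open>p\<close>, because the metric and the
  Kronecker delta are parallel. What \<open>second_bianchi\<close> leaves uncorrected are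
  Christoffel terms in the slots \<open>i\<close> and \<open>j\<close>, collected in
  \<open>QG\<close>, \<open>Gg\<close>, \<open>Gp\<close> and \<open>Gam\<close>. Each is symmetric
  in the direction and the slot it acts on, and so drops out of the cyclic sum.\<close>

lemma bianchi_Q:
  assumes x: "x \<in> U"
  defines "P \<equiv> \<lambda>k i j. \<Sum>m\<in>UNIV. G x $ i $ m * \<nabla> Q x k m j"
  defines "B \<equiv> \<lambda>l m k i j. \<nabla> Q x k m i * G x $ j $ l + P k j l * (if m = i then 1 else 0)
     - P k i l * (if m = j then 1 else 0) - \<nabla> Q x k m j * G x $ i $ l"
  shows "B l m k i j + B l m i j k + B l m j k i = 0"
proof -
  define d where "d i = (if m = i then 1 else 0 :: real)" for i
  define GQ where "GQ k i = (\<Sum>r\<in>UNIV. Gam x m k r * Q x r i)" for k i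
  define QG where "QG k i = (\<Sum>r\<in>UNIV. Q x m r * Gam x r k i)" for k i
  define Gg where "Gg k i j = (\<Sum>r\<in>UNIV. G x $ r $ j * Gam x r k i)" for k i j
  define Gp where "Gp k i j = (\<Sum>r\<in>UNIV. Gam x r k i * p x r j)" for k i j
  have sym: "QG k i = QG i k" "Gg k i j = Gg i k j" "Gp k i j = Gp i k j" "Gam x m k i = Gam x m i k" for k i j
    unfolding QG_def Gg_def Gp_def by (simp_all add: Gam_sym[OF x, of _ k i])
  have dg: "partial_deriv k (\<lambda>y. G y $ i $ j) x = Gg k i j + Gg k j i" for k i j
    unfolding pd_G[OF x] Gg_def by (simp add: G_sym[OF x, of i])
  have dp: "partial_deriv k (\<lambda>y. p y i j) x = P k i j + Gp k i j + Gp k j i" for k i j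
    unfolding pd_p[OF x] P_def Gp_def ..
  have dQ: "partial_deriv k (\<lambda>y. Q y m i) x = \<nabla> Q x k m i - GQ k i + QG k i" for k i
    unfolding covariant_deriv_def GQ_def QG_def by simp
  have dF: "partial_deriv k (\<lambda>y. curvature_op G y i j l m) x
     = (\<nabla> Q x k m i - GQ k i + QG k i) * G x $ j $ l + Q x m i * (Gg k j l + Gg k l j)
       + (P k j l + Gp k j l + Gp k l j) * d i - (P k i l + Gp k i l + Gp k l i) * d j
       - (\<nabla> Q x k m j - GQ k j + QG k j) * G x $ i $ l - Q x m j * (Gg k i l + Gg k l i)" for k i j
  proof -
    have "partial_deriv k (\<lambda>y. curvature_op G y i j l m) x = partial_deriv k (\<lambda>y. Q y m i * G y $ j $ l + p y j l * d i
       - p y i l * d j - Q y m j * G y $ i $ l) x"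
      by (rule pd_cong[OF x]) (simp add: curvature_eq d_def)
    then show ?thesis using x by (simp add: pd_rules dg dp dQ algebra_simps)
  qed
  have c1: "(\<Sum>r\<in>UNIV. Gam x m k r * curvature_op G x i j l r)
     = GQ k i * G x $ j $ l + p x j l * Gam x m k i - p x i l * Gam x m k j - GQ k j * G x $ i $ l" for k i j
  proof -
    have "(\<Sum>r\<in>UNIV. Gam x m k r * curvature_op G x i j l r)
     = GQ k i * G x $ j $ l + p x j l * (\<Sum>r\<in>UNIV. Gam x m k r * (if r = i then 1 else 0))
        - p x i l * (\<Sum>r\<in>UNIV. Gam x m k r * (if r = j then 1 else 0)) - GQ k j * G x $ i $ l"
      unfolding curvature_eq[OF x] GQ_def
      by (simp only: right_diff_distrib distrib_left sum.distrib sum_subtractf sum_distrib_left sum_distrib_right mult_ac)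
    then show ?thesis by simp
  qed
  have c2: "(\<Sum>r\<in>UNIV. curvature_op G x i j r m * Gam x r k l)
     = Q x m i * Gg k l j + Gp k l j * d i - Gp k l i * d j - Q x m j * Gg k l i" for k i j
    unfolding curvature_eq[OF x] Gg_def Gp_def d_def G_sym[OF x, of _ j] G_sym[OF x, of _ i] p_sym[OF x, of _ j] p_sym[OF x, of _ i]
    by (simp only: left_diff_distrib distrib_right right_diff_distrib distrib_left sum.distrib sum_subtractf sum_distrib_left sum_distrib_right mult_ac)
  have "partial_deriv k (\<lambda>y. curvature_op G y i j l m) x
     + (\<Sum>r\<in>UNIV. Gam x m k r * curvature_op G x i j l r - curvature_op G x i j r m * Gam x r k l)
     = B l m k i j + QG k i * G x $ j $ l + Q x m i * Gg k j l + Gp k j l * d i - Gp k i l * d j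
       - QG k j * G x $ i $ l - Q x m j * Gg k i l + p x j l * Gam x m k i - p x i l * Gam x m k j" for k i j
    unfolding sum_subtractf dF c1 c2 B_def d_def[symmetric] by (simp add: algebra_simps)
  from second_bianchi[OF x, of k i j l m, unfolded this]
  show ?thesis using sym[of k i] sym[of k j] sym[of i j] by (simp add: algebra_simps)
qed

text \<open>Setting \<open>k = m\<close> in \<open>bianchi_Q\<close> and summing gives the relation
  \<open>E\<close>, in which the derivatives of \<open>p\<close> carry the factor
  \<open>3 - n\<close>. Contracting \<open>E\<close> with the inverse metric over \<open>j\<close>
  and \<open>l\<close> yields \<open>(2 n - 4) (dv - dJ) = 0\<close>, and \<open>n \<ge> 3\<close>
  makes the factor nonzero.\<close>

lemma divergence_Q:
  assumes x: "x \<in> U"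
  shows "(\<Sum>m\<in>UNIV. \<nabla> Q x m m i) = partial_deriv i J x"
proof -
  define P where "P k i j = (\<Sum>m\<in>UNIV. G x $ i $ m * \<nabla> Q x k m j)" for k i j
  define dv where "dv i = (\<Sum>m\<in>UNIV. \<nabla> Q x m m i)" for i
  define dJ where "dJ i = partial_deriv i J x" for i
  define n where "n = real CARD('n)"
  have tr: "(\<Sum>m\<in>UNIV. \<nabla> Q x k m m) = dJ k" for k
    unfolding dJ_def J_def[abs_def] by (rule trace_covariant_deriv[OF x]) simp
  have P_sym: "P k i j = P k j i" for k i j
  proof -
    have "partial_deriv k (\<lambda>y. p y i j) x = partial_deriv k (\<lambda>y. p y j i) x"
      by (rule pd_cong[OF x p_sym])
    then show ?thesis unfolding pd_p[OF x] P_def by simp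
  qed
  have one: "(\<Sum>m\<in>UNIV. (if m = i then 1 else 0 :: real) * a m) = a i" for a :: "'n \<Rightarrow> real" and i
    by simp
  have E: "(dv i - dJ i) * G x $ j $ l - (dv j - dJ j) * G x $ i $ l + (3 - n) * (P i j l - P j i l) = 0" for i j l
  proof -
    have "(\<Sum>m\<in>UNIV. (\<nabla> Q x m m i * G x $ j $ l + P m j l * (if m = i then 1 else 0)
        - P m i l * (if m = j then 1 else 0) - \<nabla> Q x m m j * G x $ i $ l)
      + (\<nabla> Q x i m j * G x $ m $ l + P i m l * (if m = j then 1 else 0)
        - P i j l * (if m = m then 1 else 0) - \<nabla> Q x i m m * G x $ j $ l)
      + (\<nabla> Q x j m m * G x $ i $ l + P j i l * (if m = m then 1 else 0)
        - P j m l * (if m = i then 1 else 0) - \<nabla> Q x j m i * G x $ m $ l)) = 0"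
      unfolding P_def bianchi_Q[OF x] by simp
    moreover have "(\<Sum>m\<in>UNIV. \<nabla> Q x k m j * G x $ m $ l) = P k l j" for k l j
      unfolding P_def by (simp add: G_sym[OF x, of _ l] mult.commute)
    ultimately have "(dv i * G x $ j $ l + P i j l - P j i l - dv j * G x $ i $ l)
      + (P i l j + P i j l - n * P i j l - dJ i * G x $ j $ l)
      + (dJ j * G x $ i $ l + n * P j i l - P j i l - P j l i) = 0"
      by (simp add: sum.distrib sum_subtractf sum_distrib_right[symmetric] dv_def[symmetric] tr n_def)
    then show ?thesis using P_sym[of i l j] P_sym[of j l i] by (simp add: algebra_simps)
  qed
  have t1: "(\<Sum>j\<in>UNIV. \<Sum>l\<in>UNIV. gi x j l * G x $ j $ l) = n"
    unfolding n_def using gi_G[OF x] G_gi[OF x] gi_sym[OF x] G_sym[OF x]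
    by (simp add: G_sym[OF x, of _ l for l])
  have t2: "(\<Sum>j\<in>UNIV. \<Sum>l\<in>UNIV. gi x j l * (a j * G x $ i $ l)) = a i" for a
  proof -
    have "(\<Sum>j\<in>UNIV. \<Sum>l\<in>UNIV. gi x j l * (a j * G x $ i $ l)) = (\<Sum>j\<in>UNIV. a j * (\<Sum>l\<in>UNIV. G x $ i $ l * gi x l j))"
      by (simp add: sum_distrib_left gi_sym[OF x, of _ j for j] mult_ac)
    then show ?thesis by (simp add: G_gi[OF x])
  qed
  have t3: "(\<Sum>j\<in>UNIV. \<Sum>l\<in>UNIV. gi x j l * P k j l) = dJ k" for k
  proof -
    have "(\<Sum>j\<in>UNIV. \<Sum>l\<in>UNIV. gi x j l * P k j l) = (\<Sum>j\<in>UNIV. \<Sum>l\<in>UNIV. gi x j l * P k l j)"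
      by (simp add: P_sym[of k])
    then show ?thesis unfolding P_def by (simp add: raise_lower[OF x] tr)
  qed
  have t4: "(\<Sum>j\<in>UNIV. \<Sum>l\<in>UNIV. gi x j l * P j i l) = dv i"
  proof -
    have "(\<Sum>j\<in>UNIV. \<Sum>l\<in>UNIV. gi x j l * P j i l) = (\<Sum>j\<in>UNIV. \<Sum>l\<in>UNIV. gi x j l * P j l i)"
      by (simp add: P_sym[of _ i])
    then show ?thesis unfolding P_def by (simp add: raise_lower[OF x] dv_def)
  qed
  have "(\<Sum>j\<in>UNIV. \<Sum>l\<in>UNIV. gi x j l *
    ((dv i - dJ i) * G x $ j $ l - (dv j - dJ j) * G x $ i $ l + (3 - n) * (P i j l - P j i l))) = 0"
    by (simp add: E)
  moreover have "(\<Sum>j\<in>UNIV. \<Sum>l\<in>UNIV. gi x j l *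
    (b * G x $ j $ l - (dv j - dJ j) * G x $ i $ l + c * (P i j l - P j i l)))
    = b * (\<Sum>j\<in>UNIV. \<Sum>l\<in>UNIV. gi x j l * G x $ j $ l)
      - (\<Sum>j\<in>UNIV. \<Sum>l\<in>UNIV. gi x j l * ((dv j - dJ j) * G x $ i $ l))
      + c * ((\<Sum>j\<in>UNIV. \<Sum>l\<in>UNIV. gi x j l * P i j l) - (\<Sum>j\<in>UNIV. \<Sum>l\<in>UNIV. gi x j l * P j i l))" for b c
    by (simp add: right_diff_distrib distrib_left sum.distrib sum_subtractf sum_distrib_left mult_ac)
  ultimately have "(dv i - dJ i) * n - (dv i - dJ i) + (3 - n) * (dJ i - dv i) = 0"
    unfolding t1 t2 t3 t4 by simp
  then have "(2 * n - 4) * (dv i - dJ i) = 0" by (simp add: algebra_simps)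
  moreover have "n \<ge> 3" using dim by (simp add: n_def)
  ultimately show ?thesis by (simp add: dv_def dJ_def)
qed

section \<open>The bivector \<open>w\<close> and the divergence of \<open>Ric(X)\<close>\<close>

lemma sum_symmetric_w_eq_0:
  assumes x: "x \<in> U" and T: "\<And>i j. T i j = T j i"
  shows "(\<Sum>m\<in>UNIV. \<Sum>j\<in>UNIV. T m j * w x m j) = 0"
proof (rule sum_antisymmetric_eq_0)
  fix i j show "T i j * w x i j = - (T j i * w x j i)"
    unfolding T[of i j] w_antisym[of x i j] by simp
qed

lemma trace_K: assumes x: "x \<in> U" shows "(\<Sum>m\<in>UNIV. K x m m) = real CARD('n) * lam / 2 - J x"
proof -
  have "(\<Sum>m\<in>UNIV. W x m m) = 0"
    unfolding W_def by (rule sum_symmetric_w_eq_0[OF x G_sym[OF x]])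
  then show ?thesis
    unfolding J_def Q_eq[OF x] by (simp add: sum.distrib sum_subtractf sum_divide_distrib[symmetric])
qed

text \<open>The Christoffel terms on the lower index of \<open>K\<close> are symmetric in
  \<open>i\<close> and \<open>j\<close> and drop out. The products \<open>A\<close> of Christoffel
  symbols with derivatives of \<open>X\<close> cancel, and \<open>B\<close> and \<open>C\<close>
  assemble the curvature.\<close>

lemma ricci_identity:
  assumes x: "x \<in> U"
  shows "\<nabla> K x j m i - \<nabla> K x i m j = (\<Sum>r\<in>UNIV. curvature_op G x j i r m * X x $ r)"
proof -
  define A where "A j i = (\<Sum>r\<in>UNIV. Gam x m i r * partial_deriv j (\<lambda>y. X y $ r) x)" for j i
  define B where "B j i = (\<Sum>r\<in>UNIV. partial_deriv j (\<lambda>y. Gam y m i r) x * X x $ r)" for j i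
  define C where "C j i = (\<Sum>r\<in>UNIV. \<Sum>s\<in>UNIV. Gam x m j s * Gam x s i r * X x $ r)" for j i
  have "partial_deriv j (\<lambda>y. K y m i) x = partial_deriv j (partial_deriv i (\<lambda>y. X y $ m)) x + A j i + B j i" for j i
    unfolding K_def A_def B_def using x by (simp add: pd_rules sum.distrib)
  moreover have "(\<Sum>r\<in>UNIV. Gam x m j r * K x r i) = A i j + C j i" for j i
  proof -
    have "C j i = (\<Sum>r\<in>UNIV. Gam x m j r * (\<Sum>k\<in>UNIV. Gam x r i k * X x $ k))"
      unfolding C_def by (subst sum.swap) (simp add: sum_distrib_left mult_ac)
    then show ?thesis unfolding A_def K_def by (simp add: distrib_left sum.distrib)
  qed
  moreover have "(\<Sum>r\<in>UNIV. K x m r * Gam x r j i) = (\<Sum>r\<in>UNIV. K x m r * Gam x r i j)"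
    by (simp add: Gam_sym[OF x, of _ j i])
  moreover have "(\<Sum>r\<in>UNIV. curvature_op G x j i r m * X x $ r) = B j i - B i j + C j i - C i j"
    unfolding curvature_op_def B_def C_def
    by (simp add: distrib_right left_diff_distrib distrib_left right_diff_distrib sum.distrib sum_subtractf sum_distrib_right sum_distrib_left mult_ac)
  ultimately show ?thesis
    unfolding covariant_deriv_def using pd_commute[OF x, of "\<lambda>y. X y $ m" i j] by simp
qed

text \<open>The left side is the Ricci tensor, so this is the relation that characterizes
  \<open>p\<close> as the Schouten tensor.\<close>

lemma ricci_eq:
  assumes x: "x \<in> U"
  shows "(\<Sum>m\<in>UNIV. curvature_op G x m i r m) = J x * G x $ i $ r + (real CARD('n) - 2) * p x i r"
proof -
  have "(\<Sum>m\<in>UNIV. curvature_op G x m i r m) = (\<Sum>m\<in>UNIV. Q x m m) * G x $ i $ r + real CARD('n) * p x i r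
    - (\<Sum>m\<in>UNIV. p x m r * (if m = i then 1 else 0)) - (\<Sum>m\<in>UNIV. G x $ r $ m * Q x m i)"
    unfolding curvature_eq[OF x] sum_distrib_right
    by (simp add: sum.distrib sum_subtractf G_sym[OF x, of r] mult.commute[of "Q x _ i"])
  then show ?thesis
    unfolding J_def[symmetric] p_lower[OF x, symmetric] using p_sym[OF x, of r i] by (simp add: algebra_simps)
qed

text \<open>\<open>Y\<close> is \<open>Ric(X)\<close>.\<close>

definition Y where "Y x j = J x * X x $ j + (real CARD('n) - 2) * (\<Sum>r\<in>UNIV. Q x j r * X x $ r)"

text \<open>The left side is the covariant divergence of a bivector: by antisymmetry only the trace
  of the Christoffel symbols survives. Taking divergences in \<open>Q = lam/2 - K + W/2\<close> and
  applying the Ricci identity to \<open>K\<close> gives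
  \<open>dJ = - d(tr K) - Ric(X) + div W / 2\<close>. As \<open>tr K\<close> is a constant minus
  \<open>J\<close>, both occurrences of \<open>dJ\<close> cancel.\<close>

lemma divergence_w:
  assumes x: "x \<in> U"
  shows "(\<Sum>m\<in>UNIV. partial_deriv m (\<lambda>y. w y m j) x) + (\<Sum>m\<in>UNIV. (\<Sum>r\<in>UNIV. Gam x r r m) * w x m j) = 2 * Y x j"
proof -
  define D where "D k m j = partial_deriv k (\<lambda>y. w y m j) x + (\<Sum>r\<in>UNIV. Gam x m k r * w x r j)
    + (\<Sum>r\<in>UNIV. Gam x j k r * w x m r)" for k m j
  define Dv where "Dv j = (\<Sum>m\<in>UNIV. D m m j)" for j
  \<comment> \<open>Since the metric is parallel, \<open>\<nabla> W\<close> is the lowered version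
    of \<open>D\<close>, the covariant derivative of \<open>w\<close>.\<close>
  have W: "\<nabla> W x k m i = (\<Sum>j\<in>UNIV. G x $ i $ j * D k m j)" for k m i
  proof -
    have "(\<Sum>r\<in>UNIV. Gam x m k r * W x r i) = (\<Sum>j\<in>UNIV. G x $ i $ j * (\<Sum>r\<in>UNIV. Gam x m k r * w x r j))"
      unfolding W_def sum_distrib_left by (subst sum.swap) (simp add: mult_ac)
    moreover have "(\<Sum>r\<in>UNIV. W x m r * Gam x r k i) = (\<Sum>r\<in>UNIV. Gam x r k i * (\<Sum>j\<in>UNIV. G x $ r $ j * w x m j))"
      unfolding W_def by (simp add: mult.commute)
    ultimately show ?thesis
      unfolding covariant_deriv_def D_def
        pd_lower[OF x, where T = "\<lambda>y j. w y m j" and S = "\<lambda>y. W y m i", OF sm_tensors(5) W_def]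
      by (simp add: distrib_left sum.distrib)
  qed
  have Q: "\<nabla> Q x k m i = - \<nabla> K x k m i + \<nabla> W x k m i / 2" for k m i
  proof -
    have "partial_deriv k (\<lambda>y. Q y m i) x = partial_deriv k (\<lambda>y. lam / 2 * (if m = i then 1 else 0) - K y m i + W y m i * (1 / 2)) x"
      by (rule pd_cong[OF x]) (simp add: Q_eq)
    then have 1: "partial_deriv k (\<lambda>y. Q y m i) x = - partial_deriv k (\<lambda>y. K y m i) x + partial_deriv k (\<lambda>y. W y m i) x / 2"
      using x by (simp add: pd_rules)
    have 2: "(\<Sum>r\<in>UNIV. Gam x m k r * Q x r i) = lam / 2 * Gam x m k i - (\<Sum>r\<in>UNIV. Gam x m k r * K x r i) + (\<Sum>r\<in>UNIV. Gam x m k r * W x r i) / 2"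
    proof -
      have "(\<Sum>r\<in>UNIV. Gam x m k r * Q x r i) = lam / 2 * (\<Sum>r\<in>UNIV. Gam x m k r * (if r = i then 1 else 0))
        - (\<Sum>r\<in>UNIV. Gam x m k r * K x r i) + (\<Sum>r\<in>UNIV. Gam x m k r * W x r i) / 2"
        unfolding Q_eq[OF x] sum_distrib_left sum_divide_distrib sum_subtractf[symmetric] sum.distrib[symmetric]
        by (rule sum.cong) (simp_all add: algebra_simps)
      then show ?thesis by simp
    qed
    have 3: "(\<Sum>r\<in>UNIV. Q x m r * Gam x r k i) = lam / 2 * Gam x m k i - (\<Sum>r\<in>UNIV. K x m r * Gam x r k i) + (\<Sum>r\<in>UNIV. W x m r * Gam x r k i) / 2"
    proof -
      have "(\<Sum>r\<in>UNIV. Q x m r * Gam x r k i) = lam / 2 * (\<Sum>r\<in>UNIV. (if m = r then 1 else 0) * Gam x r k i)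
        - (\<Sum>r\<in>UNIV. K x m r * Gam x r k i) + (\<Sum>r\<in>UNIV. W x m r * Gam x r k i) / 2"
        unfolding Q_eq[OF x] sum_distrib_left sum_divide_distrib sum_subtractf[symmetric] sum.distrib[symmetric]
        by (rule sum.cong) (simp_all add: algebra_simps)
      then show ?thesis by simp
    qed
    show ?thesis unfolding covariant_deriv_def 1 2 3 by (simp add: field_simps)
  qed
  have "(\<Sum>j\<in>UNIV. G x $ i $ j * Dv j) = 2 * (\<Sum>r\<in>UNIV. (J x * G x $ i $ r + (real CARD('n) - 2) * p x i r) * X x $ r)" for i
  proof -
    have "(\<Sum>j\<in>UNIV. G x $ i $ j * Dv j) = (\<Sum>m\<in>UNIV. \<nabla> W x m m i)"
      unfolding W Dv_def sum_distrib_left by (rule sum.swap)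
    also have "\<dots> = 2 * (partial_deriv i J x + (\<Sum>m\<in>UNIV. \<nabla> K x m m i))"
      using divergence_Q[OF x, of i] unfolding Q by (simp add: sum.distrib sum_negf sum_divide_distrib[symmetric] sum_subtractf)
    also have "(\<Sum>m\<in>UNIV. \<nabla> K x m m i) = (\<Sum>m\<in>UNIV. \<nabla> K x i m m) + (\<Sum>m\<in>UNIV. \<Sum>r\<in>UNIV. curvature_op G x m i r m * X x $ r)"
      using ricci_identity[OF x, of _ _ i] by (simp add: sum.distrib[symmetric] algebra_simps)
    also have "(\<Sum>m\<in>UNIV. \<nabla> K x i m m) = partial_deriv i (\<lambda>y. real CARD('n) * lam / 2 - J y) x"
      unfolding trace_covariant_deriv[OF x sm_tensors(1)] by (rule pd_cong[OF x trace_K])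
    also have "\<dots> = - partial_deriv i J x" using x by (simp add: pd_rules)
    also have "(\<Sum>m\<in>UNIV. \<Sum>r\<in>UNIV. curvature_op G x m i r m * X x $ r)
      = (\<Sum>r\<in>UNIV. (J x * G x $ i $ r + (real CARD('n) - 2) * p x i r) * X x $ r)"
      by (subst sum.swap) (simp add: sum_distrib_right[symmetric] ricci_eq[OF x])
    finally show ?thesis by simp
  qed
  moreover have "(\<Sum>r\<in>UNIV. (J x * G x $ i $ r + (real CARD('n) - 2) * p x i r) * X x $ r) = (\<Sum>j\<in>UNIV. G x $ i $ j * Y x j)" for i
  proof -
    have "(\<Sum>r\<in>UNIV. p x i r * X x $ r) = (\<Sum>j\<in>UNIV. G x $ i $ j * (\<Sum>r\<in>UNIV. Q x j r * X x $ r))"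
      unfolding p_lower[OF x] sum_distrib_left sum_distrib_right by (subst sum.swap) (simp add: mult_ac)
    then show ?thesis
      unfolding Y_def by (simp add: distrib_left distrib_right sum.distrib sum_distrib_left[symmetric] mult.assoc mult.left_commute[of "G x $ i $ _"])
  qed
  moreover have "(\<Sum>j\<in>UNIV. G x $ i $ j * (2 * Y x j)) = 2 * (\<Sum>j\<in>UNIV. G x $ i $ j * Y x j)" for i
    by (simp add: sum_distrib_left mult.left_commute)
  ultimately have GD: "(\<Sum>j\<in>UNIV. G x $ i $ j * Dv j) = (\<Sum>j\<in>UNIV. G x $ i $ j * (2 * Y x j))" for i
    by simp
  have "Dv j = 2 * Y x j"
    using raise_lower[OF x, of j Dv] raise_lower[OF x, of j "\<lambda>j. 2 * Y x j"] GD by simp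
  moreover have "Dv j = (\<Sum>m\<in>UNIV. partial_deriv m (\<lambda>y. w y m j) x) + (\<Sum>m\<in>UNIV. (\<Sum>r\<in>UNIV. Gam x r r m) * w x m j)"
  proof -
    have "(\<Sum>m\<in>UNIV. \<Sum>r\<in>UNIV. Gam x j m r * w x m r) = 0"
      by (rule sum_symmetric_w_eq_0[OF x Gam_sym[OF x]])
    moreover have "(\<Sum>m\<in>UNIV. \<Sum>r\<in>UNIV. Gam x m m r * w x r j) = (\<Sum>m\<in>UNIV. (\<Sum>r\<in>UNIV. Gam x r r m) * w x m j)"
      unfolding sum_distrib_right by (rule sum.swap)
    ultimately show ?thesis unfolding Dv_def D_def by (simp add: sum.distrib)
  qed
  ultimately show ?thesis by simp
qed

text \<open>The one-form in question is the logarithmic differential of the Riemannian density.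
  Closedness is obtained here without the density: its exterior derivative is the trace of the
  curvature endomorphism of the \<open>i\<close>-th and \<open>j\<close>-th coordinate fields, which
  vanishes by \<open>curvature_eq\<close> and the symmetry of \<open>p\<close>.\<close>

lemma trace_connection_closed:
  assumes x: "x \<in> U"
  shows "partial_deriv i (\<lambda>y. \<Sum>m\<in>UNIV. Gam y m m j) x = partial_deriv j (\<lambda>y. \<Sum>m\<in>UNIV. Gam y m m i) x"
proof -
  have "(\<Sum>m\<in>UNIV. curvature_op G x i j m m) = partial_deriv i (\<lambda>y. \<Sum>m\<in>UNIV. Gam y m j m) x
    - partial_deriv j (\<lambda>y. \<Sum>m\<in>UNIV. Gam y m i m) x
    + ((\<Sum>m\<in>UNIV. \<Sum>r\<in>UNIV. Gam x r j m * Gam x m i r) - (\<Sum>m\<in>UNIV. \<Sum>r\<in>UNIV. Gam x r i m * Gam x m j r))"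
    unfolding curvature_op_def using x by (simp add: pd_rules sum.distrib sum_subtractf)
  also have "(\<Sum>m\<in>UNIV. \<Sum>r\<in>UNIV. Gam x r j m * Gam x m i r) = (\<Sum>m\<in>UNIV. \<Sum>r\<in>UNIV. Gam x r i m * Gam x m j r)"
    by (subst sum.swap) (simp add: mult.commute)
  finally have "(\<Sum>m\<in>UNIV. curvature_op G x i j m m) = partial_deriv i (\<lambda>y. \<Sum>m\<in>UNIV. Gam y m j m) x
    - partial_deriv j (\<lambda>y. \<Sum>m\<in>UNIV. Gam y m i m) x" by simp
  moreover have "(\<Sum>m\<in>UNIV. curvature_op G x i j m m) = p x j i + p x j i - p x i j - p x i j"
    unfolding curvature_eq[OF x] p_lower[OF x, of j i] p_lower[OF x, of i j]
    by (simp add: sum.distrib sum_subtractf mult.commute flip: p_lower[OF x])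
  moreover have "partial_deriv i (\<lambda>y. \<Sum>m\<in>UNIV. Gam y m j m) x = partial_deriv i (\<lambda>y. \<Sum>m\<in>UNIV. Gam y m m j) x" for i j
    by (rule pd_cong[OF x]) (simp add: Gam_sym[of _ _ j])
  ultimately show ?thesis by (simp add: p_sym[OF x, of j i])
qed

text \<open>\<open>Y\<close> is half the divergence of \<open>w\<close>, so this is
  \<open>div div w = 0\<close>. With the trace form \<open>c\<close> the double divergence expands
  into second derivatives of \<open>w\<close> (\<open>z1\<close>), derivatives of \<open>c\<close>
  (\<open>z2\<close>), terms quadratic in \<open>c\<close> (\<open>z3\<close>) and mixed terms
  (\<open>z4\<close>). The first three contract \<open>w\<close> with something symmetric; the mixed
  terms cancel each other.\<close>

lemma divergence_Y:
  assumes x: "x \<in> U"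
  shows "(\<Sum>j\<in>UNIV. partial_deriv j (\<lambda>y. Y y j) x) + (\<Sum>j\<in>UNIV. (\<Sum>r\<in>UNIV. Gam x r r j) * Y x j) = 0"
proof -
  define c where "c y m = (\<Sum>r\<in>UNIV. Gam y r r m)" for y m
  have sm_c [simp]: "smooth_on U (\<lambda>y. c y m)" for m unfolding c_def by simp
  define S where "S j = (\<Sum>m\<in>UNIV. partial_deriv m (\<lambda>y. w y m j) x)" for j
  have Y: "Y y j = ((\<Sum>m\<in>UNIV. partial_deriv m (\<lambda>y. w y m j) y) + (\<Sum>m\<in>UNIV. c y m * w y m j)) / 2" if "y \<in> U" for y j
    unfolding c_def divergence_w[OF that] by simp
  have "partial_deriv j (\<lambda>y. Y y j) x = partial_deriv j (\<lambda>y. ((\<Sum>m\<in>UNIV. partial_deriv m (\<lambda>y. w y m j) y) + (\<Sum>m\<in>UNIV. c y m * w y m j)) / 2) x" for j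
    by (rule pd_cong[OF x Y])
  then have dY: "2 * partial_deriv j (\<lambda>y. Y y j) x = (\<Sum>m\<in>UNIV. partial_deriv j (partial_deriv m (\<lambda>y. w y m j)) x)
    + (\<Sum>m\<in>UNIV. c x m * partial_deriv j (\<lambda>y. w y m j) x) + (\<Sum>m\<in>UNIV. partial_deriv j (\<lambda>y. c y m) x * w x m j)" for j
    using x by (simp add: pd_rules sum.distrib algebra_simps)
  have anti: "partial_deriv k (\<lambda>y. w y i j) z = - partial_deriv k (\<lambda>y. w y j i) z" if "z \<in> U" for k i j z
  proof -
    have "partial_deriv k (\<lambda>y. w y i j) z = partial_deriv k (\<lambda>y. 0 - w y j i) z"
      using w_antisym[of _ i j] by simp
    then show ?thesis using that by (simp add: pd_rules del: diff_0)
  qed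
  have z1: "(\<Sum>j\<in>UNIV. \<Sum>m\<in>UNIV. partial_deriv j (partial_deriv m (\<lambda>y. w y m j)) x) = 0"
  proof (rule sum_antisymmetric_eq_0)
    fix i j
    have "partial_deriv i (partial_deriv j (\<lambda>y. w y j i)) x = partial_deriv i (\<lambda>y. 0 - partial_deriv j (\<lambda>y. w y i j) y) x"
      by (rule pd_cong[OF x]) (simp add: anti[of _ _ j i])
    also have "\<dots> = - partial_deriv i (partial_deriv j (\<lambda>y. w y i j)) x"
      using x by (simp add: pd_rules del: diff_0)
    finally show "partial_deriv i (partial_deriv j (\<lambda>y. w y j i)) x = - partial_deriv j (partial_deriv i (\<lambda>y. w y i j)) x"
      using x by (simp add: pd_commute)
  qed
  have z2: "(\<Sum>j\<in>UNIV. \<Sum>m\<in>UNIV. partial_deriv j (\<lambda>y. c y m) x * w x m j) = 0"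
  proof (rule sum_antisymmetric_eq_0)
    fix i j show "partial_deriv i (\<lambda>y. c y j) x * w x j i = - (partial_deriv j (\<lambda>y. c y i) x * w x i j)"
      unfolding c_def trace_connection_closed[OF x, of i j] w_antisym[of x i j] by simp
  qed
  have z3: "(\<Sum>j\<in>UNIV. \<Sum>m\<in>UNIV. c x j * (c x m * w x m j)) = 0"
  proof (rule sum_antisymmetric_eq_0)
    fix i j show "c x i * (c x j * w x j i) = - (c x j * (c x i * w x i j))"
      unfolding w_antisym[of x i j] by simp
  qed
  have z4: "(\<Sum>j\<in>UNIV. \<Sum>m\<in>UNIV. c x m * partial_deriv j (\<lambda>y. w y m j) x) = - (\<Sum>j\<in>UNIV. c x j * S j)"
  proof -
    have "(\<Sum>j\<in>UNIV. \<Sum>m\<in>UNIV. c x m * partial_deriv j (\<lambda>y. w y m j) x)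
      = (\<Sum>m\<in>UNIV. \<Sum>j\<in>UNIV. c x m * partial_deriv j (\<lambda>y. w y m j) x)"
      by (rule sum.swap)
    also have "\<dots> = (\<Sum>m\<in>UNIV. \<Sum>j\<in>UNIV. - (c x m * partial_deriv j (\<lambda>y. w y j m) x))"
      by (intro sum.cong refl) (metis anti[OF x] minus_mult_right)
    finally show ?thesis unfolding S_def sum_distrib_left by (simp add: sum_negf)
  qed
  have "2 * ((\<Sum>j\<in>UNIV. partial_deriv j (\<lambda>y. Y y j) x) + (\<Sum>j\<in>UNIV. c x j * Y x j))
    = (\<Sum>j\<in>UNIV. 2 * partial_deriv j (\<lambda>y. Y y j) x) + (\<Sum>j\<in>UNIV. c x j * (S j + (\<Sum>m\<in>UNIV. c x m * w x m j)))"
  proof -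
    have "2 * (c x j * Y x j) = c x j * (S j + (\<Sum>m\<in>UNIV. c x m * w x m j))" for j
      by (simp add: Y[OF x] S_def)
    then show ?thesis by (simp only: distrib_left[of 2] sum_distrib_left[of 2])
  qed
  also have "\<dots> = 0"
    unfolding dY using z1 z2 z3 z4 by (simp add: sum.distrib distrib_left sum_distrib_left)
  finally show ?thesis unfolding c_def by simp
qed

text \<open>Product rule for the vanishing divergence of \<open>Y = J X + (n - 2) Q X\<close>.
  \<open>XK\<close> is the divergence of \<open>X\<close>, and \<open>QX\<close> says
  \<open>div (Q X) = X(J) + tr (Q K)\<close>, where \<open>divergence_Q\<close> supplies
  \<open>X(J)\<close>. Finally \<open>tr (Q K) = lam/2 J - tr (Q Q)\<close>, because
  \<open>W\<close> is skew and \<open>Q\<close> self-adjoint.\<close>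

lemma schouten_identity:
  assumes x: "x \<in> U"
  shows "(real CARD('n) - 1) * (\<Sum>i\<in>UNIV. X x $ i * partial_deriv i J x)
    = (real CARD('n) - 2) * (\<Sum>i\<in>UNIV. \<Sum>j\<in>UNIV. Q x i j * Q x j i) + (J x)\<^sup>2 - (real CARD('n) - 1) * lam * J x"
proof -
  define n where "n = real CARD('n)"
  define c where "c m = (\<Sum>r\<in>UNIV. Gam x r r m)" for m
  define XJ where "XJ = (\<Sum>i\<in>UNIV. X x $ i * partial_deriv i J x)"
  define QK where "QK = (\<Sum>i\<in>UNIV. \<Sum>j\<in>UNIV. Q x i j * K x j i)"
  define q where "q = (\<Sum>i\<in>UNIV. \<Sum>j\<in>UNIV. Q x i j * Q x j i)"
  define T where "T y j = (\<Sum>r\<in>UNIV. Q y j r * X y $ r)" for y j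
  have sm_T: "smooth_on U (\<lambda>y. T y j)" for j unfolding T_def by simp
  have XK: "(\<Sum>j\<in>UNIV. partial_deriv j (\<lambda>y. X y $ j) x) + (\<Sum>j\<in>UNIV. c j * X x $ j) = n * lam / 2 - J x"
  proof -
    have "(\<Sum>j\<in>UNIV. c j * X x $ j) = (\<Sum>j\<in>UNIV. \<Sum>k\<in>UNIV. Gam x j j k * X x $ k)"
      unfolding c_def sum_distrib_right by (rule sum.swap)
    then show ?thesis using trace_K[OF x] unfolding K_def n_def by (simp add: sum.distrib)
  qed
  have QX: "(\<Sum>j\<in>UNIV. partial_deriv j (\<lambda>y. T y j) x) + (\<Sum>j\<in>UNIV. c j * T x j) = XJ + QK"
  proof -
    have a: "(\<Sum>j\<in>UNIV. \<Sum>r\<in>UNIV. X x $ r * (\<Sum>s\<in>UNIV. Gam x j j s * Q x s r)) = (\<Sum>j\<in>UNIV. c j * (\<Sum>r\<in>UNIV. Q x j r * X x $ r))"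
    proof -
      have "(\<Sum>j\<in>UNIV. \<Sum>r\<in>UNIV. X x $ r * (\<Sum>s\<in>UNIV. Gam x j j s * Q x s r)) = (\<Sum>j\<in>UNIV. \<Sum>s\<in>UNIV. \<Sum>r\<in>UNIV. Gam x j j s * (Q x s r * X x $ r))"
        unfolding sum_distrib_left by (subst (2) sum.swap) (simp add: mult_ac)
      also have "\<dots> = (\<Sum>s\<in>UNIV. \<Sum>j\<in>UNIV. \<Sum>r\<in>UNIV. Gam x j j s * (Q x s r * X x $ r))"
        by (rule sum.swap)
      finally show ?thesis unfolding c_def sum_product .
    qed
    have b: "(\<Sum>j\<in>UNIV. \<Sum>r\<in>UNIV. X x $ r * (\<Sum>s\<in>UNIV. Q x j s * Gam x s j r)) = (\<Sum>j\<in>UNIV. \<Sum>r\<in>UNIV. Q x j r * (\<Sum>k\<in>UNIV. Gam x r j k * X x $ k))"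
      unfolding sum_distrib_left by (subst (2) sum.swap) (simp add: mult_ac)
    have "XJ = (\<Sum>i\<in>UNIV. X x $ i * (\<Sum>m\<in>UNIV. \<nabla> Q x m m i))"
      unfolding XJ_def divergence_Q[OF x] ..
    also have "\<dots> = (\<Sum>m\<in>UNIV. \<Sum>i\<in>UNIV. X x $ i * \<nabla> Q x m m i)"
      unfolding sum_distrib_left by (rule sum.swap)
    also have "\<dots> = (\<Sum>m\<in>UNIV. \<Sum>i\<in>UNIV. X x $ i * partial_deriv m (\<lambda>y. Q y m i) x)
      + (\<Sum>j\<in>UNIV. c j * (\<Sum>r\<in>UNIV. Q x j r * X x $ r)) - (\<Sum>j\<in>UNIV. \<Sum>r\<in>UNIV. Q x j r * (\<Sum>k\<in>UNIV. Gam x r j k * X x $ k))"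
      unfolding covariant_deriv_def a[symmetric] b[symmetric]
      by (simp only: distrib_left right_diff_distrib sum.distrib sum_subtractf)
    finally have "XJ + QK = (\<Sum>m\<in>UNIV. \<Sum>i\<in>UNIV. X x $ i * partial_deriv m (\<lambda>y. Q y m i) x)
      + (\<Sum>j\<in>UNIV. c j * (\<Sum>r\<in>UNIV. Q x j r * X x $ r)) + (\<Sum>j\<in>UNIV. \<Sum>r\<in>UNIV. Q x j r * partial_deriv j (\<lambda>y. X y $ r) x)"
      unfolding QK_def K_def by (simp add: distrib_left sum.distrib)
    then show ?thesis unfolding T_def using x by (simp add: pd_rules sum.distrib mult.commute)
  qed
  have dY: "partial_deriv j (\<lambda>y. Y y j) x = J x * partial_deriv j (\<lambda>y. X y $ j) x + partial_deriv j J x * X x $ j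
    + (n - 2) * partial_deriv j (\<lambda>y. T y j) x" for j
    unfolding Y_def n_def T_def[symmetric] using x sm_T by (simp add: pd_add pd_mult)
  have "(\<Sum>j\<in>UNIV. partial_deriv j (\<lambda>y. Y y j) x) + (\<Sum>j\<in>UNIV. c j * Y x j)
     = J x * (n * lam / 2 - J x) + XJ + (n - 2) * (XJ + QK)"
    unfolding dY unfolding Y_def T_def[symmetric] n_def[symmetric] XK[symmetric] QX[symmetric] unfolding XJ_def
    by (simp add: sum.distrib distrib_left sum_distrib_left mult_ac)
  then have 1: "J x * (n * lam / 2 - J x) + XJ + (n - 2) * (XJ + QK) = 0"
    using divergence_Y[OF x] unfolding c_def by simp
  have "QK = lam / 2 * J x - q"
  proof -
    have "Q x i j * K x j i = lam / 2 * (Q x i j * (if j = i then 1 else 0)) - Q x i j * Q x j i + Q x i j * W x j i / 2" for i j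
      unfolding Q_eq[OF x, of j i] by (simp add: algebra_simps)
    then have "QK = (\<Sum>i\<in>UNIV. \<Sum>j\<in>UNIV. lam / 2 * (Q x i j * (if j = i then 1 else 0)) - Q x i j * Q x j i + Q x i j * W x j i / 2)"
      unfolding QK_def by (simp only:)
    also have "\<dots> = lam / 2 * J x - q + (\<Sum>i\<in>UNIV. \<Sum>j\<in>UNIV. Q x i j * W x j i) / 2"
      unfolding sum.distrib sum_subtractf sum_distrib_left[symmetric] sum_divide_distrib[symmetric] by (simp add: J_def q_def)
    also have "(\<Sum>i\<in>UNIV. \<Sum>j\<in>UNIV. Q x i j * W x j i) = (\<Sum>j\<in>UNIV. \<Sum>t\<in>UNIV. p x t j * w x j t)"
    proof -
      have "(\<Sum>i\<in>UNIV. \<Sum>j\<in>UNIV. Q x i j * W x j i) = (\<Sum>j\<in>UNIV. \<Sum>i\<in>UNIV. \<Sum>t\<in>UNIV. Q x i j * (G x $ i $ t * w x j t))"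
        unfolding W_def sum_distrib_left by (rule sum.swap)
      also have "\<dots> = (\<Sum>j\<in>UNIV. \<Sum>t\<in>UNIV. \<Sum>i\<in>UNIV. Q x i j * (G x $ i $ t * w x j t))"
        by (intro sum.cong refl sum.swap)
      also have "\<dots> = (\<Sum>j\<in>UNIV. \<Sum>t\<in>UNIV. p x t j * w x j t)"
        unfolding p_lower[OF x] sum_distrib_right by (simp add: G_sym[OF x, of _ t for t] mult_ac)
      finally show ?thesis .
    qed
    also have "\<dots> = 0" by (rule sum_symmetric_w_eq_0[OF x p_sym[OF x]])
    finally show ?thesis by simp
  qed
  with 1 show ?thesis
    unfolding XJ_def[symmetric] q_def[symmetric] n_def[symmetric] by (simp add: field_simps power2_eq_square)
qed

section \<open>Pinching of \<open>J\<close> at critical points and the equality case\<close>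

lemma lie_eq_p: "lie_deriv_metric G X x i j = lam * G x $ i $ j - 2 * p x i j"
  by (simp add: p_def)

text \<open>With \<open>a = J/n\<close> the tensor \<open>t\<close> is the trace-free part of
  \<open>p\<close>, and its squared norm is \<open>tr (Q Q) - J^2 / n\<close>.\<close>

lemma trace_Q_square:
  assumes x: "x \<in> U"
  shows "(\<Sum>i\<in>UNIV. \<Sum>j\<in>UNIV. Q x i j * Q x j i) \<ge> (J x)\<^sup>2 / real CARD('n)"
    and "(\<Sum>i\<in>UNIV. \<Sum>j\<in>UNIV. Q x i j * Q x j i) = (J x)\<^sup>2 / real CARD('n)
      \<Longrightarrow> p x i j = J x / real CARD('n) * G x $ i $ j"
proof -
  define a where "a = J x / real CARD('n)"
  define t where "t = (\<chi> i j. p x i j - a * G x $ i $ j)"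
  define q where "q = (\<Sum>i\<in>UNIV. \<Sum>j\<in>UNIV. Q x i j * Q x j i)"
  have G: "transpose (G x) = G x" and t: "transpose t = t"
    using G_sym[OF x] p_sym[OF x] by (simp_all add: t_def transpose_def vec_eq_iff)
  have T: "(matrix_inv (G x) ** t) $ m $ i = Q x m i - a * (if m = i then 1 else 0)" for m i
  proof -
    have "(matrix_inv (G x) ** t) $ m $ i = Q x m i - a * (\<Sum>j\<in>UNIV. gi x m j * G x $ j $ i)"
      by (simp add: matrix_matrix_mult_def t_def Q_def right_diff_distrib sum_subtractf sum_distrib_left mult.left_commute)
    then show ?thesis by (simp only: gi_G[OF x])
  qed
  have "trace ((matrix_inv (G x) ** t) ** (matrix_inv (G x) ** t))
      = (\<Sum>i\<in>UNIV. \<Sum>j\<in>UNIV. (Q x i j - a * (if i = j then 1 else 0)) * (Q x j i - a * (if j = i then 1 else 0)))"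
    unfolding trace_def by (simp add: matrix_matrix_mult_def[of "_ ** _"] T)
  also have "\<dots> = (\<Sum>i\<in>UNIV. \<Sum>j\<in>UNIV. Q x i j * Q x j i - a * (Q x i j * (if j = i then 1 else 0))
      - a * (Q x j i * (if i = j then 1 else 0)) + a * a * ((if i = j then 1 else 0) * (if i = j then 1 else 0)))"
    by (intro sum.cong refl) (simp add: algebra_simps)
  also have "\<dots> = q - a * J x - a * J x + a * a * real CARD('n)"
    unfolding sum.distrib sum_subtractf sum_distrib_left[symmetric] q_def J_def by simp
  also have "\<dots> = q - (J x)\<^sup>2 / real CARD('n)"
    by (simp add: a_def power2_eq_square field_simps)
  finally have tr: "trace ((matrix_inv (G x) ** t) ** (matrix_inv (G x) ** t)) = q - (J x)\<^sup>2 / real CARD('n)" .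
  note * = trace_square_raised[OF G G_pos[OF x] t inverse_G(2)[OF x], unfolded tr]
  show "q \<ge> (J x)\<^sup>2 / real CARD('n)" using *(1) by simp
  show "p x i j = J x / real CARD('n) * G x $ i $ j" if "q = (J x)\<^sup>2 / real CARD('n)"
    using *(2) that by (simp add: t_def vec_eq_iff a_def)
qed

text \<open>At a critical point the left side of \<open>schouten_identity\<close> vanishes.
  Replacing \<open>tr (Q Q)\<close> by its lower bound is allowed because \<open>n - 2 > 0\<close>,
  and the resulting quadratic in \<open>J\<close> has the roots \<open>0\<close> and
  \<open>n lam / 2\<close>.\<close>

lemma J_critical_point:
  assumes x: "x \<in> U" and crit: "\<And>i. partial_deriv i J x = 0"
  shows "J x * (J x - real CARD('n) * lam / 2) \<le> 0"
proof -
  define n where "n = real CARD('n)"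
  define q where "q = (\<Sum>i\<in>UNIV. \<Sum>j\<in>UNIV. Q x i j * Q x j i)"
  have n: "n \<ge> 3" using dim by (simp add: n_def)
  have "0 = (n - 2) * q + (J x)\<^sup>2 - (n - 1) * lam * J x"
    using schouten_identity[OF x] crit by (simp add: n_def q_def)
  moreover have "(n - 2) * ((J x)\<^sup>2 / n) \<le> (n - 2) * q"
    using trace_Q_square(1)[OF x] n by (intro mult_left_mono) (auto simp: n_def q_def)
  ultimately have "(n - 2) * ((J x)\<^sup>2 / n) + (J x)\<^sup>2 - (n - 1) * lam * J x \<le> 0" by linarith
  also have "(n - 2) * ((J x)\<^sup>2 / n) + (J x)\<^sup>2 - (n - 1) * lam * J x = (2 * (n - 1) / n) * (J x * (J x - n * lam / 2))"
    using n by (simp add: field_simps power2_eq_square)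
  finally have "(2 * (n - 1) / n) * (J x * (J x - n * lam / 2)) \<le> 0" .
  moreover have "2 * (n - 1) / n > 0" using n by simp
  ultimately have "J x * (J x - n * lam / 2) \<le> 0" by (meson mult_pos_pos not_le)
  then show ?thesis by (simp add: n_def)
qed

lemma lie_deriv_eq_0_if_J_const:
  assumes const: "\<And>y. y \<in> U \<Longrightarrow> J y = real CARD('n) * lam / 2" and x: "x \<in> U"
  shows "lie_deriv_metric G X x i j = 0"
proof -
  define n where "n = real CARD('n)"
  define q where "q = (\<Sum>i\<in>UNIV. \<Sum>j\<in>UNIV. Q x i j * Q x j i)"
  have n: "n \<ge> 3" using dim by (simp add: n_def)
  have J: "J x = n * lam / 2" using const[OF x] by (simp add: n_def)
  have "partial_deriv i J x = 0" for i
    using pd_cong[OF x const] by simp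
  then have "(n - 2) * q + (J x)\<^sup>2 - (n - 1) * lam * J x = 0"
    using schouten_identity[OF x] by (simp add: n_def q_def)
  \<comment> \<open>For \<open>J = n lam / 2\<close> one has
    \<open>J^2 - (n - 1) lam J = - (n - 2) J^2 / n\<close>.\<close>
  then have "(n - 2) * (q - (J x)\<^sup>2 / n) = 0"
    using n unfolding J by (simp add: field_simps power2_eq_square)
  then have "q = (J x)\<^sup>2 / n" using n by simp
  from trace_Q_square(2)[OF x, folded q_def n_def, OF this, of i j]
  have "p x i j = lam / 2 * G x $ i $ j" using n by (simp add: J)
  then show ?thesis by (simp add: lie_eq_p)
qed

end

section \<open>Relabelling the coordinates by a well-ordered type\<close>

text \<open>The change of variables theorem of the library needs a well-ordered index type, which an
  arbitrary finite type is not.\<close>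

typedef 'a relabelled = "UNIV :: 'a set" morphisms unlabel relabel by simp

lemma bij_unlabel: "bij (unlabel :: 'a relabelled \<Rightarrow> 'a)"
  by (metis bijI' relabel_inverse UNIV_I unlabel_inject)

instance relabelled :: (finite) finite
proof
  show "finite (UNIV :: 'a relabelled set)"
    using bij_unlabel bij_betw_finite[of unlabel "UNIV :: 'a relabelled set" "UNIV :: 'a set"] by simp
qed

instantiation relabelled :: (finite) wellorder
begin

definition less_eq_relabelled :: "'a relabelled \<Rightarrow> 'a relabelled \<Rightarrow> bool" where
  "a \<le> b \<longleftrightarrow> to_nat (unlabel a) \<le> to_nat (unlabel b)"

definition less_relabelled :: "'a relabelled \<Rightarrow> 'a relabelled \<Rightarrow> bool" where
  "a < b \<longleftrightarrow> to_nat (unlabel a) < to_nat (unlabel b)"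

instance
proof
  fix P :: "'a relabelled \<Rightarrow> bool" and a
  assume step: "\<And>x. (\<And>y. y < x \<Longrightarrow> P y) \<Longrightarrow> P x"
  show "P a"
    by (induction a rule: measure_induct_rule[of "\<lambda>a. to_nat (unlabel a)"]) (auto intro: step simp: less_relabelled_def)
qed (auto simp: less_eq_relabelled_def less_relabelled_def unlabel_inject)

end

lemma unlabel_relabel [simp]: "unlabel (relabel a) = a" "relabel (unlabel b) = b"
  by (simp_all add: relabel_inverse unlabel_inverse)

lemma sum_unlabel: "(\<Sum>a\<in>UNIV. f (unlabel a)) = (\<Sum>i\<in>(UNIV :: 'n::finite set). f i)"
  by (rule sum.reindex_bij_betw[OF bij_unlabel])

definition relabel_vec :: "'a ^ 'n \<Rightarrow> 'a ^ 'n relabelled" where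
  "relabel_vec x = (\<chi> a. x $ unlabel a)"

definition unlabel_vec :: "'a ^ 'n relabelled \<Rightarrow> 'a ^ 'n" where
  "unlabel_vec y = (\<chi> i. y $ relabel i)"

definition relabel_matrix :: "'a ^ 'n ^ 'n \<Rightarrow> 'a ^ 'n relabelled ^ 'n relabelled" where
  "relabel_matrix M = (\<chi> a b. M $ unlabel a $ unlabel b)"

lemma relabel_vec_inverse [simp]: "unlabel_vec (relabel_vec x) = x" "relabel_vec (unlabel_vec y) = y"
  by (simp_all add: relabel_vec_def unlabel_vec_def vec_eq_iff)

lemma bounded_linear_relabel_vec: "bounded_linear (relabel_vec :: real ^ 'n \<Rightarrow> real ^ 'n::finite relabelled)"
  unfolding linear_conv_bounded_linear[symmetric]
  by (rule linearI) (simp_all add: relabel_vec_def vec_eq_iff)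

lemma bounded_linear_unlabel_vec: "bounded_linear (unlabel_vec :: real ^ 'n::finite relabelled \<Rightarrow> real ^ 'n)"
  unfolding linear_conv_bounded_linear[symmetric]
  by (rule linearI) (simp_all add: unlabel_vec_def vec_eq_iff)

lemma relabel_matrix_mult:
  fixes M N :: "real ^ 'n::finite ^ 'n"
  shows "relabel_matrix (M ** N) = relabel_matrix M ** relabel_matrix N"
  unfolding relabel_matrix_def matrix_matrix_mult_def
  by (simp add: vec_eq_iff sum_unlabel[of "\<lambda>i. M $ _ $ i * N $ i $ _"])

lemma relabel_matrix_transpose: "relabel_matrix (transpose M) = transpose (relabel_matrix M)"
  by (simp add: relabel_matrix_def transpose_def vec_eq_iff)

lemma relabel_matrix_one: "relabel_matrix (mat 1) = mat 1"
  by (simp add: relabel_matrix_def mat_def vec_eq_iff unlabel_inject)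

text \<open>Relabelling coordinates maps boxes to boxes with the same side lengths, and Lebesgue
  measure is determined by its values on boxes.\<close>

lemma distr_unlabel_vec: "distr lborel borel (unlabel_vec :: real ^ 'n::finite relabelled \<Rightarrow> real ^ 'n) = lborel"
proof (rule lborel_eqI[symmetric])
  fix l u :: "real ^ 'n"
  assume lu: "\<And>b. b \<in> Basis \<Longrightarrow> l \<bullet> b \<le> u \<bullet> b"
  have meas: "unlabel_vec \<in> borel_measurable (borel :: (real ^ 'n relabelled) measure)"
    by (intro borel_measurable_continuous_onI linear_continuous_on bounded_linear_unlabel_vec)
  have le: "l $ i \<le> u $ i" for i
    using lu[of "axis i 1"] by (simp add: inner_axis)
  have prod: "(\<Prod>b\<in>Basis. (v - w) \<bullet> b) = (\<Prod>i\<in>UNIV. v $ i - w $ i)" for v w :: "real ^ 'k::finite"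
  proof -
    have "(\<Prod>b\<in>Basis. (v - w) \<bullet> b) = (\<Prod>b\<in>(\<lambda>i. axis i 1) ` UNIV. (v - w) \<bullet> b)"
      by (rule prod.cong) (auto simp: Basis_vec_def)
    also have "\<dots> = (\<Prod>i\<in>UNIV. (v - w) \<bullet> axis i 1)"
      by (subst prod.reindex) (auto simp: inj_on_def axis_eq_axis)
    finally show ?thesis by (simp add: inner_axis)
  qed
  have box: "unlabel_vec -` box l u = box (relabel_vec l) (relabel_vec u)"
    by (auto simp: mem_box_cart unlabel_vec_def relabel_vec_def) (metis unlabel_relabel)+
  have "emeasure (distr lborel borel unlabel_vec) (box l u) = emeasure lborel (box (relabel_vec l) (relabel_vec u))"
    using meas by (simp add: emeasure_distr box)
  also have "\<dots> = (\<Prod>b\<in>Basis. (relabel_vec u - relabel_vec l) \<bullet> b)"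
  proof (rule emeasure_lborel_box)
    fix b :: "real ^ 'n relabelled" assume "b \<in> Basis"
    then show "relabel_vec l \<bullet> b \<le> relabel_vec u \<bullet> b"
      using le by (auto simp: Basis_vec_def inner_axis relabel_vec_def)
  qed
  also have "(\<Prod>b\<in>Basis. (relabel_vec u - relabel_vec l) \<bullet> b) = (\<Prod>b\<in>Basis. (u - l) \<bullet> b)"
    unfolding prod by (simp add: relabel_vec_def prod.reindex_bij_betw[OF bij_unlabel, of "\<lambda>i. u $ i - l $ i"])
  finally show "emeasure (distr lborel borel unlabel_vec) (box l u) = ennreal (\<Prod>b\<in>Basis. (u - l) \<bullet> b)" .
qed simp

lemma
  fixes f :: "real ^ 'n::finite \<Rightarrow> real"
  assumes "integrable lborel f"
  shows integrable_unlabel_vec: "integrable lborel (\<lambda>y. f (unlabel_vec y))"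
    and integral_unlabel_vec: "(\<integral>y. f (unlabel_vec y) \<partial>lborel) = (\<integral>x. f x \<partial>lborel)"
proof -
  have meas: "unlabel_vec \<in> borel_measurable (lborel :: (real ^ 'n relabelled) measure)"
    using borel_measurable_continuous_onI[OF linear_continuous_on[OF bounded_linear_unlabel_vec]] by simp
  have f: "f \<in> borel_measurable borel"
    using borel_measurable_integrable[OF assms] by simp
  show "integrable lborel (\<lambda>y. f (unlabel_vec y))"
    using assms integrable_distr_eq[OF meas, of f] f unfolding distr_unlabel_vec by simp
  show "(\<integral>y. f (unlabel_vec y) \<partial>lborel) = (\<integral>x. f x \<partial>lborel)"
    using integral_distr[OF meas, of f] f unfolding distr_unlabel_vec by simp
qed

text \<open>The transformation formula for gauge integrals over \<open>S\<close> and its image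
  becomes one for Lebesgue integrals over the whole space, since \<open>f\<close> and
  \<open>h\<close> vanish outside these sets.\<close>

lemma integral_change_of_variables_lborel_wellorder:
  fixes f h :: "real ^ 'n::{finite, wellorder} \<Rightarrow> real"
  assumes S: "open S" and F: "\<And>x. x \<in> S \<Longrightarrow> (F has_derivative F' x) (at x)" and inj: "inj_on F S"
    and f: "integrable lborel f" "\<And>y. y \<notin> F ` S \<Longrightarrow> f y = 0"
    and h: "integrable lborel h" "\<And>x. x \<notin> S \<Longrightarrow> h x = 0"
    and hf: "\<And>x. x \<in> S \<Longrightarrow> h x = \<bar>det (matrix (F' x))\<bar> * f (F x)"
  shows "(\<integral>x. h x \<partial>lborel) = (\<integral>y. f y \<partial>lborel)"
proof -
  have f_eq: "(\<lambda>x. if x \<in> F ` S then f x else 0) = f" and h_eq: "(\<lambda>x. if x \<in> S then h x else 0) = h"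
    using f(2) h(2) by auto
  have abs: "f absolutely_integrable_on (F ` S)"
  proof -
    have "integrable lebesgue f"
      using integrable_completion[of f lborel] f(1) borel_measurable_integrable[OF f(1)] by simp
    then have "(\<lambda>x. if x \<in> F ` S then f x else 0) absolutely_integrable_on UNIV"
      unfolding f_eq by (simp add: set_integrable_def)
    then show ?thesis by (simp only: absolutely_integrable_restrict_UNIV)
  qed
  \<comment> \<open>The transformation formula is stated for vector-valued integrands, so
    \<open>f\<close> is embedded into \<open>real ^ 1\<close>.\<close>
  have "(\<lambda>x. vec (f x) :: real ^ 1) absolutely_integrable_on (F ` S)"
    using abs by (simp add: absolutely_integrable_on_1_iff)
  then have "integral S (\<lambda>x. \<bar>det (matrix (F' x))\<bar> *\<^sub>R (vec (f (F x)) :: real ^ 1)) = integral (F ` S) (\<lambda>x. vec (f x))"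
    using integral_change_of_variables[of S F F' "\<lambda>x. vec (f x) :: real ^ 1"] inj S F
    by (auto simp: has_derivative_at_withinI)
  then have "integral S (\<lambda>x. \<bar>det (matrix (F' x))\<bar> * f (F x)) = integral (F ` S) f"
    by (simp add: integral_on_1_eq vec_eq_iff)
  moreover have "integral S (\<lambda>x. \<bar>det (matrix (F' x))\<bar> * f (F x)) = integral S h"
    by (rule integral_cong) (simp add: hf)
  moreover have "integral S h = (\<integral>x. h x \<partial>lborel)"
    using integral_lborel[OF h(1)] integral_restrict_UNIV[of S h] by (simp add: h_eq)
  moreover have "integral (F ` S) f = (\<integral>x. f x \<partial>lborel)"
    using integral_lborel[OF f(1)] integral_restrict_UNIV[of "F ` S" f] by (simp add: f_eq)
  ultimately show ?thesis by simp
qed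

text \<open>Both integrals are pulled back by \<open>unlabel_vec\<close>, which conjugates
  \<open>F\<close> to \<open>F2\<close> and its Jacobian matrix to the relabelled one. The
  determinant is left in relabelled form, the form in which \<open>density\<close> is
  defined.\<close>

lemma integral_change_of_variables_lborel:
  fixes f h :: "real ^ 'n::finite \<Rightarrow> real"
  assumes S: "open S" and F: "\<And>x. x \<in> S \<Longrightarrow> (F has_derivative F' x) (at x)" and inj: "inj_on F S"
    and f: "integrable lborel f" "\<And>y. y \<notin> F ` S \<Longrightarrow> f y = 0"
    and h: "integrable lborel h" "\<And>x. x \<notin> S \<Longrightarrow> h x = 0"
    and hf: "\<And>x. x \<in> S \<Longrightarrow> h x = \<bar>det (relabel_matrix (matrix (F' x)))\<bar> * f (F x)"
  shows "(\<integral>x. h x \<partial>lborel) = (\<integral>y. f y \<partial>lborel)"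
proof -
  define S' where "S' = unlabel_vec -` S"
  define F2 where "F2 y = relabel_vec (F (unlabel_vec y))" for y
  have "(\<integral>y. h (unlabel_vec y) \<partial>lborel) = (\<integral>y. f (unlabel_vec y) \<partial>lborel)"
  proof (rule integral_change_of_variables_lborel_wellorder)
    show "open S'"
      unfolding S'_def using S by (intro open_vimage linear_continuous_on bounded_linear_unlabel_vec)
    show "(F2 has_derivative (\<lambda>v. relabel_vec (F' (unlabel_vec y) (unlabel_vec v)))) (at y)" if "y \<in> S'" for y
    proof -
      have "(unlabel_vec has_derivative unlabel_vec) (at y)"
        by (rule bounded_linear_imp_has_derivative[OF bounded_linear_unlabel_vec])
      from has_derivative_compose[OF this F] that
      have "((\<lambda>y. F (unlabel_vec y)) has_derivative (\<lambda>v. F' (unlabel_vec y) (unlabel_vec v))) (at y)"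
        by (simp add: S'_def)
      then show ?thesis unfolding F2_def
        by (rule bounded_linear.has_derivative[OF bounded_linear_relabel_vec])
    qed
    show "inj_on F2 S'"
      using inj unfolding inj_on_def F2_def S'_def by (metis relabel_vec_inverse vimageE)
    show "f (unlabel_vec y) = 0" if "y \<notin> F2 ` S'" for y
    proof (rule f(2))
      show "unlabel_vec y \<notin> F ` S"
      proof
        assume "unlabel_vec y \<in> F ` S"
        then obtain x where "x \<in> S" "unlabel_vec y = F x" by auto
        then have "y = F2 (relabel_vec x)" "relabel_vec x \<in> S'"
          unfolding F2_def S'_def by (metis relabel_vec_inverse, simp)
        with that show False by blast
      qed
    qed
    show "h (unlabel_vec y) = \<bar>det (matrix (\<lambda>v. relabel_vec (F' (unlabel_vec y) (unlabel_vec v))))\<bar> * f (unlabel_vec (F2 y))"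
      if "y \<in> S'" for y
    proof -
      have "unlabel_vec (axis a 1 :: real ^ 'n relabelled) = axis (unlabel a) 1" for a
        by (simp add: unlabel_vec_def axis_def vec_eq_iff) (metis unlabel_relabel)
      then have "matrix (\<lambda>v. relabel_vec (F' (unlabel_vec y) (unlabel_vec v))) = relabel_matrix (matrix (F' (unlabel_vec y)))"
        by (simp add: matrix_def relabel_vec_def relabel_matrix_def)
      then show ?thesis using hf that by (simp add: S'_def F2_def)
    qed
  qed (use f h integrable_unlabel_vec in \<open>auto simp: S'_def\<close>)
  then show ?thesis using f h by (simp add: integral_unlabel_vec)
qed

section \<open>The derivative of a determinant\<close>

text \<open>Jacobi's formula. The product rule makes the derivative a sum of determinants with one
  row differentiated, and each of these is evaluated by expanding that row in the rows of
  \<open>M x\<close>.\<close>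

lemma partial_deriv_det:
  fixes M :: "real ^ 'n::finite \<Rightarrow> real ^ 'k::finite ^ 'k"
  assumes M: "\<And>i j. (\<lambda>x. M x $ i $ j) differentiable (at x)" and inv: "N ** M x = mat 1"
  shows "partial_deriv c (\<lambda>x. det (M x)) x
    = det (M x) * (\<Sum>i\<in>UNIV. \<Sum>j\<in>UNIV. N $ j $ i * partial_deriv c (\<lambda>x. M x $ i $ j) x)"
proof -
  define D where "D i j = partial_deriv c (\<lambda>x. M x $ i $ j) x" for i j
  have "((\<lambda>x. det (M x)) has_derivative (\<lambda>v. \<Sum>p | p permutes UNIV. of_int (sign p) *
      (\<Sum>i\<in>UNIV. frechet_derivative (\<lambda>x. M x $ i $ p i) (at x) v * (\<Prod>j\<in>UNIV - {i}. M x $ j $ p j)))) (at x)"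
    unfolding det_def using M
    by (intro has_derivative_sum has_derivative_mult_right has_derivative_prod) (simp add: frechet_derivative_works[symmetric])
  then have "partial_deriv c (\<lambda>x. det (M x)) x = (\<Sum>p | p permutes UNIV. of_int (sign p) *
      (\<Sum>i\<in>UNIV. D i (p i) * (\<Prod>j\<in>UNIV - {i}. M x $ j $ p j)))"
    unfolding D_def partial_deriv_def[of _ "\<lambda>x. M x $ _ $ _"] by (rule partial_deriv_eq)
  also have "\<dots> = (\<Sum>i\<in>UNIV. \<Sum>p | p permutes UNIV. of_int (sign p) * (D i (p i) * (\<Prod>j\<in>UNIV - {i}. M x $ j $ p j)))"
    unfolding sum_distrib_left by (rule sum.swap)
  also have "\<dots> = (\<Sum>i\<in>UNIV. det (\<chi> j. if j = i then \<chi> l. D i l else row j (M x)))"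
  proof (rule sum.cong)
    fix i :: 'k
    have "(\<Prod>j\<in>UNIV. (\<chi> j. if j = i then \<chi> l. D i l else row j (M x)) $ j $ p j)
        = D i (p i) * (\<Prod>j\<in>UNIV - {i}. M x $ j $ p j)" for p
      by (subst prod.remove[of _ i]) (auto simp: row_def intro!: prod.cong)
    then show "(\<Sum>p | p permutes UNIV. of_int (sign p) * (D i (p i) * (\<Prod>j\<in>UNIV - {i}. M x $ j $ p j)))
        = det (\<chi> j. if j = i then \<chi> l. D i l else row j (M x))"
      unfolding det_def by simp
  qed simp
  also have "\<dots> = (\<Sum>i\<in>UNIV. (\<Sum>j\<in>UNIV. D i j * N $ j $ i) * det (M x))"
  proof (rule sum.cong)
    fix i :: 'k
    \<comment> \<open>The coefficients of the differentiated row in the rows of \<open>M x\<close>: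
      that row times \<open>N\<close>, the inverse of \<open>M x\<close>.\<close>
    define y where "y = (\<chi> r. \<Sum>j\<in>UNIV. D i j * N $ j $ r)"
    have "(\<Sum>r\<in>UNIV. y $ r *s row r (M x)) $ l = D i l" for l
    proof -
      have "(\<Sum>r\<in>UNIV. y $ r *s row r (M x)) $ l = (\<Sum>r\<in>UNIV. \<Sum>j\<in>UNIV. D i j * (N $ j $ r * M x $ r $ l))"
        by (simp add: y_def row_def sum_distrib_right mult.assoc)
      also have "\<dots> = (\<Sum>j\<in>UNIV. D i j * (N ** M x) $ j $ l)"
        by (subst sum.swap) (simp add: matrix_matrix_mult_def sum_distrib_left)
      finally show ?thesis by (simp add: inv mat_def)
    qed
    then have eq: "(\<chi> l. D i l) = (\<Sum>r\<in>UNIV. y $ r *s row r (M x))"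
      by (simp add: vec_eq_iff)
    then show "det (\<chi> j. if j = i then \<chi> l. D i l else row j (M x)) = (\<Sum>j\<in>UNIV. D i j * N $ j $ i) * det (M x)"
      unfolding eq cramer_lemma_transpose by (simp add: y_def)
  qed simp
  finally show ?thesis
    unfolding D_def by (simp add: sum_distrib_left sum_distrib_right mult_ac)
qed

section \<open>Integrals of derivatives\<close>

lemma integrable_continuous_compact_support:
  fixes f :: "'a::euclidean_space \<Rightarrow> real"
  assumes "continuous_on UNIV f" "compact K" "\<And>x. x \<notin> K \<Longrightarrow> f x = 0"
  shows "integrable lborel f"
proof -
  have "integrable lborel (\<lambda>x. indicator K x *\<^sub>R f x)"
    by (rule borel_integrable_compact[OF assms(2) continuous_on_subset[OF assms(1)]]) simp
  also have "(\<lambda>x. indicator K x *\<^sub>R f x) = f"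
    using assms(3) by (auto simp: indicator_def fun_eq_iff)
  finally show ?thesis .
qed

text \<open>Difference quotients of \<open>f\<close> have integral \<open>0\<close> by translation
  invariance, and dominated convergence passes to the partial derivative.\<close>

lemma integral_partial_deriv_eq_0:
  fixes f :: "real ^ 'n::finite \<Rightarrow> real"
  assumes f: "Ck_on 1 UNIV f" and K: "compact K" "\<And>x. x \<notin> K \<Longrightarrow> f x = 0"
  shows "(\<integral>x. partial_deriv i f x \<partial>lborel) = 0"
proof -
  define e :: "real ^ 'n" where "e = axis i 1"
  have f': "(f has_derivative frechet_derivative f (at x)) (at x)" for x
    using Ck_on_has_derivative[of 0 UNIV f] f by simp
  have contf: "continuous_on UNIV f"
    using Ck_on_le[OF f, of 0] by simp
  have cont: "continuous_on UNIV (partial_deriv i f)"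
    using f unfolding partial_deriv_def[abs_def] One_nat_def Ck_on.simps by blast
  have zero: "partial_deriv i f x = 0" if "x \<notin> K" for x
    using partial_deriv_cong[of "- K" x f "\<lambda>_. 0" i] K that compact_imp_closed by auto
  obtain C where C: "\<And>x. \<bar>partial_deriv i f x\<bar> \<le> C"
  proof -
    have "bounded (partial_deriv i f ` K)"
      using K(1) cont by (intro compact_imp_bounded compact_continuous_image) (auto intro: continuous_on_subset)
    then obtain C where C: "\<And>x. x \<in> K \<Longrightarrow> \<bar>partial_deriv i f x\<bar> \<le> C"
      by (auto simp: bounded_iff)
    show thesis
    proof (rule that[of "\<bar>C\<bar>"])
      show "\<bar>partial_deriv i f x\<bar> \<le> \<bar>C\<bar>" for x
        using C[of x] zero[of x] by (cases "x \<in> K") auto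
    qed
  qed
  \<comment> \<open>Steps of length at most \<open>1\<close> keep the supports of all difference
    quotients inside \<open>K'\<close>, the closed unit neighbourhood of \<open>K\<close>. With the
    bound \<open>C\<close> on the derivative this gives an integrable majorant.\<close>
  define t where "t m = 1 / (1 + real m)" for m :: nat
  have t: "t m > 0" "t m \<le> 1" for m by (auto simp: t_def)
  define q where "q m x = (f (t m *\<^sub>R e + x) - f x) / t m" for m x
  define K' where "K' = {x + y |x y. x \<in> K \<and> y \<in> cball (0 :: real ^ 'n) 1}"
  have K': "compact K'" unfolding K'_def by (rule compact_sums[OF K(1) compact_cball])
  have line: "((\<lambda>s. f (s *\<^sub>R e + x)) has_real_derivative partial_deriv i f (s *\<^sub>R e + x)) (at s)" for s x
  proof -
    interpret bounded_linear "frechet_derivative f (at (s *\<^sub>R e + x))"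
      using f' by (rule has_derivative_bounded_linear)
    have "((\<lambda>s. s *\<^sub>R e + x) has_derivative (\<lambda>k. k *\<^sub>R e)) (at s)"
      by (auto intro!: derivative_eq_intros)
    from has_derivative_compose[OF this f']
    moreover have "partial_deriv i f (s *\<^sub>R e + x) = frechet_derivative f (at (s *\<^sub>R e + x)) e"
      by (simp add: partial_deriv_def e_def)
    ultimately show ?thesis by (simp add: has_field_derivative_def scaleR mult_commute_abs)
  qed
  have bound: "norm (q m x) \<le> C * indicator K' x" for m x
  proof (cases "x \<in> K'")
    case True
    obtain s where "f (t m *\<^sub>R e + x) - f (0 *\<^sub>R e + x) = (t m - 0) * partial_deriv i f (s *\<^sub>R e + x)"
      using MVT2[of 0 "t m" "\<lambda>s. f (s *\<^sub>R e + x)" "\<lambda>s. partial_deriv i f (s *\<^sub>R e + x)"] t(1)[of m] line by blast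
    then have "q m x = partial_deriv i f (s *\<^sub>R e + x)"
      unfolding q_def using t(1)[of m] by simp
    then show ?thesis using C True by simp
  next
    case False
    have "x \<notin> K"
    proof
      assume "x \<in> K"
      then have "x + 0 \<in> K'" unfolding K'_def by (intro CollectI exI[of _ x] exI[of _ 0]) simp
      with False show False by simp
    qed
    moreover have "t m *\<^sub>R e + x \<notin> K"
    proof
      assume "t m *\<^sub>R e + x \<in> K"
      moreover have "- (t m *\<^sub>R e) \<in> cball 0 1"
        using t(1,2)[of m] by (simp add: e_def norm_axis_1)
      ultimately have "(t m *\<^sub>R e + x) + - (t m *\<^sub>R e) \<in> K'" unfolding K'_def by blast
      with False show False by simp
    qed
    ultimately show ?thesis using K(2) False by (simp add: q_def)
  qed
  have int_f: "integrable lborel f"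
    by (rule integrable_continuous_compact_support[OF contf K])
  have meas_f: "f \<in> borel_measurable borel"
    by (rule borel_measurable_continuous_onI[OF contf])
  have "(\<integral>x. q m x \<partial>lborel) = 0" for m
  proof -
    have meas: "(+) (t m *\<^sub>R e) \<in> borel_measurable lborel" by simp
    have "integrable lborel (\<lambda>x. f (t m *\<^sub>R e + x))"
      using integrable_distr_eq[OF meas, of f] int_f meas_f by (simp add: lborel_distr_plus)
    moreover have "(\<integral>x. f (t m *\<^sub>R e + x) \<partial>lborel) = (\<integral>x. f x \<partial>lborel)"
      using integral_distr[OF meas, of f] meas_f by (simp add: lborel_distr_plus)
    ultimately show ?thesis using int_f unfolding q_def by simp
  qed
  moreover have "(\<lambda>m. \<integral>x. q m x \<partial>lborel) \<longlonglongrightarrow> (\<integral>x. partial_deriv i f x \<partial>lborel)"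
  proof (rule integral_dominated_convergence[where w = "\<lambda>x. C * indicator K' x"])
    show "partial_deriv i f \<in> borel_measurable lborel"
      using borel_measurable_continuous_onI[OF cont] by simp
    show "q m \<in> borel_measurable lborel" for m
    proof -
      have "continuous_on UNIV (q m)"
        unfolding q_def[abs_def] using t(1)[of m]
        by (intro continuous_intros continuous_on_compose2[OF contf]) auto
      then show ?thesis using borel_measurable_continuous_onI by simp
    qed
    show "integrable lborel (\<lambda>x. C * indicator K' x)"
      using emeasure_bounded_finite[OF compact_imp_bounded[OF K']] compact_imp_closed[OF K']
      by (intro integrable_mult_right integrable_real_indicator) (auto simp: borel_closed)
    show "AE x in lborel. norm (q m x) \<le> C * indicator K' x" for m using bound by simp
    show "AE x in lborel. (\<lambda>m. q m x) \<longlonglongrightarrow> partial_deriv i f x"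
    proof (rule AE_I2)
      fix x
      have "((\<lambda>h. (f ((0 + h) *\<^sub>R e + x) - f (0 *\<^sub>R e + x)) / h) \<longlongrightarrow> partial_deriv i f (0 *\<^sub>R e + x)) (at 0)"
        using line[of x 0] unfolding DERIV_def .
      moreover have "filterlim t (at 0) sequentially"
      proof -
        have "t \<longlonglongrightarrow> 0"
          unfolding t_def[abs_def] using LIMSEQ_inverse_real_of_nat by (simp add: inverse_eq_divide add.commute)
        then show ?thesis using t(1) by (auto simp: filterlim_at less_imp_neq[symmetric] eventually_sequentially intro!: exI[of _ 0])
      qed
      ultimately have "((\<lambda>m. (f ((0 + t m) *\<^sub>R e + x) - f (0 *\<^sub>R e + x)) / t m) \<longlongrightarrow> partial_deriv i f (0 *\<^sub>R e + x)) sequentially"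
        by (rule filterlim_compose)
      then show "(\<lambda>m. q m x) \<longlonglongrightarrow> partial_deriv i f x" by (simp add: q_def[abs_def])
    qed
  qed
  ultimately show ?thesis by (simp add: LIMSEQ_const_iff)
qed

section \<open>Zero extension, composition and bump functions\<close>

lemma Ck_on_Un:
  "open S \<Longrightarrow> open T \<Longrightarrow> Ck_on k S f \<Longrightarrow> Ck_on k T f \<Longrightarrow> Ck_on k (S \<union> T) f"
  by (induction k arbitrary: f) (auto intro: continuous_on_open_Un)

lemma Ck_on_zero_extension:
  assumes "open S" "compact L" "L \<subseteq> S" "Ck_on k S f" "\<And>x. x \<in> S - L \<Longrightarrow> f x = 0"
  shows "Ck_on k UNIV (\<lambda>x. if x \<in> S then f x else 0)"
proof -
  have L: "open (- L)" using assms(2) compact_imp_closed by blast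
  have "Ck_on k S (\<lambda>x. if x \<in> S then f x else 0)"
    using Ck_on_cong[OF assms(1), of f "\<lambda>x. if x \<in> S then f x else 0" k] assms(4) by simp
  moreover have "Ck_on k (- L) (\<lambda>x. if x \<in> S then f x else 0)"
  proof (rule iffD1[OF Ck_on_cong[OF L] Ck_on_const])
    show "0 = (if y \<in> S then f y else 0)" if "y \<in> - L" for y using assms(5) that by simp
  qed
  ultimately have "Ck_on k (S \<union> - L) (\<lambda>x. if x \<in> S then f x else 0)"
    by (rule Ck_on_Un[OF assms(1) L])
  moreover have "S \<union> - L = UNIV" using assms(3) by auto
  ultimately show ?thesis by simp
qed

text \<open>Order one is what bump functions need on overlapping charts, and a single application of
  the chain rule settles it.\<close>

lemma Ck_on_1_compose:
  fixes b :: "real ^ 'n::finite \<Rightarrow> real" and \<tau> :: "'a::real_normed_vector \<Rightarrow> real ^ 'n"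
  assumes "open S" "open T" "Ck_on 1 T b" "Ck_on 1 S \<tau>" "\<tau> ` S \<subseteq> T"
  shows "Ck_on 1 S (\<lambda>x. b (\<tau> x))"
  unfolding One_nat_def
proof (rule Ck_on_SucI[OF assms(1)])
  let ?D = "\<lambda>x v. \<Sum>i\<in>UNIV. frechet_derivative \<tau> (at x) v $ i * partial_deriv i b (\<tau> x)"
  show "((\<lambda>x. b (\<tau> x)) has_derivative ?D x) (at x)" if x: "x \<in> S" for x
  proof -
    have b: "(b has_derivative frechet_derivative b (at (\<tau> x))) (at (\<tau> x))"
      using Ck_on_has_derivative[of 0 T b "\<tau> x"] assms x by auto
    have \<tau>: "(\<tau> has_derivative frechet_derivative \<tau> (at x)) (at x)"
      using Ck_on_has_derivative[of 0 S \<tau> x] assms x by auto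
    from has_derivative_compose[OF \<tau> b] show ?thesis
      unfolding has_derivative_partial_deriv[OF b] .
  qed
  show "Ck_on 0 S (\<lambda>x. ?D x v)" for v
  proof -
    have \<tau>: "continuous_on S \<tau>" and \<tau>': "continuous_on S (\<lambda>x. frechet_derivative \<tau> (at x) v)"
      using assms(4) Ck_on_SucD[of 0 S \<tau>] by auto
    have "continuous_on T (partial_deriv i b)" for i
      using assms(3) unfolding partial_deriv_def[abs_def] by simp
    then have "continuous_on S (\<lambda>x. partial_deriv i b (\<tau> x))" for i
      using continuous_on_compose2[OF _ \<tau> assms(5)] by blast
    with \<tau>' show ?thesis by (auto intro!: continuous_intros)
  qed
qed

text \<open>Squaring flattens the kink of the positive part at \<open>0\<close>, which yields a
  \<open>C^1\<close> cut-off.\<close>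

lemma DERIV_max_0_square:
  "((\<lambda>s::real. (max 0 s)\<^sup>2) has_real_derivative 2 * max 0 s) (at s)"
proof -
  consider "s > 0" | "s < 0" | "s = 0" by linarith
  then show ?thesis
  proof cases
    case 1
    have "((\<lambda>s::real. s\<^sup>2) has_real_derivative 2 * max 0 s) (at s)"
      using 1 by (auto intro!: derivative_eq_intros)
    then show ?thesis
      by (rule has_field_derivative_transform_within_open[of _ _ _ "{0<..}"]) (use 1 in auto)
  next
    case 2
    have "((\<lambda>s::real. 0) has_real_derivative 2 * max 0 s) (at s)"
      using 2 by (auto intro!: derivative_eq_intros)
    then show ?thesis
      by (rule has_field_derivative_transform_within_open[of _ _ _ "{..<0}"]) (use 2 in auto)
  next
    case 3
    have "((\<lambda>h::real. max 0 h) \<longlongrightarrow> max 0 0) (at 0)"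
      by (intro tendsto_intros)
    moreover have "\<forall>\<^sub>F h::real in at 0. max 0 h = ((max 0 (s + h))\<^sup>2 - (max 0 s)\<^sup>2) / h"
      using 3 by (auto simp: eventually_at_filter power2_eq_square max_def)
    ultimately show ?thesis
      unfolding DERIV_def using 3 by (auto intro: Lim_transform_eventually)
  qed
qed

lemma Ck_on_bump:
  fixes a :: "'a::real_inner"
  shows "Ck_on 1 UNIV (\<lambda>y. (max 0 (r\<^sup>2 - (y - a) \<bullet> (y - a)))\<^sup>2)"
  unfolding One_nat_def
proof (rule Ck_on_SucI[OF open_UNIV])
  let ?q = "\<lambda>y. r\<^sup>2 - (y - a) \<bullet> (y - a)"
  show "((\<lambda>y. (max 0 (?q y))\<^sup>2) has_derivative (\<lambda>v. 2 * max 0 (?q x) * (- 2 * ((x - a) \<bullet> v)))) (at x)" for x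
  proof -
    have "(?q has_derivative (\<lambda>v. - 2 * ((x - a) \<bullet> v))) (at x)"
      by (auto intro!: derivative_eq_intros simp: inner_commute)
    from has_derivative_compose[OF this DERIV_max_0_square[unfolded has_field_derivative_def]]
    show ?thesis .
  qed
  show "Ck_on 0 UNIV (\<lambda>x. 2 * max 0 (?q x) * (- 2 * ((x - a) \<bullet> v)))" for v
    by (auto intro!: continuous_intros)
qed

section \<open>The Riemannian density\<close>

context metric_chart
begin

text \<open>The Riemannian volume density. Relabelling rows and columns simultaneously does not
  alter the determinant; the relabelled form is the one that occurs in the change of variables
  formula.\<close>

definition density where "density x = sqrt (det (relabel_matrix (G x)))"

lemma det_relabel_pos: assumes x: "x \<in> U" shows "det (relabel_matrix (G x)) > 0"
proof -
  have "transpose (G x) = G x"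
    using G_sym[OF x] by (simp add: transpose_def vec_eq_iff)
  then obtain E :: "real ^ 'n ^ 'n" where "transpose E ** G x ** E = mat 1"
    using orthonormal_frame_exists[of "G x"] G_pos[OF x] by blast
  from arg_cong[OF this, of "\<lambda>M. det (relabel_matrix M)"]
  have "(det (relabel_matrix E))\<^sup>2 * det (relabel_matrix (G x)) = 1"
    by (simp add: relabel_matrix_mult relabel_matrix_transpose relabel_matrix_one det_mul power2_eq_square mult_ac)
  then show ?thesis
    by (metis zero_less_one zero_less_mult_pos zero_le_power2 less_eq_real_def mult_zero_left)
qed

lemma density_pos: "x \<in> U \<Longrightarrow> density x > 0"
  by (simp add: density_def det_relabel_pos)

lemma sm_density [simp]: "smooth_on U (\<lambda>x. density x)"
  unfolding smooth_on_def
proof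
  fix k
  have "Ck_on k U (\<lambda>x. relabel_matrix (G x) $ i $ j)" for i j
    using sm_G unfolding smooth_on_def relabel_matrix_def by simp
  then show "Ck_on k U (\<lambda>x. density x)"
    unfolding density_def by (intro Ck_on_sqrt Ck_on_det open_U det_relabel_pos)
qed

text \<open>The two other derivatives in the Christoffel symbol are exchanged by swapping the
  contracted indices, so their difference vanishes against the symmetric inverse metric.\<close>

lemma trace_Gam:
  assumes x: "x \<in> U"
  shows "(\<Sum>r\<in>UNIV. Gam x r r k) = (\<Sum>i\<in>UNIV. \<Sum>j\<in>UNIV. gi x j i * partial_deriv k (\<lambda>y. G y $ i $ j) x) / 2"
proof -
  have "(\<Sum>i\<in>UNIV. \<Sum>j\<in>UNIV. gi x i j * (partial_deriv i (\<lambda>y. G y $ k $ j) x - partial_deriv j (\<lambda>y. G y $ i $ k) x)) = 0"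
  proof (rule sum_antisymmetric_eq_0)
    fix i j
    show "gi x i j * (partial_deriv i (\<lambda>y. G y $ k $ j) x - partial_deriv j (\<lambda>y. G y $ i $ k) x)
      = - (gi x j i * (partial_deriv j (\<lambda>y. G y $ k $ i) x - partial_deriv i (\<lambda>y. G y $ j $ k) x))"
      unfolding gi_sym[OF x, of j i] pd_G_sym[OF x, of i k j] pd_G_sym[OF x, of j k i]
      by (simp add: algebra_simps)
  qed
  then have "(\<Sum>i\<in>UNIV. \<Sum>j\<in>UNIV. gi x i j * (partial_deriv i (\<lambda>y. G y $ k $ j) x + partial_deriv k (\<lambda>y. G y $ i $ j) x
      - partial_deriv j (\<lambda>y. G y $ i $ k) x)) = (\<Sum>i\<in>UNIV. \<Sum>j\<in>UNIV. gi x i j * partial_deriv k (\<lambda>y. G y $ i $ j) x)"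
    by (simp add: distrib_left right_diff_distrib sum.distrib sum_subtractf)
  then show ?thesis
    unfolding christoffel_def by (simp add: sum_divide_distrib[symmetric] gi_sym[OF x, of _ "_"])
qed

text \<open>Jacobi's formula for the square of the density, combined with \<open>trace_Gam\<close>.
  It identifies \<open>density\<close> times the covariant divergence of a field with the coordinate
  divergence of \<open>density\<close> times the field.\<close>

lemma pd_density:
  assumes x: "x \<in> U"
  shows "partial_deriv k density x = density x * (\<Sum>r\<in>UNIV. Gam x r r k)"
proof -
  define d where "d y = det (relabel_matrix (G y))" for y
  have diff: "(\<lambda>y. relabel_matrix (G y) $ i $ j) differentiable (at x)" for i j
    using smooth_on_differentiable[OF sm_G x] by (simp add: relabel_matrix_def)
  have "relabel_matrix (matrix_inv (G x)) ** relabel_matrix (G x) = mat 1"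
    using inverse_G(2)[OF x] by (simp add: relabel_matrix_mult[symmetric] relabel_matrix_one)
  then have "partial_deriv k d x = d x * (\<Sum>i\<in>UNIV. \<Sum>j\<in>UNIV. relabel_matrix (matrix_inv (G x)) $ j $ i * partial_deriv k (\<lambda>y. relabel_matrix (G y) $ i $ j) x)"
    unfolding d_def[abs_def] by (rule partial_deriv_det[OF diff])
  also have "\<dots> = d x * (2 * (\<Sum>r\<in>UNIV. Gam x r r k))"
    unfolding trace_Gam[OF x]
    by (simp add: relabel_matrix_def sum_unlabel[of "\<lambda>j. gi x j _ * partial_deriv k (\<lambda>y. G y $ _ $ j) x"]
      sum_unlabel[of "\<lambda>i. \<Sum>j\<in>UNIV. gi x j i * partial_deriv k (\<lambda>y. G y $ i $ j) x"])
  finally have pd: "partial_deriv k d x = d x * (2 * (\<Sum>r\<in>UNIV. Gam x r r k))" .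
  have sq: "d y = density y * density y" if "y \<in> U" for y
    using det_relabel_pos[OF that] by (simp add: density_def d_def)
  have "partial_deriv k d x = partial_deriv k (\<lambda>y. density y * density y) x"
    by (rule pd_cong[OF x sq])
  also have "\<dots> = 2 * density x * partial_deriv k density x"
    using x by (simp add: pd_mult)
  finally show ?thesis
    using density_pos[OF x] pd sq[OF x] by simp
qed

end

text \<open>The absolute value is the square root of a squared determinant; this is the factor in
  the change of variables formula, whatever the orientation of the charts.\<close>

lemma density_transform:
  assumes "metric_chart U G" "metric_chart V H" "x \<in> U" "y \<in> V"
    and "G x = transpose D ** H y ** D"
  shows "metric_chart.density G x = \<bar>det (relabel_matrix D)\<bar> * metric_chart.density H y"
  unfolding metric_chart.density_def[OF assms(1)] metric_chart.density_def[OF assms(2)] assms(5)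
  by (simp add: relabel_matrix_mult relabel_matrix_transpose det_mul real_sqrt_mult)

section \<open>The divergence theorem on a compact manifold\<close>

locale riemannian_vector_field =
  fixes A :: "('m::{t2_space, second_countable_topology}, 'n::finite) chart set"
    and g :: "('m, 'n) chart \<Rightarrow> real ^ 'n \<Rightarrow> real ^ 'n ^ 'n"
    and X :: "('m, 'n) chart \<Rightarrow> real ^ 'n \<Rightarrow> real ^ 'n"
  assumes atlas: "smooth_atlas A" and metric: "riemannian_metric A g"
    and vector_field: "smooth_vector_field A X"
begin

section \<open>Charts and transition maps\<close>

lemma chart_exists: obtains c where "c \<in> A" "m \<in> fst c"
  using atlas unfolding smooth_atlas_def by blast

lemma
  assumes "c \<in> A"
  shows open_domain: "open (fst c)" and open_image: "open (chart_image c)"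
    and continuous_chart: "continuous_on (fst c) (snd c)"
    and continuous_chart_inv: "continuous_on (chart_image c) (chart_inv c)"
    and chart_inv_chart [simp]: "m \<in> fst c \<Longrightarrow> chart_inv c (snd c m) = m"
    and chart_chart_inv [simp]: "x \<in> chart_image c \<Longrightarrow> snd c (chart_inv c x) = x"
    and chart_in_image [simp]: "m \<in> fst c \<Longrightarrow> snd c m \<in> chart_image c"
    and chart_inv_in_domain [simp]: "x \<in> chart_image c \<Longrightarrow> chart_inv c x \<in> fst c"
  using assms atlas unfolding smooth_atlas_def homeomorphism_def by blast+

lemma chart_metric: "c \<in> A \<Longrightarrow> metric_chart (chart_image c) (g c)"
  using metric open_image unfolding riemannian_metric_def
  by unfold_locales (auto simp: transpose_def vec_eq_iff)

lemma overlap_iff: "c \<in> A \<Longrightarrow> x \<in> overlap c d \<longleftrightarrow> x \<in> chart_image c \<and> chart_inv c x \<in> fst d"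
  unfolding overlap_def by (auto simp: rev_image_eqI chart_image_def[symmetric]) (metis IntI chart_chart_inv chart_inv_in_domain image_eqI)

lemma open_overlap:
  assumes "c \<in> A" "d \<in> A" shows "open (overlap c d)"
proof -
  have "overlap c d = chart_image c \<inter> chart_inv c -` fst d"
    using overlap_iff[OF assms(1)] by blast
  then show ?thesis
    using continuous_open_preimage[OF continuous_chart_inv open_image open_domain] assms by metis
qed

lemma
  assumes "c \<in> A" "d \<in> A" "x \<in> overlap c d"
  shows transition_in_overlap: "transition c d x \<in> overlap d c"
    and chart_inv_transition: "chart_inv d (transition c d x) = chart_inv c x"
    and transition_in_image: "transition c d x \<in> chart_image d"
  using assms overlap_iff[of c x d] overlap_iff[of d "transition c d x" c] by (auto simp: transition_def)

lemma transition_inverse: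
  assumes "c \<in> A" "d \<in> A" "x \<in> overlap c d" shows "transition d c (transition c d x) = x"
  using chart_inv_transition[OF assms] assms overlap_iff[of c x d] by (simp add: transition_def)

lemma Ck_on_transition: "c \<in> A \<Longrightarrow> d \<in> A \<Longrightarrow> Ck_on k (overlap c d) (transition c d)"
  using atlas unfolding smooth_atlas_def smooth_on_def by blast

lemma has_derivative_transition:
  "c \<in> A \<Longrightarrow> d \<in> A \<Longrightarrow> x \<in> overlap c d \<Longrightarrow>
    (transition c d has_derivative frechet_derivative (transition c d) (at x)) (at x)"
  using Ck_on_has_derivative[OF Ck_on_transition[of c d "Suc 0"]] .

lemma jacobian_mult:
  assumes "c \<in> A" "d \<in> A" "x \<in> overlap c d"
  shows "jacobian c d x *v v = frechet_derivative (transition c d) (at x) v"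
  unfolding jacobian_def
  using has_derivative_bounded_linear[OF has_derivative_transition[OF assms]]
  by (simp add: matrix_works bounded_linear.linear)

section \<open>Functions on the manifold and their derivative along the vector field\<close>

definition Ck_fun :: "nat \<Rightarrow> ('m \<Rightarrow> real) \<Rightarrow> bool" where
  "Ck_fun k u \<longleftrightarrow> (\<forall>c\<in>A. Ck_on k (chart_image c) (\<lambda>x. u (chart_inv c x)))"

text \<open>Computed in an arbitrarily chosen chart around \<open>m\<close>; for \<open>C^1\<close>
  functions \<open>dir_deriv_eq\<close> shows that every chart gives the same value.\<close>

definition dir_deriv :: "('m \<Rightarrow> real) \<Rightarrow> 'm \<Rightarrow> real" where
  "dir_deriv u m = (let c = (SOME c. c \<in> A \<and> m \<in> fst c) in
     frechet_derivative (\<lambda>x. u (chart_inv c x)) (at (snd c m)) (X c (snd c m)))"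

lemma Ck_fun_mult: "Ck_fun k u \<Longrightarrow> Ck_fun k v \<Longrightarrow> Ck_fun k (\<lambda>m. u m * v m)"
  by (simp add: Ck_fun_def Ck_on_mult open_image)

lemma Ck_fun_sum: "(\<And>i. i \<in> I \<Longrightarrow> Ck_fun k (f i)) \<Longrightarrow> Ck_fun k (\<lambda>m. \<Sum>i\<in>I. f i m)"
  by (simp add: Ck_fun_def Ck_on_sum open_image)

lemma Ck_fun_divide: "Ck_fun k u \<Longrightarrow> Ck_fun k v \<Longrightarrow> (\<And>m. v m \<noteq> 0) \<Longrightarrow> Ck_fun k (\<lambda>m. u m / v m)"
  by (simp add: Ck_fun_def Ck_on_divide open_image)

lemma Ck_fun_SucD: "Ck_fun (Suc k) u \<Longrightarrow> Ck_fun k u"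
  unfolding Ck_fun_def using Ck_on_SucD by blast

lemma has_derivative_Ck_fun:
  assumes "Ck_fun 1 u" "c \<in> A" "x \<in> chart_image c"
  shows "((\<lambda>x. u (chart_inv c x)) has_derivative frechet_derivative (\<lambda>x. u (chart_inv c x)) (at x)) (at x)"
proof (rule Ck_on_has_derivative[of 0])
  show "Ck_on (Suc 0) (chart_image c) (\<lambda>x. u (chart_inv c x))"
    using assms(1,2) unfolding Ck_fun_def One_nat_def by blast
qed (fact assms(3))

lemma continuous_Ck_fun:
  assumes "Ck_fun 0 u" shows "continuous_on UNIV u"
proof -
  have "continuous_on (\<Union>c\<in>A. fst c) u"
  proof (rule continuous_on_open_UN)
    show "continuous_on (fst c) u" if c: "c \<in> A" for c
    proof -
      have "continuous_on (fst c) (\<lambda>m. u (chart_inv c (snd c m)))"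
        using assms c by (intro continuous_on_compose2[OF _ continuous_chart[OF c]]) (auto simp: Ck_fun_def)
      then show ?thesis using c by (simp cong: continuous_on_cong)
    qed
  qed (rule open_domain)
  moreover have "(\<Union>c\<in>A. fst c) = UNIV" using atlas by (simp add: smooth_atlas_def)
  ultimately show ?thesis by simp
qed

lemma dir_deriv_transition:
  assumes u: "Ck_fun 1 u" and c: "c \<in> A" and d: "d \<in> A" and x: "x \<in> overlap c d"
  shows "frechet_derivative (\<lambda>x. u (chart_inv c x)) (at x) (X c x)
    = frechet_derivative (\<lambda>x. u (chart_inv d x)) (at (transition c d x)) (X d (transition c d x))"
proof -
  let ?y = "transition c d x"
  have "((\<lambda>x. u (chart_inv d (transition c d x))) has_derivative
    (\<lambda>v. frechet_derivative (\<lambda>x. u (chart_inv d x)) (at ?y) (frechet_derivative (transition c d) (at x) v))) (at x)"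
    by (rule has_derivative_compose[OF has_derivative_transition[OF c d x] has_derivative_Ck_fun[OF u d transition_in_image[OF c d x]]])
  then have "((\<lambda>x. u (chart_inv c x)) has_derivative
    (\<lambda>v. frechet_derivative (\<lambda>x. u (chart_inv d x)) (at ?y) (frechet_derivative (transition c d) (at x) v))) (at x)"
    by (rule has_derivative_transform_within_open[OF _ open_overlap[OF c d] x]) (simp add: chart_inv_transition c d)
  from fun_cong[OF frechet_derivative_at[OF this], of "X c x"]
  have "frechet_derivative (\<lambda>x. u (chart_inv c x)) (at x) (X c x)
    = frechet_derivative (\<lambda>x. u (chart_inv d x)) (at ?y) (jacobian c d x *v X c x)"
    by (simp add: jacobian_mult[OF c d x])
  then show ?thesis
    using vector_field c d x unfolding smooth_vector_field_def by simp
qed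

lemma dir_deriv_eq:
  assumes u: "Ck_fun 1 u" and d: "d \<in> A" and y: "y \<in> chart_image d"
  shows "dir_deriv u (chart_inv d y) = (\<Sum>i\<in>UNIV. X d y $ i * partial_deriv i (\<lambda>x. u (chart_inv d x)) y)"
proof -
  define m where "m = chart_inv d y"
  define c where "c = (SOME c. c \<in> A \<and> m \<in> fst c)"
  have "c \<in> A \<and> m \<in> fst c"
    unfolding c_def by (rule someI_ex) (metis chart_exists)
  then have c: "c \<in> A" "m \<in> fst c" by auto
  have x: "snd c m \<in> overlap c d"
    using overlap_iff[OF c(1)] c d y by (simp add: m_def)
  have "transition c d (snd c m) = y"
    using c d y by (simp add: transition_def) (simp add: m_def)
  then have "dir_deriv u m = frechet_derivative (\<lambda>x. u (chart_inv d x)) (at y) (X d y)"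
    using dir_deriv_transition[OF u c(1) d x] unfolding dir_deriv_def Let_def c_def[symmetric] by simp
  then show ?thesis
    using has_derivative_partial_deriv[OF has_derivative_Ck_fun[OF u d y]] by (simp add: m_def)
qed

lemma Ck_fun_dir_deriv:
  assumes "Ck_fun 1 u" shows "Ck_fun 0 (dir_deriv u)"
  unfolding Ck_fun_def
proof
  fix c assume c: "c \<in> A"
  have "continuous_on (chart_image c) (partial_deriv i (\<lambda>x. u (chart_inv c x)))" for i
    using assms c unfolding Ck_fun_def partial_deriv_def[abs_def] by simp
  moreover have "Ck_on 0 (chart_image c) (X c)"
    using vector_field c unfolding smooth_vector_field_def smooth_on_def by blast
  ultimately have "continuous_on (chart_image c) (\<lambda>y. \<Sum>i\<in>UNIV. X c y $ i * partial_deriv i (\<lambda>x. u (chart_inv c x)) y)"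
    by (auto intro!: continuous_intros)
  then show "Ck_on 0 (chart_image c) (\<lambda>x. dir_deriv u (chart_inv c x))"
    using dir_deriv_eq[OF assms c] by (simp cong: continuous_on_cong)
qed

lemma dir_deriv_sum:
  assumes "finite I" "\<And>i. i \<in> I \<Longrightarrow> Ck_fun 1 (f i)"
  shows "dir_deriv (\<lambda>m. \<Sum>i\<in>I. f i m) m = (\<Sum>i\<in>I. dir_deriv (f i) m)"
proof -
  obtain c where c: "c \<in> A" "m \<in> fst c" by (rule chart_exists)
  define x where "x = snd c m"
  have x: "x \<in> chart_image c" "m = chart_inv c x" using c by (simp_all add: x_def)
  have diff: "(\<lambda>x. f i (chart_inv c x)) differentiable (at x)" if "i \<in> I" for i
    using has_derivative_Ck_fun[OF assms(2)[OF that] c(1) x(1)] by (auto simp: differentiable_def)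
  have C1: "Ck_fun 1 (\<lambda>m. \<Sum>i\<in>I. f i m)" by (rule Ck_fun_sum[OF assms(2)])
  have "dir_deriv (\<lambda>m. \<Sum>i\<in>I. f i m) m = (\<Sum>j\<in>UNIV. X c x $ j * (\<Sum>i\<in>I. partial_deriv j (\<lambda>x. f i (chart_inv c x)) x))"
    using dir_deriv_eq[OF C1 c(1) x(1)] diff by (simp add: x(2) partial_deriv_sum)
  also have "\<dots> = (\<Sum>i\<in>I. \<Sum>j\<in>UNIV. X c x $ j * partial_deriv j (\<lambda>x. f i (chart_inv c x)) x)"
    unfolding sum_distrib_left by (rule sum.swap)
  also have "\<dots> = (\<Sum>i\<in>I. dir_deriv (f i) m)"
    using dir_deriv_eq[OF assms(2) c(1) x(1)] by (simp add: x(2))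
  finally show ?thesis .
qed

lemma dir_deriv_const: "dir_deriv (\<lambda>m. a) m = 0"
  by (simp add: dir_deriv_def)

section \<open>Supports and integrals in a chart\<close>

definition supported_in where
  "supported_in S u \<longleftrightarrow> (\<exists>K. closed K \<and> K \<subseteq> S \<and> (\<forall>m. m \<notin> K \<longrightarrow> u m = (0::real)))" for S :: "'m set"

lemma supported_in_mult:
  "supported_in S u \<Longrightarrow> supported_in S (\<lambda>m. u m * v m)"
  "supported_in S u \<Longrightarrow> supported_in S (\<lambda>m. v m * u m)"
  unfolding supported_in_def by (metis mult_zero_left, metis mult_zero_right)

lemma supported_in_Int:
  assumes "supported_in S u" "supported_in T u" shows "supported_in (S \<inter> T) u"
  using assms unfolding supported_in_def by (metis (full_types) Int_iff Int_mono closed_Int)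

lemma supported_in_subset: "supported_in S u \<Longrightarrow> S \<subseteq> T \<Longrightarrow> supported_in T u"
  unfolding supported_in_def by blast

lemma supported_in_dir_deriv:
  assumes u: "Ck_fun 1 u" "supported_in S u" shows "supported_in S (dir_deriv u)"
proof -
  obtain K where K: "closed K" "K \<subseteq> S" "\<And>m. m \<notin> K \<Longrightarrow> u m = 0"
    using u(2) unfolding supported_in_def by blast
  have "dir_deriv u m = 0" if m: "m \<notin> K" for m
  proof -
    obtain c where c: "c \<in> A" "m \<in> fst c" by (rule chart_exists)
    define x where "x = snd c m"
    have x: "x \<in> chart_image c" "m = chart_inv c x" using c by (simp_all add: x_def)
    have "open (chart_image c \<inter> chart_inv c -` (- K))"
      using continuous_open_preimage[OF continuous_chart_inv open_image] c K(1) by blast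
    then have "partial_deriv i (\<lambda>x. u (chart_inv c x)) x = partial_deriv i (\<lambda>x. 0) x" for i
      by (rule partial_deriv_cong) (use x m K(3) in auto)
    then show ?thesis using dir_deriv_eq[OF u(1) c(1) x(1)] by (simp add: x(2))
  qed
  then show ?thesis using K unfolding supported_in_def by blast
qed

abbreviation dens where "dens c \<equiv> metric_chart.density (g c)"

text \<open>For \<open>u\<close> supported in the domain of \<open>c\<close> this is the integral of
  \<open>u\<close> over the manifold with respect to the Riemannian volume.\<close>

definition chart_integral where
  "chart_integral c u = (\<integral>x. (if x \<in> chart_image c then dens c x * u (chart_inv c x) else 0) \<partial>lborel)"

lemma Ck_on_dens: "c \<in> A \<Longrightarrow> Ck_on k (chart_image c) (dens c)"
  using metric_chart.sm_density[OF chart_metric] unfolding smooth_on_def by blast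

lemma chart_compact_support:
  assumes "compact (UNIV :: 'm set)" "c \<in> A" "supported_in (fst c) u"
  obtains L where "compact L" "L \<subseteq> chart_image c" "\<And>x. x \<in> chart_image c - L \<Longrightarrow> u (chart_inv c x) = 0"
proof -
  obtain K where K: "closed K" "K \<subseteq> fst c" "\<And>m. m \<notin> K \<Longrightarrow> u m = 0"
    using assms(3) unfolding supported_in_def by blast
  have "compact K"
    using compact_Int_closed[OF assms(1) K(1)] by simp
  then have "compact (snd c ` K)"
    using continuous_on_subset[OF continuous_chart[OF assms(2)] K(2)] by (rule compact_continuous_image[rotated])
  moreover have "snd c ` K \<subseteq> chart_image c" using K(2) by (auto simp: chart_image_def)
  moreover have "u (chart_inv c x) = 0" if "x \<in> chart_image c - snd c ` K" for x
    using that K(3) assms(2) by (metis DiffE chart_chart_inv image_eqI)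
  ultimately show ?thesis by (rule that)
qed

lemma integrable_chart:
  assumes "compact (UNIV :: 'm set)" "c \<in> A" "supported_in (fst c) u" "Ck_fun 0 u"
  shows "integrable lborel (\<lambda>x. if x \<in> chart_image c then dens c x * u (chart_inv c x) else 0)"
proof -
  obtain L where L: "compact L" "L \<subseteq> chart_image c" "\<And>x. x \<in> chart_image c - L \<Longrightarrow> u (chart_inv c x) = 0"
    using chart_compact_support[OF assms(1-3)] by blast
  have "Ck_on 0 (chart_image c) (\<lambda>x. dens c x * u (chart_inv c x))"
    using assms(2,4) by (intro Ck_on_mult open_image Ck_on_dens) (auto simp: Ck_fun_def)
  then have "Ck_on 0 UNIV (\<lambda>x. if x \<in> chart_image c then dens c x * u (chart_inv c x) else 0)"
    by (rule Ck_on_zero_extension[OF open_image[OF assms(2)] L(1,2)]) (use L(3) in auto)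
  then show ?thesis
    by (intro integrable_continuous_compact_support[OF _ L(1)]) (use L(2,3) in auto)
qed

lemma chart_integral_sum:
  assumes "compact (UNIV :: 'm set)" "c \<in> A" "finite I"
    and "\<And>i. i \<in> I \<Longrightarrow> supported_in (fst c) (f i)" "\<And>i. i \<in> I \<Longrightarrow> Ck_fun 0 (f i)"
  shows "chart_integral c (\<lambda>m. \<Sum>i\<in>I. f i m) = (\<Sum>i\<in>I. chart_integral c (f i))"
proof -
  have "chart_integral c (\<lambda>m. \<Sum>i\<in>I. f i m)
    = (\<integral>x. (\<Sum>i\<in>I. if x \<in> chart_image c then dens c x * f i (chart_inv c x) else 0) \<partial>lborel)"
    unfolding chart_integral_def by (rule Bochner_Integration.integral_cong) (auto simp: sum_distrib_left)
  also have "\<dots> = (\<Sum>i\<in>I. chart_integral c (f i))"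
    unfolding chart_integral_def using integrable_chart[OF assms(1,2)] assms(4,5)
    by (intro Bochner_Integration.integral_sum) auto
  finally show ?thesis .
qed

text \<open>The Jacobian factor of the transition is absorbed by the density. As \<open>u\<close>
  vanishes off the common domain, both integrals live on the overlap.\<close>

lemma chart_integral_change:
  assumes comp: "compact (UNIV :: 'm set)" and c: "c \<in> A" and d: "d \<in> A"
    and u: "supported_in (fst c \<inter> fst d) u" "Ck_fun 0 u"
  shows "chart_integral c u = chart_integral d u"
  unfolding chart_integral_def
proof (rule integral_change_of_variables_lborel)
  show "open (overlap c d)" by (rule open_overlap[OF c d])
  show "(transition c d has_derivative frechet_derivative (transition c d) (at x)) (at x)" if "x \<in> overlap c d" for x
    by (rule has_derivative_transition[OF c d that])
  show "inj_on (transition c d) (overlap c d)"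
    using transition_inverse[OF c d] by (metis inj_on_inverseI)
  have zero: "u m = 0" if "m \<notin> fst c \<or> m \<notin> fst d" for m
    using u(1) that unfolding supported_in_def by blast
  show "(if y \<in> chart_image d then dens d y * u (chart_inv d y) else 0) = 0" if y: "y \<notin> transition c d ` overlap c d" for y
  proof (cases "y \<in> overlap d c")
    case True
    have "y = transition c d (transition d c y)" "transition d c y \<in> overlap c d"
      using transition_inverse[OF d c True] transition_in_overlap[OF d c True] by auto
    with y show ?thesis by blast
  next
    case False
    then show ?thesis using overlap_iff[OF d, of y c] zero by auto
  qed
  show "(if x \<in> chart_image c then dens c x * u (chart_inv c x) else 0) = 0" if "x \<notin> overlap c d" for x
    using that overlap_iff[OF c, of x d] zero by auto
  show "(if x \<in> chart_image c then dens c x * u (chart_inv c x) else 0)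
    = \<bar>det (relabel_matrix (matrix (frechet_derivative (transition c d) (at x))))\<bar> *
      (if transition c d x \<in> chart_image d then dens d (transition c d x) * u (chart_inv d (transition c d x)) else 0)"
    if x: "x \<in> overlap c d" for x
  proof -
    have "dens c x = \<bar>det (relabel_matrix (jacobian c d x))\<bar> * dens d (transition c d x)"
    proof (rule density_transform[OF chart_metric[OF c] chart_metric[OF d]])
      show "g c x = transpose (jacobian c d x) ** g d (transition c d x) ** jacobian c d x"
        using metric c d x unfolding riemannian_metric_def by blast
    qed (use x overlap_iff[OF c] transition_in_image[OF c d x] in auto)
    then show ?thesis
      using x overlap_iff[OF c, of x d] transition_in_image[OF c d x] chart_inv_transition[OF c d x]
      by (simp add: jacobian_def)
  qed
qed (use integrable_chart[OF comp] c d u supported_in_subset[OF u(1)] in auto)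

definition divergence where
  "divergence c x = (\<Sum>i\<in>UNIV. partial_deriv i (\<lambda>y. X c y $ i) x)
     + (\<Sum>i\<in>UNIV. (\<Sum>r\<in>UNIV. christoffel (g c) x r r i) * X c x $ i)"

text \<open>In the chart, \<open>density\<close> times \<open>u div X + X(u)\<close> is the sum of
  the partial derivatives of the \<open>f i\<close>, and each \<open>f i\<close> is
  \<open>C^1\<close> with compact support.\<close>

lemma chart_integral_divergence:
  assumes comp: "compact (UNIV :: 'm set)" and c: "c \<in> A" and u: "supported_in (fst c) u" "Ck_fun 1 u"
    and D: "\<And>x. x \<in> chart_image c \<Longrightarrow> divergence c x = D (chart_inv c x)"
  shows "chart_integral c (\<lambda>m. u m * D m + dir_deriv u m) = 0"
proof -
  interpret metric_chart "chart_image c" "g c" by (rule chart_metric[OF c])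
  obtain L where L: "compact L" "L \<subseteq> chart_image c" "\<And>x. x \<in> chart_image c - L \<Longrightarrow> u (chart_inv c x) = 0"
    using chart_compact_support[OF comp c u(1)] by blast
  define v where "v x = u (chart_inv c x)" for x
  define f where "f i x = (if x \<in> chart_image c then density x * X c x $ i * v x else 0)" for i x
  have sm_X: "smooth_on (chart_image c) (\<lambda>x. X c x $ i)" for i
    using vector_field c smooth_on_component[OF open_U] unfolding smooth_vector_field_def by blast
  have Ck_v: "Ck_on 1 (chart_image c) v"
    using u(2) c unfolding Ck_fun_def v_def by blast
  have Ck_f: "Ck_on 1 UNIV (f i)" for i
    unfolding f_def
  proof (rule Ck_on_zero_extension[OF open_U L(1,2)])
    show "Ck_on 1 (chart_image c) (\<lambda>x. density x * X c x $ i * v x)"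
      using sm_X sm_density Ck_v unfolding smooth_on_def by (intro Ck_on_mult open_U) auto
  qed (use L(3) in \<open>auto simp: v_def\<close>)
  have f_zero: "f i x = 0" if "x \<notin> L" for i x
    using that L(3) by (auto simp: f_def v_def)
  have pd_zero: "partial_deriv i (f i) x = 0" if "x \<notin> L" for i x
    using partial_deriv_cong[of "- L" x "f i" "\<lambda>_. 0" i] f_zero that compact_imp_closed[OF L(1)] by auto
  have "integrable lborel (partial_deriv i (f i))" for i
  proof (rule integrable_continuous_compact_support[OF _ L(1)])
    show "continuous_on UNIV (partial_deriv i (f i))"
      using Ck_f[of i] unfolding partial_deriv_def[abs_def] by simp
  qed (use pd_zero in auto)
  then have "(\<integral>x. (\<Sum>i\<in>UNIV. partial_deriv i (f i) x) \<partial>lborel) = (\<Sum>i\<in>UNIV. \<integral>x. partial_deriv i (f i) x \<partial>lborel)"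
    by (intro Bochner_Integration.integral_sum) auto
  also have "\<dots> = 0"
    using integral_partial_deriv_eq_0[OF Ck_f L(1)] f_zero by simp
  finally have int0: "(\<integral>x. (\<Sum>i\<in>UNIV. partial_deriv i (f i) x) \<partial>lborel) = 0" .
  have "(if x \<in> chart_image c then density x * (u (chart_inv c x) * D (chart_inv c x) + dir_deriv u (chart_inv c x)) else 0)
    = (\<Sum>i\<in>UNIV. partial_deriv i (f i) x)" for x
  proof (cases "x \<in> chart_image c")
    case x: True
    have "partial_deriv i (f i) x = partial_deriv i (\<lambda>x. density x * X c x $ i * v x) x" for i
      by (rule pd_cong[OF x]) (simp add: f_def)
    moreover have "partial_deriv i (\<lambda>x. density x * X c x $ i * v x) x
      = density x * (v x * partial_deriv i (\<lambda>x. X c x $ i) x + v x * ((\<Sum>r\<in>UNIV. Gam x r r i) * X c x $ i) + X c x $ i * partial_deriv i v x)" for i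
    proof -
      have "v differentiable (at x)" "(\<lambda>x. X c x $ i) differentiable (at x)" "density differentiable (at x)"
        using Ck_v x smooth_on_differentiable[OF sm_X x] smooth_on_differentiable[OF sm_density x] by auto
      then show ?thesis
        using pd_density[OF x, of i] by (simp add: partial_deriv_mult algebra_simps)
    qed
    ultimately have "(\<Sum>i\<in>UNIV. partial_deriv i (f i) x) = density x * (v x * divergence c x + (\<Sum>i\<in>UNIV. X c x $ i * partial_deriv i v x))"
      unfolding divergence_def by (simp add: sum_distrib_left[symmetric] sum.distrib distrib_left)
    then show ?thesis
      using x D[OF x] dir_deriv_eq[OF u(2) c x] by (simp add: v_def[abs_def])
  next
    case False
    then have "x \<notin> L" using L(2) by blast
    then show ?thesis using False by (simp add: pd_zero)
  qed
  then show ?thesis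
    unfolding chart_integral_def using int0 by simp
qed

text \<open>\<open>u\<close> is a cut-off in one chart, extended by zero. In another chart
  \<open>d\<close> it is checked to be \<open>C^1\<close> on two open sets covering
  \<open>chart_image d\<close>: the overlap, where it is a composition with the transition map, and
  the preimage of the complement of \<open>K\<close>, where it vanishes. The latter is open because
  compact sets in a Hausdorff space are closed.\<close>

lemma bump_exists:
  assumes comp: "compact (UNIV :: 'm set)"
  shows "\<exists>u c. c \<in> A \<and> Ck_fun 1 u \<and> supported_in (fst c) u \<and> (\<forall>m. u m \<ge> 0) \<and> u a > 0"
proof -
  obtain c where c: "c \<in> A" "a \<in> fst c" by (rule chart_exists)
  obtain r where r: "r > 0" "cball (snd c a) r \<subseteq> chart_image c"
    using open_image[OF c(1)] c by (meson chart_in_image open_contains_cball)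
  define b where "b y = (max 0 (r\<^sup>2 - (y - snd c a) \<bullet> (y - snd c a)))\<^sup>2" for y
  define u where "u m = (if m \<in> fst c then b (snd c m) else 0)" for m
  define K where "K = chart_inv c ` cball (snd c a) r"
  have b_zero: "b y = 0" if "y \<notin> cball (snd c a) r" for y
  proof -
    have "r \<le> norm (y - snd c a)" using that by (simp add: dist_norm norm_minus_commute)
    then have "r\<^sup>2 \<le> (y - snd c a) \<bullet> (y - snd c a)"
      using r(1) by (simp add: dot_square_norm power_mono)
    then show ?thesis by (simp add: b_def)
  qed
  have "compact K"
    unfolding K_def using continuous_on_subset[OF continuous_chart_inv[OF c(1)] r(2)]
    by (rule compact_continuous_image) simp
  then have K: "closed K" by (rule compact_imp_closed)
  have K_sub: "K \<subseteq> fst c" using r(2) c(1) by (auto simp: K_def)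
  have u_zero: "u m = 0" if "m \<notin> K" for m
  proof (cases "m \<in> fst c")
    case True
    then have "snd c m \<notin> cball (snd c a) r"
      using that c(1) unfolding K_def by (metis chart_inv_chart image_eqI)
    then show ?thesis by (simp add: u_def b_zero)
  qed (simp add: u_def)
  have supp: "supported_in (fst c) u"
    unfolding supported_in_def using K K_sub u_zero by blast
  have "Ck_on 1 (chart_image d) (\<lambda>x. u (chart_inv d x))" if d: "d \<in> A" for d
  proof -
    let ?T = "chart_image d \<inter> chart_inv d -` (- K)"
    have T: "open ?T"
      using continuous_open_preimage[OF continuous_chart_inv open_image] d K by blast
    have b1: "Ck_on 1 (overlap d c) (\<lambda>x. b (transition d c x))"
      unfolding b_def
      by (rule Ck_on_1_compose[OF open_overlap[OF d c(1)] open_UNIV Ck_on_bump Ck_on_transition[OF d c(1)]]) simp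
    have 1: "Ck_on 1 (overlap d c) (\<lambda>x. u (chart_inv d x))"
    proof (rule iffD1[OF Ck_on_cong[OF open_overlap[OF d c(1)]] b1])
      show "b (transition d c x) = u (chart_inv d x)" if "x \<in> overlap d c" for x
        using that overlap_iff[OF d] by (simp add: u_def transition_def)
    qed
    have 2: "Ck_on 1 ?T (\<lambda>x. u (chart_inv d x))"
    proof (rule iffD1[OF Ck_on_cong[OF T] Ck_on_const])
      show "0 = u (chart_inv d y)" if "y \<in> ?T" for y using that u_zero by simp
    qed
    have "overlap d c \<union> ?T = chart_image d"
      using overlap_iff[OF d] K_sub by blast
    then show ?thesis
      using Ck_on_Un[OF open_overlap[OF d c(1)] T 1 2] by simp
  qed
  then have "Ck_fun 1 u" by (simp add: Ck_fun_def)
  moreover have "u m \<ge> 0" for m by (simp add: u_def b_def)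
  moreover have "u a > 0" using c(2) r(1) by (simp add: u_def b_def)
  ultimately show ?thesis using c(1) supp by blast
qed

text \<open>With a partition of unity \<open>\<rho>\<close>, the integral of \<open>\<rho> a\<close>
  times \<open>D\<close> in the chart of \<open>a\<close> is minus that of the derivative of
  \<open>\<rho> a\<close> along \<open>X\<close>. The latter integrals add up to \<open>0\<close>
  because the functions \<open>\<rho> a\<close> add up to \<open>1\<close>. So nonnegative integrals
  have sum zero, and continuity excludes an exceptional null set.\<close>

theorem divergence_nonneg_imp_eq_0:
  assumes comp: "compact (UNIV :: 'm set)"
    and D: "\<And>c x. c \<in> A \<Longrightarrow> x \<in> chart_image c \<Longrightarrow> divergence c x = D (chart_inv c x)"
    and D_cont: "Ck_fun 0 D" and nonneg: "\<And>m. D m \<ge> 0"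
  shows "D m = 0"
proof -
  obtain u ch where u: "\<And>a. ch a \<in> A" "\<And>a. Ck_fun 1 (u a)" "\<And>a. supported_in (fst (ch a)) (u a)"
    "\<And>a m. u a m \<ge> 0" "\<And>a. u a a > 0"
    using bump_exists[OF comp] by metis
  have u_cont: "continuous_on UNIV (u a)" for a
    using continuous_Ck_fun Ck_fun_SucD u(2) by (metis One_nat_def)
  have "open {m. u a m > 0}" for a
    using u_cont[of a] by (simp add: open_Collect_less)
  moreover have "UNIV \<subseteq> (\<Union>a\<in>UNIV. {m. u a m > 0})" using u(5) by auto
  ultimately obtain I where I: "finite I" "UNIV \<subseteq> (\<Union>a\<in>I. {m. u a m > 0})"
    using compactE_image[OF comp, of UNIV "\<lambda>a. {m. u a m > 0}"] by metis
  define s where "s m = (\<Sum>a\<in>I. u a m)" for m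
  have s_pos: "s m > 0" for m
  proof -
    obtain a where "a \<in> I" "u a m > 0" using I(2) by auto
    then show ?thesis unfolding s_def using I(1) u(4) by (intro sum_pos2) auto
  qed
  define \<rho> where "\<rho> a m = u a m / s m" for a m
  have Ck_s: "Ck_fun 1 s" unfolding s_def[abs_def] by (intro Ck_fun_sum u)
  have \<rho>1: "Ck_fun 1 (\<rho> a)" for a
    unfolding \<rho>_def[abs_def] using s_pos by (intro Ck_fun_divide u Ck_s) (simp add: less_imp_neq[symmetric])
  then have \<rho>0: "Ck_fun 0 (\<rho> a)" for a using Ck_fun_SucD[of 0] by simp
  have \<rho>_supp: "supported_in (fst (ch a)) (\<rho> a)" for a
    unfolding \<rho>_def[abs_def] divide_inverse by (rule supported_in_mult(1)[OF u(3)])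
  have \<rho>_sum: "(\<Sum>a\<in>I. \<rho> a m) = 1" for m
    using s_pos[of m] by (simp add: \<rho>_def sum_divide_distrib[symmetric] s_def[symmetric])
  have d0: "Ck_fun 0 (dir_deriv (\<rho> a))" for a by (rule Ck_fun_dir_deriv[OF \<rho>1])
  have d_supp: "supported_in (fst (ch a)) (dir_deriv (\<rho> a))" for a
    by (rule supported_in_dir_deriv[OF \<rho>1 \<rho>_supp])
  have prod0: "Ck_fun 0 (\<lambda>m. \<rho> b m * dir_deriv (\<rho> a) m)" for a b by (intro Ck_fun_mult \<rho>0 d0)
  \<comment> \<open>Insert a second partition of unity, move the integrals to the charts of the second one,
    and use that the derivatives of the first one add up to \<open>0\<close>.\<close>
  have "(\<Sum>a\<in>I. chart_integral (ch a) (dir_deriv (\<rho> a))) = (\<Sum>a\<in>I. \<Sum>b\<in>I. chart_integral (ch a) (\<lambda>m. \<rho> b m * dir_deriv (\<rho> a) m))"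
  proof (rule sum.cong)
    fix a
    have "dir_deriv (\<rho> a) = (\<lambda>m. \<Sum>b\<in>I. \<rho> b m * dir_deriv (\<rho> a) m)"
      by (simp add: sum_distrib_right[symmetric] \<rho>_sum)
    then have "chart_integral (ch a) (dir_deriv (\<rho> a)) = chart_integral (ch a) (\<lambda>m. \<Sum>b\<in>I. \<rho> b m * dir_deriv (\<rho> a) m)"
      by simp
    also have "\<dots> = (\<Sum>b\<in>I. chart_integral (ch a) (\<lambda>m. \<rho> b m * dir_deriv (\<rho> a) m))"
      by (rule chart_integral_sum[OF comp u(1) I(1) supported_in_mult(2)[OF d_supp] prod0])
    finally show "chart_integral (ch a) (dir_deriv (\<rho> a)) = (\<Sum>b\<in>I. chart_integral (ch a) (\<lambda>m. \<rho> b m * dir_deriv (\<rho> a) m))" .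
  qed simp
  also have "\<dots> = (\<Sum>a\<in>I. \<Sum>b\<in>I. chart_integral (ch b) (\<lambda>m. \<rho> b m * dir_deriv (\<rho> a) m))"
    by (intro sum.cong refl chart_integral_change comp u supported_in_Int prod0 supported_in_mult \<rho>_supp d_supp)
  also have "\<dots> = (\<Sum>b\<in>I. \<Sum>a\<in>I. chart_integral (ch b) (\<lambda>m. \<rho> b m * dir_deriv (\<rho> a) m))"
    by (rule sum.swap)
  also have "\<dots> = (\<Sum>b\<in>I. chart_integral (ch b) (\<lambda>m. 0))"
  proof (rule sum.cong)
    fix b
    have "(\<Sum>a\<in>I. chart_integral (ch b) (\<lambda>m. \<rho> b m * dir_deriv (\<rho> a) m))
      = chart_integral (ch b) (\<lambda>m. \<Sum>a\<in>I. \<rho> b m * dir_deriv (\<rho> a) m)"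
      by (rule chart_integral_sum[OF comp u(1) I(1) supported_in_mult(1)[OF \<rho>_supp] prod0, symmetric])
    also have "(\<lambda>m. \<Sum>a\<in>I. \<rho> b m * dir_deriv (\<rho> a) m) = (\<lambda>m. 0)"
      unfolding sum_distrib_left[symmetric] dir_deriv_sum[OF I(1), of \<rho>, OF \<rho>1, symmetric]
      by (simp add: \<rho>_sum dir_deriv_const)
    finally show "(\<Sum>a\<in>I. chart_integral (ch b) (\<lambda>m. \<rho> b m * dir_deriv (\<rho> a) m)) = chart_integral (ch b) (\<lambda>m. 0)" .
  qed simp
  finally have dsum: "(\<Sum>a\<in>I. chart_integral (ch a) (dir_deriv (\<rho> a))) = 0"
    by (simp add: chart_integral_def cong: if_cong)
  have \<rho>D0: "Ck_fun 0 (\<lambda>m. \<rho> a m * D m)" and \<rho>D_supp: "supported_in (fst (ch a)) (\<lambda>m. \<rho> a m * D m)" for a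
    by (intro Ck_fun_mult \<rho>0 D_cont supported_in_mult(1) \<rho>_supp)+
  have "chart_integral (ch a) (\<lambda>m. \<rho> a m * D m) + chart_integral (ch a) (dir_deriv (\<rho> a)) = 0" for a
  proof -
    \<comment> \<open>A sum over the two truth values lets \<open>chart_integral_sum\<close> serve
      as additivity for two functions.\<close>
    have "chart_integral (ch a) (\<lambda>m. \<rho> a m * D m) + chart_integral (ch a) (dir_deriv (\<rho> a))
      = (\<Sum>i\<in>{True, False}. chart_integral (ch a) (\<lambda>m. if i then \<rho> a m * D m else dir_deriv (\<rho> a) m))"
      by simp
    also have "\<dots> = chart_integral (ch a) (\<lambda>m. \<Sum>i\<in>{True, False}. if i then \<rho> a m * D m else dir_deriv (\<rho> a) m)"
    proof (rule chart_integral_sum[OF comp u(1), symmetric])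
      show "supported_in (fst (ch a)) (\<lambda>m. if i then \<rho> a m * D m else dir_deriv (\<rho> a) m)"
        "Ck_fun 0 (\<lambda>m. if i then \<rho> a m * D m else dir_deriv (\<rho> a) m)" for i
        using \<rho>D0 \<rho>D_supp d0 d_supp by (cases i; simp)+
    qed simp
    also have "\<dots> = 0"
      using chart_integral_divergence[OF comp u(1) \<rho>_supp \<rho>1 D[OF u(1)]] by simp
    finally show ?thesis .
  qed
  then have "(\<Sum>a\<in>I. chart_integral (ch a) (\<lambda>m. \<rho> a m * D m)) = 0"
    using dsum by (metis (no_types, lifting) add.right_neutral sum.distrib sum.neutral)
  moreover have \<rho>_nonneg: "\<rho> a m \<ge> 0" for a m
    using u(4)[of a m] s_pos[of m] by (simp add: \<rho>_def)
  have integrand_nonneg: "0 \<le> (if x \<in> chart_image (ch a) then dens (ch a) x * (\<rho> a (chart_inv (ch a) x) * D (chart_inv (ch a) x)) else 0)" for a x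
    using metric_chart.density_pos[OF chart_metric[OF u(1)], of x a] \<rho>_nonneg nonneg by (simp add: less_imp_le)
  then have "chart_integral (ch a) (\<lambda>m. \<rho> a m * D m) \<ge> 0" for a
    unfolding chart_integral_def by (intro Bochner_Integration.integral_nonneg)
  ultimately have int0: "chart_integral (ch a) (\<lambda>m. \<rho> a m * D m) = 0" if "a \<in> I" for a
    using that I(1) by (simp add: sum_nonneg_eq_0_iff)
  obtain a where a: "a \<in> I" "u a m > 0" using I(2) by auto
  have m: "m \<in> fst (ch a)"
    using u(3)[of a] a(2) unfolding supported_in_def by fastforce
  let ?f = "\<lambda>x. dens (ch a) x * (\<rho> a (chart_inv (ch a) x) * D (chart_inv (ch a) x))"
  let ?F = "\<lambda>x. if x \<in> chart_image (ch a) then ?f x else 0"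
  have "Ck_on 0 (chart_image (ch a)) ?f"
    using \<rho>0[of a] D_cont u(1) by (intro Ck_on_mult open_image Ck_on_dens) (auto simp: Ck_fun_def)
  then have cont: "continuous_on (chart_image (ch a)) ?f" by simp
  have "AE x in lborel. ?F x = 0"
    using int0[OF a(1)] integral_nonneg_eq_0_iff_AE[OF integrable_chart[OF comp u(1) \<rho>D_supp \<rho>D0]] integrand_nonneg
    unfolding chart_integral_def by simp
  then have ae: "AE x in lborel. x \<in> chart_image (ch a) \<longrightarrow> ?f x = 0"
    by (rule AE_mp) (auto intro!: AE_I2)
  have "?f (snd (ch a) m) = 0"
  proof (rule ccontr)
    assume ne: "?f (snd (ch a) m) \<noteq> 0"
    \<comment> \<open>The set where the integrand does not vanish is open by continuity and null by
      \<open>ae\<close>, and an open null set is empty.\<close>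
    let ?W = "chart_image (ch a) \<inter> ?f -` (- {0})"
    have W: "open ?W"
      by (rule continuous_open_preimage[OF cont open_image[OF u(1)]]) auto
    have "AE x in lborel. x \<notin> ?W" using ae by (rule AE_mp) (auto intro!: AE_I2)
    moreover have "?W \<in> sets lborel" using W by (simp only: sets_lborel borel_open)
    ultimately have "?W \<in> null_sets lborel" by (simp only: AE_iff_null_sets)
    then have "negligible ?W" using negligible_iff_null_sets null_sets_completionI by blast
    moreover have "snd (ch a) m \<in> ?W" using ne m u(1) by simp
    ultimately show False using W open_not_negligible by blast
  qed
  then have "dens (ch a) (snd (ch a) m) * (\<rho> a m * D m) = 0"
    using m u(1) by simp
  moreover have "dens (ch a) (snd (ch a) m) \<noteq> 0"
    using metric_chart.density_pos[OF chart_metric[OF u(1)], of "snd (ch a) m" a] m u(1) by simp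
  moreover have "\<rho> a m \<noteq> 0" using a(2) s_pos[of m] by (simp add: \<rho>_def)
  ultimately show ?thesis by simp
qed

end

lemma sum_mult_double_sum:
  fixes f :: "'i \<Rightarrow> real"
  shows "(\<Sum>k\<in>I. f k * (\<Sum>a\<in>A. \<Sum>b\<in>B. F k a b)) = (\<Sum>a\<in>A. \<Sum>b\<in>B. \<Sum>k\<in>I. f k * F k a b)"
proof -
  have "(\<Sum>k\<in>I. f k * (\<Sum>a\<in>A. \<Sum>b\<in>B. F k a b)) = (\<Sum>a\<in>A. \<Sum>k\<in>I. \<Sum>b\<in>B. f k * F k a b)"
    unfolding sum_distrib_left by (rule sum.swap)
  also have "\<dots> = (\<Sum>a\<in>A. \<Sum>b\<in>B. \<Sum>k\<in>I. f k * F k a b)"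
    by (intro sum.cong refl sum.swap)
  finally show ?thesis .
qed

text \<open>The pointwise algebra behind the tensoriality of the Lie derivative: \<open>J\<close> is
  the Jacobian, \<open>h\<close> and \<open>Y\<close> are the components in the target chart, and a
  prefix \<open>d\<close> with an extra first index marks partial derivatives. Second derivatives of
  the transition, collected in \<open>P\<close>, enter on the left through the metric and on the
  right through \<open>Y\<close>; they match because those derivatives are symmetric.\<close>

lemma lie_derivative_transform_algebra:
  fixes J :: "'n::finite \<Rightarrow> 'n \<Rightarrow> real"
  assumes g: "\<And>i j. g i j = (\<Sum>a\<in>UNIV. \<Sum>b\<in>UNIV. J a i * J b j * h a b)"
    and dg: "\<And>k i j. dg k i j = (\<Sum>a\<in>UNIV. \<Sum>b\<in>UNIV. dJ k a i * J b j * h a b + J a i * dJ k b j * h a b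
      + J a i * J b j * (\<Sum>c\<in>UNIV. J c k * dh c a b))"
    and Y: "\<And>c. Y c = (\<Sum>k\<in>UNIV. J c k * X k)"
    and dY: "\<And>a i. (\<Sum>c\<in>UNIV. J c i * dY c a) = (\<Sum>k\<in>UNIV. dJ i a k * X k + J a k * dX i k)"
    and sym: "\<And>i a k. dJ i a k = dJ k a i"
  shows "(\<Sum>k\<in>UNIV. X k * dg k i j + g k j * dX i k + g i k * dX j k)
    = (\<Sum>a\<in>UNIV. \<Sum>b\<in>UNIV. J a i * J b j * (\<Sum>c\<in>UNIV. Y c * dh c a b + h c b * dY a c + h a c * dY b c))"
proof -
  define P where "P a i = (\<Sum>k\<in>UNIV. X k * dJ i a k)" for a i
  define R where "R a i = (\<Sum>k\<in>UNIV. dX i k * J a k)" for a i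
  have E: "(\<Sum>c\<in>UNIV. J c i * dY c a) = P a i + R a i" for a i
    unfolding dY P_def R_def by (simp add: sum.distrib mult.commute)
  have 1: "(\<Sum>k\<in>UNIV. X k * dg k i j) = (\<Sum>a\<in>UNIV. \<Sum>b\<in>UNIV. P a i * J b j * h a b + J a i * P b j * h a b
      + J a i * J b j * (\<Sum>c\<in>UNIV. Y c * dh c a b))"
    unfolding dg sum_mult_double_sum
  proof (intro sum.cong refl)
    fix a b
    have "(\<Sum>c\<in>UNIV. Y c * dh c a b) = (\<Sum>k\<in>UNIV. X k * (\<Sum>c\<in>UNIV. J c k * dh c a b))"
      unfolding Y sum_distrib_left sum_distrib_right by (subst sum.swap) (simp add: mult_ac)
    moreover have "P a i = (\<Sum>k\<in>UNIV. X k * dJ k a i)" for a i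
      unfolding P_def by (rule sum.cong) (simp_all add: sym[of i])
    ultimately show "(\<Sum>k\<in>UNIV. X k * (dJ k a i * J b j * h a b + J a i * dJ k b j * h a b + J a i * J b j * (\<Sum>c\<in>UNIV. J c k * dh c a b)))
      = P a i * J b j * h a b + J a i * P b j * h a b + J a i * J b j * (\<Sum>c\<in>UNIV. Y c * dh c a b)"
      by (simp only: distrib_left sum.distrib sum_distrib_left[of _ _ UNIV] sum_distrib_right mult_ac)
  qed
  have 2: "(\<Sum>k\<in>UNIV. g k j * dX i k) = (\<Sum>a\<in>UNIV. \<Sum>b\<in>UNIV. R a i * J b j * h a b)"
  proof -
    have "(\<Sum>k\<in>UNIV. g k j * dX i k) = (\<Sum>k\<in>UNIV. dX i k * (\<Sum>a\<in>UNIV. \<Sum>b\<in>UNIV. J a k * J b j * h a b))"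
      unfolding g by (simp add: mult.commute)
    then show ?thesis unfolding sum_mult_double_sum R_def by (simp add: sum_distrib_right mult.assoc)
  qed
  have 3: "(\<Sum>k\<in>UNIV. g i k * dX j k) = (\<Sum>a\<in>UNIV. \<Sum>b\<in>UNIV. J a i * R b j * h a b)"
  proof -
    have "(\<Sum>k\<in>UNIV. g i k * dX j k) = (\<Sum>k\<in>UNIV. dX j k * (\<Sum>a\<in>UNIV. \<Sum>b\<in>UNIV. J a i * J b k * h a b))"
      unfolding g by (simp add: mult.commute)
    then show ?thesis unfolding sum_mult_double_sum R_def by (simp add: sum_distrib_right sum_distrib_left mult_ac)
  qed
  have 4: "(\<Sum>a\<in>UNIV. \<Sum>b\<in>UNIV. J a i * J b j * (\<Sum>c\<in>UNIV. h c b * dY a c)) = (\<Sum>a\<in>UNIV. \<Sum>b\<in>UNIV. (P a i + R a i) * J b j * h a b)"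
  proof -
    have "(\<Sum>a\<in>UNIV. \<Sum>b\<in>UNIV. J a i * J b j * (\<Sum>c\<in>UNIV. h c b * dY a c))
      = (\<Sum>a\<in>UNIV. J a i * (\<Sum>c\<in>UNIV. \<Sum>b\<in>UNIV. J b j * h c b * dY a c))"
      unfolding sum_distrib_left by (subst (2) sum.swap) (simp add: mult_ac)
    also have "\<dots> = (\<Sum>c\<in>UNIV. \<Sum>b\<in>UNIV. \<Sum>a\<in>UNIV. J a i * (J b j * h c b * dY a c))"
      by (rule sum_mult_double_sum)
    finally show ?thesis unfolding E[symmetric] by (simp add: sum_distrib_right sum_distrib_left mult_ac)
  qed
  have 5: "(\<Sum>a\<in>UNIV. \<Sum>b\<in>UNIV. J a i * J b j * (\<Sum>c\<in>UNIV. h a c * dY b c)) = (\<Sum>a\<in>UNIV. \<Sum>b\<in>UNIV. J a i * (P b j + R b j) * h a b)"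
  proof (rule sum.cong)
    fix a :: 'n
    have "(\<Sum>b\<in>UNIV. J a i * J b j * (\<Sum>c\<in>UNIV. h a c * dY b c)) = (\<Sum>c\<in>UNIV. \<Sum>b\<in>UNIV. J a i * (J b j * (h a c * dY b c)))"
      unfolding sum_distrib_left by (subst sum.swap) (simp add: mult_ac)
    then show "(\<Sum>b\<in>UNIV. J a i * J b j * (\<Sum>c\<in>UNIV. h a c * dY b c)) = (\<Sum>b\<in>UNIV. J a i * (P b j + R b j) * h a b)"
      unfolding E[symmetric] by (simp add: sum_distrib_right sum_distrib_left mult_ac)
  qed simp
  have "(\<Sum>a\<in>UNIV. \<Sum>b\<in>UNIV. J a i * J b j * (\<Sum>c\<in>UNIV. Y c * dh c a b + h c b * dY a c + h a c * dY b c))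
    = (\<Sum>a\<in>UNIV. \<Sum>b\<in>UNIV. J a i * J b j * (\<Sum>c\<in>UNIV. Y c * dh c a b))
      + (\<Sum>a\<in>UNIV. \<Sum>b\<in>UNIV. J a i * J b j * (\<Sum>c\<in>UNIV. h c b * dY a c))
      + (\<Sum>a\<in>UNIV. \<Sum>b\<in>UNIV. J a i * J b j * (\<Sum>c\<in>UNIV. h a c * dY b c))"
    by (simp only: sum.distrib distrib_left)
  then show ?thesis
    unfolding 4 5 by (simp only: sum.distrib 1 2 3 distrib_left distrib_right)
qed

section \<open>Change of chart\<close>

context riemannian_vector_field
begin

lemma partial_deriv_transition:
  assumes c: "c \<in> A" and d: "d \<in> A" and x: "x \<in> overlap c d"
    and f: "f differentiable (at (transition c d x))"
  shows "(\<lambda>z. f (transition c d z)) differentiable (at x)"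
    and "partial_deriv k (\<lambda>z. f (transition c d z)) x
      = (\<Sum>a\<in>UNIV. jacobian c d x $ a $ k * partial_deriv a f (transition c d x))"
proof -
  have f': "(f has_derivative frechet_derivative f (at (transition c d x))) (at (transition c d x))"
    using f by (simp add: frechet_derivative_works)
  note chain = has_derivative_compose[OF has_derivative_transition[OF c d x] f']
  then show "(\<lambda>z. f (transition c d z)) differentiable (at x)"
    by (auto simp: differentiable_def)
  have "frechet_derivative (transition c d) (at x) (axis k 1) $ a = jacobian c d x $ a $ k" for a
    by (simp add: jacobian_def matrix_def)
  then show "partial_deriv k (\<lambda>z. f (transition c d z)) x
      = (\<Sum>a\<in>UNIV. jacobian c d x $ a $ k * partial_deriv a f (transition c d x))"
    unfolding partial_deriv_eq[OF chain] has_derivative_partial_deriv[OF f'] by simp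
qed

lemma jacobian_component:
  assumes "c \<in> A" "d \<in> A" "x \<in> overlap c d"
  shows "jacobian c d x $ a $ k = partial_deriv k (\<lambda>z. transition c d z $ a) x"
proof -
  have "((\<lambda>z. transition c d z $ a) has_derivative (\<lambda>v. frechet_derivative (transition c d) (at x) v $ a)) (at x)"
    by (rule bounded_linear.has_derivative[OF bounded_linear_vec_nth has_derivative_transition[OF assms]])
  then show ?thesis by (simp add: partial_deriv_eq jacobian_def matrix_def)
qed

text \<open>Serves to make \<open>p\<close>, and with it \<open>J\<close>, independent of the chart.
  The inputs of the algebraic lemma come from differentiating the transformation laws of
  \<open>g\<close> and \<open>X\<close> on the overlap.\<close>

lemma lie_deriv_transform:
  assumes c: "c \<in> A" and d: "d \<in> A" and x: "x \<in> overlap c d"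
  shows "lie_deriv_metric (g c) (X c) x i j
    = (\<Sum>a\<in>UNIV. \<Sum>b\<in>UNIV. jacobian c d x $ a $ i * jacobian c d x $ b $ j * lie_deriv_metric (g d) (X d) (transition c d x) a b)"
proof -
  let ?O = "overlap c d" and ?y = "transition c d x"
  interpret C: metric_chart "chart_image c" "g c" by (rule chart_metric[OF c])
  interpret D: metric_chart "chart_image d" "g d" by (rule chart_metric[OF d])
  have O: "open ?O" by (rule open_overlap[OF c d])
  have xc: "x \<in> chart_image c" using x overlap_iff[OF c] by blast
  have yd: "?y \<in> chart_image d" by (rule transition_in_image[OF c d x])
  define J where "J z a k = partial_deriv k (\<lambda>z. transition c d z $ a) z" for z a k
  have J: "jacobian c d z $ a $ k = J z a k" if "z \<in> ?O" for z a k
    unfolding J_def by (rule jacobian_component[OF c d that])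
  have sm_T: "smooth_on ?O (\<lambda>z. transition c d z $ a)" for a
    using Ck_on_transition[OF c d] by (intro smooth_on_component[OF O]) (simp add: smooth_on_def)
  have J_diff: "(\<lambda>z. J z a k) differentiable (at x)" for a k
    unfolding J_def by (rule smooth_on_differentiable[OF smooth_on_partial_deriv[OF sm_T] x])
  have sm_X: "smooth_on (chart_image c) (\<lambda>x. X c x $ i)" if "c \<in> A" for c i
    using vector_field that smooth_on_component[OF open_image] unfolding smooth_vector_field_def by blast
  have Xc_diff: "(\<lambda>z. X c z $ i) differentiable (at x)" for i
    by (rule smooth_on_differentiable[OF sm_X[OF c] xc])
  have Xd_diff: "(\<lambda>z. X d z $ i) differentiable (at ?y)" for i
    by (rule smooth_on_differentiable[OF sm_X[OF d] yd])
  have gd_diff: "(\<lambda>z. g d z $ a $ b) differentiable (at ?y)" for a b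
    by (rule smooth_on_differentiable[OF D.sm_G yd])
  have g_eq: "g c z $ i $ j = (\<Sum>a\<in>UNIV. \<Sum>b\<in>UNIV. J z a i * J z b j * g d (transition c d z) $ a $ b)"
    if z: "z \<in> ?O" for z i j
  proof -
    have "g c z = transpose (jacobian c d z) ** g d (transition c d z) ** jacobian c d z"
      using metric c d z unfolding riemannian_metric_def by blast
    then have "g c z $ i $ j = (\<Sum>b\<in>UNIV. (\<Sum>a\<in>UNIV. J z a i * g d (transition c d z) $ a $ b) * J z b j)"
      by (simp add: matrix_matrix_mult_def transpose_def J[OF z])
    also have "\<dots> = (\<Sum>a\<in>UNIV. \<Sum>b\<in>UNIV. J z a i * J z b j * g d (transition c d z) $ a $ b)"
      unfolding sum_distrib_right by (subst sum.swap) (simp add: mult_ac)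
    finally show ?thesis .
  qed
  have X_eq: "X d (transition c d z) $ a = (\<Sum>k\<in>UNIV. J z a k * X c z $ k)" if z: "z \<in> ?O" for z a
  proof -
    have "X d (transition c d z) = jacobian c d z *v X c z"
      using vector_field c d z unfolding smooth_vector_field_def by blast
    then show ?thesis by (simp add: matrix_vector_mult_def J[OF z])
  qed
  show ?thesis
    unfolding lie_deriv_metric_def J[OF x]
  proof (rule lie_derivative_transform_algebra[where dJ = "\<lambda>k a i. partial_deriv k (\<lambda>z. J z a i) x"])
    show "g c x $ i $ j = (\<Sum>a\<in>UNIV. \<Sum>b\<in>UNIV. J x a i * J x b j * g d ?y $ a $ b)" for i j
      by (rule g_eq[OF x])
    show "X d ?y $ a = (\<Sum>k\<in>UNIV. J x a k * X c x $ k)" for a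
      by (rule X_eq[OF x])
    show "partial_deriv k (\<lambda>y. g c y $ i $ j) x = (\<Sum>a\<in>UNIV. \<Sum>b\<in>UNIV. partial_deriv k (\<lambda>z. J z a i) x * J x b j * g d ?y $ a $ b
       + J x a i * partial_deriv k (\<lambda>z. J z b j) x * g d ?y $ a $ b
       + J x a i * J x b j * (\<Sum>e\<in>UNIV. J x e k * partial_deriv e (\<lambda>y. g d y $ a $ b) ?y))" for k i j
    proof -
      have "partial_deriv k (\<lambda>y. g c y $ i $ j) x
        = partial_deriv k (\<lambda>z. \<Sum>a\<in>UNIV. \<Sum>b\<in>UNIV. J z a i * J z b j * g d (transition c d z) $ a $ b) x"
        by (rule partial_deriv_cong[OF O x g_eq])
      then show ?thesis
        using partial_deriv_transition[OF c d x gd_diff] J_diff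
        by (simp add: partial_deriv_sum partial_deriv_mult J[OF x] algebra_simps)
    qed
    show "(\<Sum>e\<in>UNIV. J x e i * partial_deriv e (\<lambda>y. X d y $ a) ?y)
      = (\<Sum>k\<in>UNIV. partial_deriv i (\<lambda>z. J z a k) x * X c x $ k + J x a k * partial_deriv i (\<lambda>y. X c y $ k) x)" for a i
    proof -
      have "partial_deriv i (\<lambda>z. X d (transition c d z) $ a) x = partial_deriv i (\<lambda>z. \<Sum>k\<in>UNIV. J z a k * X c z $ k) x"
        by (rule partial_deriv_cong[OF O x X_eq])
      then show ?thesis
        using partial_deriv_transition[OF c d x Xd_diff] J_diff Xc_diff
        by (simp add: partial_deriv_sum partial_deriv_mult J[OF x] algebra_simps)
    qed
    show "partial_deriv i (\<lambda>z. J z a k) x = partial_deriv k (\<lambda>z. J z a i) x" for i a k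
      unfolding J_def by (rule partial_deriv_commute[OF O x sm_T])
  qed
qed

text \<open>The nonnegative case applied to the field \<open>- X\<close>, whose divergence is
  \<open>- D\<close>.\<close>

lemma divergence_nonpos_imp_eq_0:
  assumes comp: "compact (UNIV :: 'm set)"
    and D: "\<And>c x. c \<in> A \<Longrightarrow> x \<in> chart_image c \<Longrightarrow> divergence c x = D (chart_inv c x)"
    and D_cont: "Ck_fun 0 D" and nonpos: "\<And>m. D m \<le> 0"
  shows "D m = 0"
proof -
  interpret N: riemannian_vector_field A g "\<lambda>c x. - X c x"
  proof
    show "smooth_vector_field A (\<lambda>c x. - X c x)"
      unfolding smooth_vector_field_def
    proof (intro conjI ballI)
      fix c assume c: "c \<in> A"
      show "smooth_on (chart_image c) (\<lambda>x. - X c x)"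
        using vector_field c Ck_on_linear[OF open_image[OF c] bounded_linear_minus[OF bounded_linear_ident]]
        unfolding smooth_vector_field_def smooth_on_def by blast
      fix d x assume dx: "d \<in> A" "x \<in> overlap c d"
      then have "X d (transition c d x) = jacobian c d x *v X c x"
        using vector_field c unfolding smooth_vector_field_def by blast
      then show "- X d (transition c d x) = jacobian c d x *v - X c x"
        by (simp add: matrix_vector_mult_def vec_eq_iff sum_negf)
    qed
  qed (fact atlas metric)+
  have "- D m = 0"
  proof (rule N.divergence_nonneg_imp_eq_0[OF comp])
    fix c x assume c: "c \<in> A" and x: "x \<in> chart_image c"
    have "smooth_on (chart_image c) (\<lambda>x. X c x $ i)" for i
      using vector_field c smooth_on_component[OF open_image] unfolding smooth_vector_field_def by blast
    then have "partial_deriv i (\<lambda>y. - X c y $ i) x = - partial_deriv i (\<lambda>y. X c y $ i) x" for i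
      using partial_deriv_diff[of "\<lambda>_. 0" x "\<lambda>y. X c y $ i" i] x smooth_on_differentiable by fastforce
    then show "N.divergence c x = - D (chart_inv c x)"
      using D[OF c x] by (simp add: N.divergence_def divergence_def sum_negf)
  next
    show "Ck_fun 0 (\<lambda>m. - D m)"
      using D_cont by (auto simp: Ck_fun_def intro: continuous_on_minus)
  qed (use nonpos in auto)
  then show ?thesis by simp
qed

end

section \<open>Compact Riemann solitons\<close>

theorem theorem1:
  fixes A :: "('m::{t2_space, second_countable_topology}, 'n::finite) chart set"
    and g :: "('m, 'n) chart \<Rightarrow> real ^ 'n \<Rightarrow> real ^ 'n ^ 'n"
    and X :: "('m, 'n) chart \<Rightarrow> real ^ 'n \<Rightarrow> real ^ 'n"
    and lam :: real
  assumes "CARD('n) \<ge> 3"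
    and "riemann_soliton A g X lam"
    and "compact (UNIV :: 'm set)"
  shows "trivial_soliton A g X"
proof -
  interpret riemannian_vector_field A g X
    using assms(2) by unfold_locales (auto simp: riemann_soliton_def)
  have chart_soliton: "soliton_chart (chart_image c) (g c) (X c) lam" if c: "c \<in> A" for c
  proof -
    interpret metric_chart "chart_image c" "g c" by (rule chart_metric[OF c])
    show ?thesis
    proof
      show "smooth_on (chart_image c) (X c)"
        using vector_field c unfolding smooth_vector_field_def by blast
    qed (use assms(1,2) c in \<open>auto simp: riemann_soliton_def Let_def\<close>)
  qed
  define Jc where "Jc c = soliton_chart.J (g c) (X c) lam" for c
  define a where "a = real CARD('n) * lam / 2"
  have J_transition: "Jc c x = Jc d (transition c d x)" if c: "c \<in> A" and d: "d \<in> A" and x: "x \<in> overlap c d" for c d x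
  proof -
    interpret C: soliton_chart "chart_image c" "g c" "X c" lam by (rule chart_soliton[OF c])
    interpret D: soliton_chart "chart_image d" "g d" "X d" lam by (rule chart_soliton[OF d])
    let ?y = "transition c d x"
    define M where "M = jacobian c d x"
    define pc :: "real ^ 'n ^ 'n" where "pc = (\<chi> i j. C.p x i j)"
    define pd :: "real ^ 'n ^ 'n" where "pd = (\<chi> i j. D.p ?y i j)"
    have xc: "x \<in> chart_image c" using x overlap_iff[OF c] by blast
    have yd: "?y \<in> chart_image d" by (rule transition_in_image[OF c d x])
    have g: "g c x = transpose M ** g d ?y ** M"
      using metric c d x unfolding riemannian_metric_def M_def by blast
    have mm: "(transpose M ** N ** M) $ i $ j = (\<Sum>a\<in>UNIV. \<Sum>b\<in>UNIV. M $ a $ i * M $ b $ j * N $ a $ b)" for N i j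
      unfolding matrix_matrix_mult_def transpose_def sum_distrib_right vec_lambda_beta
      by (subst sum.swap) (simp add: mult_ac)
    have p: "pc = transpose M ** pd ** M"
    proof -
      have "pc $ i $ j = (transpose M ** pd ** M) $ i $ j" for i j
        unfolding mm pc_def pd_def vec_lambda_beta C.p_def D.p_def lie_deriv_transform[OF c d x] g mm M_def[symmetric]
        by (simp add: right_diff_distrib sum_subtractf sum_distrib_left sum_divide_distrib mult_ac)
      then show ?thesis by (simp add: vec_eq_iff)
    qed
    \<comment> \<open>Metric and Schouten tensor are both congruent by \<open>M\<close> to their
      counterparts in the other chart, so the endomorphisms are conjugate by \<open>M\<close> and
      have the same trace. \<open>N\<close> is the inverse of \<open>M\<close>.\<close>
    have "det M \<noteq> 0"
      using C.det_G[OF xc] unfolding g by (auto simp: det_mul)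
    then obtain N where N: "M ** N = mat 1" "N ** M = mat 1"
      using invertible_det_nz[of M] unfolding invertible_def by blast
    have NT: "transpose N ** transpose M = mat 1"
      using N(1) by (metis matrix_transpose_mul transpose_mat)
    let ?I = "N ** matrix_inv (g d ?y) ** transpose N"
    have "?I ** g c x = N ** (matrix_inv (g d ?y) ** ((transpose N ** transpose M) ** g d ?y)) ** M"
      unfolding g by (simp add: matrix_mul_assoc)
    then have "?I ** g c x = mat 1"
      using D.inverse_G(2)[OF yd] N NT by simp
    then have I: "matrix_inv (g c x) = ?I"
      by (metis C.inverse_G(1)[OF xc] matrix_mul_assoc matrix_mul_lid matrix_mul_rid)
    have "matrix_inv (g c x) ** pc = N ** (matrix_inv (g d ?y) ** ((transpose N ** transpose M) ** pd)) ** M"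
      unfolding I p by (simp add: matrix_mul_assoc)
    then have "trace (matrix_inv (g c x) ** pc) = trace (N ** (matrix_inv (g d ?y) ** pd ** M))"
      using NT by (simp add: matrix_mul_assoc)
    also have "\<dots> = trace (matrix_inv (g d ?y) ** pd)"
      by (subst trace_mul_sym) (simp add: matrix_mul_assoc[symmetric] N)
    finally show ?thesis
      unfolding Jc_def C.J_def D.J_def C.Q_def D.Q_def
      by (simp add: trace_def matrix_matrix_mult_def pc_def pd_def)
  qed
  \<comment> \<open>\<open>J\<close> as a function on the manifold; the choice of the chart is
    immaterial by \<open>J_transition\<close>.\<close>
  define Jm where "Jm m = (let c = (SOME c. c \<in> A \<and> m \<in> fst c) in Jc c (snd c m))" for m
  have Jm: "Jm (chart_inv d y) = Jc d y" if d: "d \<in> A" and y: "y \<in> chart_image d" for d y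
  proof -
    define m where "m = chart_inv d y"
    define c where "c = (SOME c. c \<in> A \<and> m \<in> fst c)"
    have "c \<in> A \<and> m \<in> fst c"
      unfolding c_def by (rule someI_ex) (metis chart_exists)
    then have c: "c \<in> A" "m \<in> fst c" by auto
    have x: "snd c m \<in> overlap c d"
      using overlap_iff[OF c(1)] c d y by (simp add: m_def)
    have "transition c d (snd c m) = y"
      using c d y by (simp add: transition_def) (simp add: m_def)
    then show ?thesis
      using J_transition[OF c(1) d x] by (simp add: Jm_def Let_def c_def[symmetric] m_def[symmetric])
  qed
  have J_cont: "Ck_fun 0 Jm"
    unfolding Ck_fun_def
  proof
    fix c assume c: "c \<in> A"
    interpret soliton_chart "chart_image c" "g c" "X c" lam by (rule chart_soliton[OF c])
    have "Ck_on 0 (chart_image c) (Jc c)"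
      using sm_tensors(4) unfolding Jc_def smooth_on_def by blast
    then show "Ck_on 0 (chart_image c) (\<lambda>x. Jm (chart_inv c x))"
      using Jm[OF c] by (simp cong: continuous_on_cong)
  qed
  have crit: "Jm m * (Jm m - a) \<le> 0" if ext: "(\<forall>z. Jm z \<le> Jm m) \<or> (\<forall>z. Jm m \<le> Jm z)" for m
  proof -
    obtain c where c: "c \<in> A" "m \<in> fst c" by (rule chart_exists)
    interpret soliton_chart "chart_image c" "g c" "X c" lam by (rule chart_soliton[OF c(1)])
    define x where "x = snd c m"
    have x: "x \<in> chart_image c" "m = chart_inv c x" using c by (simp_all add: x_def)
    have d: "(Jc c has_derivative frechet_derivative (Jc c) (at x)) (at x)"
      using smooth_on_differentiable[OF sm_tensors(4) x(1)] by (simp add: Jc_def frechet_derivative_works)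
    have "frechet_derivative (Jc c) (at x) = (\<lambda>v. 0)"
    proof (rule differential_zero_maxmin[OF x(1) open_U d])
      show "(\<forall>y\<in>chart_image c. Jc c y \<le> Jc c x) \<or> (\<forall>y\<in>chart_image c. Jc c x \<le> Jc c y)"
        using ext Jm[OF c(1)] x by metis
    qed
    then have "partial_deriv i J x = 0" for i
      by (simp add: partial_deriv_def Jc_def)
    from J_critical_point[OF x(1) this] show ?thesis
      using Jm[OF c(1) x(1)] by (simp add: x(2) Jc_def a_def)
  qed
  have J_cont': "continuous_on UNIV Jm" by (rule continuous_Ck_fun[OF J_cont])
  obtain m1 where m1: "\<And>z. Jm z \<le> Jm m1"
    using continuous_attains_sup[OF assms(3) _ J_cont'] by auto
  obtain m2 where m2: "\<And>z. Jm m2 \<le> Jm z"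
    using continuous_attains_inf[OF assms(3) _ J_cont'] by auto
  have div: "divergence c x = a - Jm (chart_inv c x)" if c: "c \<in> A" and x: "x \<in> chart_image c" for c x
  proof -
    interpret soliton_chart "chart_image c" "g c" "X c" lam by (rule chart_soliton[OF c])
    have "(\<Sum>i\<in>UNIV. (\<Sum>r\<in>UNIV. Gam x r r i) * X c x $ i) = (\<Sum>m\<in>UNIV. \<Sum>k\<in>UNIV. Gam x m m k * X c x $ k)"
      unfolding sum_distrib_right by (rule sum.swap)
    then show ?thesis
      using trace_K[OF x] Jm[OF c x] unfolding divergence_def K_def by (simp add: sum.distrib a_def Jc_def)
  qed
  have D_cont: "Ck_fun 0 (\<lambda>m. a - Jm m)"
    using J_cont by (auto simp: Ck_fun_def intro: continuous_intros)
  have "a - Jm m = 0" for m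
  proof (cases "a \<ge> 0")
    case True
    \<comment> \<open>At a value above \<open>a \<ge> 0\<close>, and likewise at a value below a
      negative \<open>a\<close>, the two factors in \<open>crit\<close> would have the same strict
      sign.\<close>
    have "Jm m1 \<le> a" using crit[of m1] m1 True by (auto simp: mult_le_0_iff)
    then have "a - Jm z \<ge> 0" for z using m1[of z] by linarith
    then show ?thesis using divergence_nonneg_imp_eq_0[OF assms(3) div D_cont] by blast
  next
    case False
    have "Jm m2 \<ge> a" using crit[of m2] m2 False by (auto simp: mult_le_0_iff)
    then have "a - Jm z \<le> 0" for z using m2[of z] by linarith
    then show ?thesis using divergence_nonpos_imp_eq_0[OF assms(3) div D_cont] by blast
  qed
  then have J_const: "Jc c x = a" if "c \<in> A" "x \<in> chart_image c" for c x
    using Jm[OF that] by (metis eq_iff_diff_eq_0)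
  show ?thesis
    unfolding trivial_soliton_def
  proof (intro ballI allI)
    fix c x i j assume c: "c \<in> A" and x: "x \<in> chart_image c"
    interpret soliton_chart "chart_image c" "g c" "X c" lam by (rule chart_soliton[OF c])
    show "lie_deriv_metric (g c) (X c) x i j = 0"
      using J_const[OF c] by (intro lie_deriv_eq_0_if_J_const x) (simp add: Jc_def a_def)
  qed
qed

end
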